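(* Let $(M,g)$ be a compact Riemannian manifold with constant scalar curvature, let $\pi:(M,g)\to(B,\check g)$ be a Riemannian submersion with totally geodesic $S^1$ fibers, and suppose $X$ is a smooth vector field on $M$ tangent to the fibers of $\pi$. If $(M,g,X)$ is quasi-Einstein, then $|A|$ is constant and $B$ has constant scalar curvature.
   Context: All manifolds are without boundary. A triple $(M,g,X)$ is quasi-Einstein if $\mathrm{Ric} + \frac{1}{2}\mathcal{L}_X g - \frac{1}{m} X^*\otimes X^* = \lambda g$ for some real constants $m \neq 0$ and $\lambda$, where $X^* = g(X,\cdot)$. Let $\mathcal V=\ker d\pi$ and $\mathcal H=\mathcal V^\perp$, also denoting the corresponding projections. O'Neill's tensor is $A_{E_1}E_2=\mathcal H\nabla_{\mathcal HE_1}\mathcal VE_2+\mathcal V\nabla_{\mathcal HE_1}\mathcal HE_2$, and $|A|^2=\sum_i g(A_{Y_i}U,A_{Y_i}U)$ for an orthonormal basis $\{Y_i\}$ of $\mathcal H$ and a unit vertical vector $U$. *)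

theory Defs
  imports "HOL-Analysis.Analysis"
begin

section \<open>Model spaces and smooth functions\<close>

text \<open>Finite-dimensional inner product spaces. Unlike \<^class>\<open>euclidean_space\<close>, dimension 0 is
  allowed, so that zero-dimensional manifolds are covered. The inner product of the model space
  plays no role in the geometry; it only provides a norm.\<close>

class findim_inner = real_inner +
  assumes finite_spanning: "\<exists>E. finite E \<and> (\<forall>x. \<exists>c. x = (\<Sum>e\<in>E. c e *\<^sub>R e))"

instance euclidean_space \<subseteq> findim_inner
proof
  show "\<exists>E. finite E \<and> (\<forall>x::'a. \<exists>c. x = (\<Sum>e\<in>E. c e *\<^sub>R e))"
  proof (intro exI[of _ Basis] conjI allI)
    fix x :: 'a
    show "\<exists>c. x = (\<Sum>e\<in>Basis. c e *\<^sub>R e)"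
      by (rule exI[of _ "\<lambda>e. x \<bullet> e"]) (simp add: euclidean_representation)
  qed simp
qed

text \<open>\<open>dd f x v\<close> is the derivative of \<open>f\<close> at \<open>x\<close> in direction \<open>v\<close>.\<close>

definition dd :: "('v::real_normed_vector \<Rightarrow> 'w::real_normed_vector) \<Rightarrow> 'v \<Rightarrow> 'v \<Rightarrow> 'w" where
  "dd f x v = frechet_derivative f (at x) v"

primrec C_k_on :: "nat \<Rightarrow> 'v::real_normed_vector set \<Rightarrow> ('v \<Rightarrow> 'w::real_normed_vector) \<Rightarrow> bool" where
  "C_k_on 0 S f \<longleftrightarrow> continuous_on S f"
| "C_k_on (Suc k) S f \<longleftrightarrow>
     (\<forall>x\<in>S. f differentiable (at x)) \<and> (\<forall>v. C_k_on k S (\<lambda>x. dd f x v))"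

text \<open>Only used on open subsets of finite-dimensional spaces.\<close>

definition smooth_on :: "'v::real_normed_vector set \<Rightarrow> ('v \<Rightarrow> 'w::real_normed_vector) \<Rightarrow> bool" where
  "smooth_on S f \<longleftrightarrow> (\<forall>k. C_k_on k S f)"


section \<open>Smooth manifolds\<close>

text \<open>A chart is a pair of its domain and its coordinate map; the values of the map outside the
  domain are irrelevant. The atlas need not be maximal.\<close>

type_synonym ('a, 'v) chart = "'a set \<times> ('a \<Rightarrow> 'v)"

record ('a, 'v) mfd =
  mtop :: "'a topology"
  charts :: "('a, 'v) chart set"

definition chart_img :: "('a, 'v) chart \<Rightarrow> 'v set" where
  "chart_img c = snd c ` fst c"

definition chart_inv :: "('a, 'v) chart \<Rightarrow> 'v \<Rightarrow> 'a" where
  "chart_inv c = inv_into (fst c) (snd c)"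

text \<open>Chart images are open in the whole model space: there is no boundary. Connectedness is
  not required.\<close>

definition smooth_manifold :: "('a, 'v::findim_inner) mfd \<Rightarrow> bool" where
  "smooth_manifold M \<longleftrightarrow>
     Hausdorff_space (mtop M) \<and> second_countable (mtop M) \<and>
     (\<Union>c\<in>charts M. fst c) = topspace (mtop M) \<and>
     (\<forall>c\<in>charts M. openin (mtop M) (fst c) \<and> open (chart_img c) \<and>
        homeomorphic_map (subtopology (mtop M) (fst c)) (top_of_set (chart_img c)) (snd c)) \<and>
     (\<forall>c\<in>charts M. \<forall>d\<in>charts M.
        smooth_on (snd c ` (fst c \<inter> fst d)) (snd d \<circ> chart_inv c))"

definition smooth_map ::
  "('a, 'v::findim_inner) mfd \<Rightarrow> ('b, 'w::findim_inner) mfd \<Rightarrow> ('a \<Rightarrow> 'b) \<Rightarrow> bool" where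
  "smooth_map M N F \<longleftrightarrow>
     continuous_map (mtop M) (mtop N) F \<and>
     (\<forall>c\<in>charts M. \<forall>d\<in>charts N.
        smooth_on (snd c ` {p \<in> fst c. F p \<in> fst d}) (snd d \<circ> F \<circ> chart_inv c))"

text \<open>\<open>f\<close> is defined and smooth on some neighbourhood of \<open>p\<close>.\<close>

definition smooth_near :: "('a, 'v::findim_inner) mfd \<Rightarrow> 'a \<Rightarrow> ('a \<Rightarrow> real) \<Rightarrow> bool" where
  "smooth_near M p f \<longleftrightarrow>
     (\<exists>W. openin (mtop M) W \<and> p \<in> W \<and>
        (\<forall>c\<in>charts M. smooth_on (snd c ` (fst c \<inter> W)) (f \<circ> chart_inv c)))"

text \<open>A tangent vector at \<open>p\<close> is a derivation on functions smooth near \<open>p\<close>. It is set to 0 on all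
  other functions, so that derivations agreeing on germs are equal. The zero vector is
  \<open>\<lambda>_. 0\<close>.\<close>

type_synonym 'a tvec = "('a \<Rightarrow> real) \<Rightarrow> real"

text \<open>The tangent vector with components \<open>u\<close> in the chart \<open>c\<close>, at the point with
  coordinates \<open>x\<close>.\<close>

definition coord_vec :: "('a, 'v::findim_inner) mfd \<Rightarrow> ('a, 'v) chart \<Rightarrow> 'v \<Rightarrow> 'v \<Rightarrow> 'a tvec" where
  "coord_vec M c x u =
     (\<lambda>f. if smooth_near M (chart_inv c x) f then dd (f \<circ> chart_inv c) x u else 0)"

definition tangent_space :: "('a, 'v::findim_inner) mfd \<Rightarrow> 'a \<Rightarrow> 'a tvec set" where
  "tangent_space M p = {coord_vec M c (snd c p) u | c u. c \<in> charts M \<and> p \<in> fst c}"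

text \<open>The differential of \<open>F : M \<rightarrow> N\<close> at \<open>p\<close>, applied to a tangent vector of \<open>M\<close> at \<open>p\<close>.\<close>

definition differential ::
  "('b, 'w::findim_inner) mfd \<Rightarrow> ('a \<Rightarrow> 'b) \<Rightarrow> 'a \<Rightarrow> 'a tvec \<Rightarrow> 'b tvec" where
  "differential N F p \<xi> = (\<lambda>f. if smooth_near N (F p) f then \<xi> (f \<circ> F) else 0)"

definition smooth_embedding ::
  "('a, 'v::findim_inner) mfd \<Rightarrow> ('b, 'w::findim_inner) mfd \<Rightarrow> ('a \<Rightarrow> 'b) \<Rightarrow> bool" where
  "smooth_embedding M N F \<longleftrightarrow>
     smooth_map M N F \<and> embedding_map (mtop M) (mtop N) F \<and>
     (\<forall>p\<in>topspace (mtop M). \<forall>\<xi>\<in>tangent_space M p.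
        differential N F p \<xi> = (\<lambda>_. 0) \<longrightarrow> \<xi> = (\<lambda>_. 0))"

text \<open>The circle, with the local inverses of \<open>t \<mapsto> cis t\<close> as charts.\<close>

definition circle :: "(complex, real) mfd" where
  "circle =
     \<lparr>mtop = top_of_set (sphere 0 1),
      charts = {(cis ` {a<..<a + 2 * pi}, the_inv_into {a<..<a + 2 * pi} cis) | a. True}\<rparr>"

text \<open>A vector field assigns to each point a tangent vector at that point; \<open>local_field\<close> gives
  its components in a chart, as a function of the coordinates.\<close>

definition local_field ::
  "('a, 'v::findim_inner) mfd \<Rightarrow> ('a \<Rightarrow> 'a tvec) \<Rightarrow> ('a, 'v) chart \<Rightarrow> 'v \<Rightarrow> 'v" where
  "local_field M X c x = (THE u. coord_vec M c x u = X (chart_inv c x))"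

definition smooth_vector_field :: "('a, 'v::findim_inner) mfd \<Rightarrow> ('a \<Rightarrow> 'a tvec) \<Rightarrow> bool" where
  "smooth_vector_field M X \<longleftrightarrow>
     (\<forall>p\<in>topspace (mtop M). X p \<in> tangent_space M p) \<and>
     (\<forall>c\<in>charts M. smooth_on (chart_img c) (local_field M X c))"

type_synonym 'a metric_tensor = "'a \<Rightarrow> 'a tvec \<Rightarrow> 'a tvec \<Rightarrow> real"

definition local_metric ::
  "('a, 'v::findim_inner) mfd \<Rightarrow> 'a metric_tensor \<Rightarrow> ('a, 'v) chart \<Rightarrow> 'v \<Rightarrow> 'v \<Rightarrow> 'v \<Rightarrow> real" where
  "local_metric M g c x u v = g (chart_inv c x) (coord_vec M c x u) (coord_vec M c x v)"

definition riemannian_metric :: "('a, 'v::findim_inner) mfd \<Rightarrow> 'a metric_tensor \<Rightarrow> bool" where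
  "riemannian_metric M g \<longleftrightarrow>
     (\<forall>c\<in>charts M.
        (\<forall>x\<in>chart_img c.
           bilinear (local_metric M g c x) \<and>
           (\<forall>u v. local_metric M g c x u v = local_metric M g c x v u) \<and>
           (\<forall>u. u \<noteq> 0 \<longrightarrow> local_metric M g c x u u > 0)) \<and>
        (\<forall>u v. smooth_on (chart_img c) (\<lambda>x. local_metric M g c x u v)))"


section \<open>Riemannian geometry in a chart\<close>

text \<open>Throughout this section \<open>G\<close> is the metric in the coordinates of one chart: \<open>G x\<close> is an
  inner product for each \<open>x\<close> in the image of the chart. Vector fields are functions \<open>'v \<Rightarrow> 'v\<close>.
  A tensor is evaluated on vectors at a point by extending them to vector fields with constant
  components.\<close>

type_synonym 'v lmetric = "'v \<Rightarrow> 'v \<Rightarrow> 'v \<Rightarrow> real"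

definition orthonormal_basis :: "('v::real_vector \<Rightarrow> 'v \<Rightarrow> real) \<Rightarrow> 'v set \<Rightarrow> 'v set \<Rightarrow> bool" where
  "orthonormal_basis b W E \<longleftrightarrow>
     finite E \<and> span E = W \<and> (\<forall>e\<in>E. \<forall>e'\<in>E. b e e' = (if e = e' then 1 else 0))"

text \<open>Trace with respect to the inner product \<open>b\<close> of the restriction to the subspace \<open>W\<close> of
  the bilinear form \<open>\<beta>\<close>; it does not depend on the orthonormal basis.\<close>

definition metric_trace ::
  "('v::real_vector \<Rightarrow> 'v \<Rightarrow> real) \<Rightarrow> 'v set \<Rightarrow> ('v \<Rightarrow> 'v \<Rightarrow> real) \<Rightarrow> real" where
  "metric_trace b W \<beta> = (\<Sum>e\<in>(SOME E. orthonormal_basis b W E). \<beta> e e)"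

definition lie_bracket ::
  "('v::real_normed_vector \<Rightarrow> 'v) \<Rightarrow> ('v \<Rightarrow> 'v) \<Rightarrow> 'v \<Rightarrow> 'v" where
  "lie_bracket X Y x = dd Y x (X x) - dd X x (Y x)"

text \<open>\<open>christoffel G x \<partial>\<^sub>i \<partial>\<^sub>j = \<Gamma>\<^sub>i\<^sub>j\<^sup>k \<partial>\<^sub>k\<close>, through the Koszul formula for coordinate fields.\<close>

definition christoffel :: "'v::real_normed_vector lmetric \<Rightarrow> 'v \<Rightarrow> 'v \<Rightarrow> 'v \<Rightarrow> 'v" where
  "christoffel G x u v =
     (THE z. \<forall>w. 2 * G x z w =
        dd (\<lambda>y. G y v w) x u + dd (\<lambda>y. G y u w) x v - dd (\<lambda>y. G y u v) x w)"

text \<open>The Levi-Civita connection, \<open>\<nabla>\<^sub>X Y\<close>.\<close>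

definition nabla ::
  "'v::real_normed_vector lmetric \<Rightarrow> ('v \<Rightarrow> 'v) \<Rightarrow> ('v \<Rightarrow> 'v) \<Rightarrow> 'v \<Rightarrow> 'v" where
  "nabla G X Y x = dd Y x (X x) + christoffel G x (X x) (Y x)"

definition curvature ::
  "'v::real_normed_vector lmetric \<Rightarrow> ('v \<Rightarrow> 'v) \<Rightarrow> ('v \<Rightarrow> 'v) \<Rightarrow> ('v \<Rightarrow> 'v) \<Rightarrow> 'v \<Rightarrow> 'v" where
  "curvature G X Y Z x =
     nabla G X (nabla G Y Z) x - nabla G Y (nabla G X Z) x - nabla G (lie_bracket X Y) Z x"

definition ricci :: "'v::real_normed_vector lmetric \<Rightarrow> 'v \<Rightarrow> 'v \<Rightarrow> 'v \<Rightarrow> real" where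
  "ricci G x u v =
     metric_trace (G x) UNIV (\<lambda>e e'. G x (curvature G (\<lambda>_. e) (\<lambda>_. u) (\<lambda>_. v) x) e')"

definition scal :: "'v::real_normed_vector lmetric \<Rightarrow> 'v \<Rightarrow> real" where
  "scal G x = metric_trace (G x) UNIV (ricci G x)"

definition lie_derivative_metric ::
  "'v::real_normed_vector lmetric \<Rightarrow> ('v \<Rightarrow> 'v) \<Rightarrow> 'v \<Rightarrow> 'v \<Rightarrow> 'v \<Rightarrow> real" where
  "lie_derivative_metric G X x u v =
     dd (\<lambda>y. G y u v) x (X x)
     - G x (lie_bracket X (\<lambda>_. u) x) v - G x u (lie_bracket X (\<lambda>_. v) x)"

text \<open>Orthogonal projections of a vector field to a distribution \<open>V\<close> (below: the vertical
  distribution) and to its orthogonal complement.\<close>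

definition ver :: "'v::real_vector lmetric \<Rightarrow> ('v \<Rightarrow> 'v set) \<Rightarrow> ('v \<Rightarrow> 'v) \<Rightarrow> 'v \<Rightarrow> 'v" where
  "ver G V E x = (THE v. v \<in> V x \<and> (\<forall>w\<in>V x. G x (E x - v) w = 0))"

definition hor :: "'v::real_vector lmetric \<Rightarrow> ('v \<Rightarrow> 'v set) \<Rightarrow> ('v \<Rightarrow> 'v) \<Rightarrow> 'v \<Rightarrow> 'v" where
  "hor G V E x = E x - ver G V E x"

definition orth_compl :: "'v lmetric \<Rightarrow> ('v \<Rightarrow> 'v set) \<Rightarrow> 'v \<Rightarrow> 'v set" where
  "orth_compl G V x = {u. \<forall>w\<in>V x. G x u w = 0}"

definition oneill_A ::
  "'v::real_normed_vector lmetric \<Rightarrow> ('v \<Rightarrow> 'v set) \<Rightarrow> ('v \<Rightarrow> 'v) \<Rightarrow> ('v \<Rightarrow> 'v) \<Rightarrow> 'v \<Rightarrow> 'v" where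
  "oneill_A G V E F x =
     hor G V (nabla G (hor G V E) (ver G V F)) x + ver G V (nabla G (hor G V E) (hor G V F)) x"

text \<open>The norm of \<open>A\<close> for a one-dimensional vertical distribution; it does not depend on which of
  the two unit vertical vectors is taken.\<close>

definition oneill_A_norm ::
  "'v::real_normed_vector lmetric \<Rightarrow> ('v \<Rightarrow> 'v set) \<Rightarrow> 'v \<Rightarrow> real" where
  "oneill_A_norm G V x =
     (let U = (SOME u. u \<in> V x \<and> G x u u = 1) in
      sqrt (metric_trace (G x) (orth_compl G V x)
        (\<lambda>y y'. G x (oneill_A G V (\<lambda>_. y) (\<lambda>_. U) x) (oneill_A G V (\<lambda>_. y') (\<lambda>_. U) x))))"

text \<open>The second fundamental form of the leaves of \<open>V\<close>.\<close>

definition second_ff ::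
  "'v::real_normed_vector lmetric \<Rightarrow> ('v \<Rightarrow> 'v set) \<Rightarrow> ('v \<Rightarrow> 'v) \<Rightarrow> ('v \<Rightarrow> 'v) \<Rightarrow> 'v \<Rightarrow> 'v" where
  "second_ff G V E F x = hor G V (nabla G (ver G V E) (ver G V F)) x"


section \<open>Global notions\<close>

definition constant_scalar_curvature ::
  "('a, 'v::findim_inner) mfd \<Rightarrow> 'a metric_tensor \<Rightarrow> bool" where
  "constant_scalar_curvature M g \<longleftrightarrow>
     (\<exists>k. \<forall>c\<in>charts M. \<forall>x\<in>chart_img c. scal (local_metric M g c) x = k)"

definition quasi_einstein ::
  "('a, 'v::findim_inner) mfd \<Rightarrow> 'a metric_tensor \<Rightarrow> ('a \<Rightarrow> 'a tvec) \<Rightarrow> bool" where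
  "quasi_einstein M g X \<longleftrightarrow>
     (\<exists>m \<Lambda> :: real. m \<noteq> 0 \<and>
        (\<forall>c\<in>charts M. \<forall>x\<in>chart_img c. \<forall>u v.
           (let G = local_metric M g c; Y = local_field M X c in
            ricci G x u v + 1 / 2 * lie_derivative_metric G Y x u v
              - 1 / m * (G x (Y x) u * G x (Y x) v) = \<Lambda> * G x u v)))"

definition vertical_space ::
  "('a, 'v::findim_inner) mfd \<Rightarrow> ('b, 'w::findim_inner) mfd \<Rightarrow> ('a \<Rightarrow> 'b) \<Rightarrow> 'a \<Rightarrow> 'a tvec set" where
  "vertical_space M B \<pi> p = {\<xi> \<in> tangent_space M p. differential B \<pi> p \<xi> = (\<lambda>_. 0)}"

definition horizontal_space ::
  "('a, 'v::findim_inner) mfd \<Rightarrow> 'a metric_tensor \<Rightarrow> ('b, 'w::findim_inner) mfd \<Rightarrow> ('a \<Rightarrow> 'b) \<Rightarrow>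
     'a \<Rightarrow> 'a tvec set" where
  "horizontal_space M g B \<pi> p =
     {\<xi> \<in> tangent_space M p. \<forall>\<eta>\<in>vertical_space M B \<pi> p. g p \<xi> \<eta> = 0}"

definition riemannian_submersion ::
  "('a, 'v::findim_inner) mfd \<Rightarrow> 'a metric_tensor \<Rightarrow>
   ('b, 'w::findim_inner) mfd \<Rightarrow> 'b metric_tensor \<Rightarrow> ('a \<Rightarrow> 'b) \<Rightarrow> bool" where
  "riemannian_submersion M g B h \<pi> \<longleftrightarrow>
     smooth_map M B \<pi> \<and> \<pi> ` topspace (mtop M) = topspace (mtop B) \<and>
     (\<forall>p\<in>topspace (mtop M).
        differential B \<pi> p ` tangent_space M p = tangent_space B (\<pi> p) \<and>
        (\<forall>\<xi>\<in>horizontal_space M g B \<pi> p. \<forall>\<eta>\<in>horizontal_space M g B \<pi> p.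
           h (\<pi> p) (differential B \<pi> p \<xi>) (differential B \<pi> p \<eta>) = g p \<xi> \<eta>))"

text \<open>Each fiber is diffeomorphic to the circle as a submanifold of \<open>M\<close>.\<close>

definition circle_fibers ::
  "('a, 'v::findim_inner) mfd \<Rightarrow> ('b, 'w::findim_inner) mfd \<Rightarrow> ('a \<Rightarrow> 'b) \<Rightarrow> bool" where
  "circle_fibers M B \<pi> \<longleftrightarrow>
     (\<forall>b\<in>topspace (mtop B). \<exists>\<sigma>. smooth_embedding circle M \<sigma> \<and>
        \<sigma> ` topspace (mtop circle) = {p \<in> topspace (mtop M). \<pi> p = b})"

definition local_vertical ::
  "('a, 'v::findim_inner) mfd \<Rightarrow> ('b, 'w::findim_inner) mfd \<Rightarrow> ('a \<Rightarrow> 'b) \<Rightarrow>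
     ('a, 'v) chart \<Rightarrow> 'v \<Rightarrow> 'v set" where
  "local_vertical M B \<pi> c x = {u. coord_vec M c x u \<in> vertical_space M B \<pi> (chart_inv c x)}"

definition totally_geodesic_fibers ::
  "('a, 'v::findim_inner) mfd \<Rightarrow> 'a metric_tensor \<Rightarrow> ('b, 'w::findim_inner) mfd \<Rightarrow> ('a \<Rightarrow> 'b) \<Rightarrow>
     bool" where
  "totally_geodesic_fibers M g B \<pi> \<longleftrightarrow>
     (\<forall>c\<in>charts M. \<forall>x\<in>chart_img c. \<forall>u v.
        second_ff (local_metric M g c) (local_vertical M B \<pi> c) (\<lambda>_. u) (\<lambda>_. v) x = 0)"

definition constant_oneill_norm ::
  "('a, 'v::findim_inner) mfd \<Rightarrow> 'a metric_tensor \<Rightarrow> ('b, 'w::findim_inner) mfd \<Rightarrow> ('a \<Rightarrow> 'b) \<Rightarrow>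
     bool" where
  "constant_oneill_norm M g B \<pi> \<longleftrightarrow>
     (\<exists>k. \<forall>c\<in>charts M. \<forall>x\<in>chart_img c.
        oneill_A_norm (local_metric M g c) (local_vertical M B \<pi> c) x = k)"

end

(* Let U be a local unit vertical field, \<theta> = g(U, -), \<phi> v = \<nabla>_v U and \<omega>(u, v) = g(\<phi> u, v). Then
   g = \<pi>^* h + \<theta> \<otimes> \<theta>, and \<phi> U = 0 because the fibers are geodesics; differentiating the first identity
   along U shows that U is a Killing field, so \<omega> is skew. As A_v U = \<phi> v for horizontal v, the curvature
   of a unit Killing field gives Ric(U, U) = |A|^2.

   The Hessian of \<pi> is -(\<theta> \<otimes> \<psi> + \<psi> \<otimes> \<theta>) with \<psi> = d\<pi> \<circ> \<phi>. Skew-symmetrising its covariant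
   derivative (the Ricci identity for maps) yields O'Neill's formula
   R_B(u, v, v, u) = R_M(u, v, v, u) + 3 \<omega>(u, v)^2 for horizontal u, v, and tracing it gives
   scal_B = tr_H Ric_M + 2 |A|^2.

   For X tangent to the fibers both X^* and the Lie derivative of g vanish on (v, v) for horizontal v,
   so the quasi-Einstein equation gives Ric(v, v) = \<lambda> |v|^2. Hence |A|^2 = scal_M - (n - 1) \<lambda> and
   scal_B = 2 scal_M - (n - 1) \<lambda>, where n = dim M.

   That the vertical space is a line uses the circle fibers: every kernel vector of d\<pi> is the limit of
   rescaled secants of the fiber, and these have the direction of the velocity of the circle. *)

theory Submission
  imports Defs
begin

section \<open>Calculus\<close>

text \<open>No hypothesis relates the dimensions of the model spaces \<open>'v\<close> and
  \<open>'w\<close>, so the rank of the vertical distribution cannot be found by counting; it has to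
  be read off from the circle. This needs fiber points close to a prescribed kernel direction, that
  is, the existence half of the implicit function theorem, which a contraction supplies. All
  geometry takes place in one chart of M and one chart of B. A pointwise choice of unit vertical
  vectors need not be smooth, so the local field is obtained as the metric dual of a smooth covector
  and then normalised. Its value at one point is prescribed, because the norm of A is defined
  through a choice made at each point. The decomposition of the metric is used for arbitrary vectors
  and not for horizontal ones, since horizontality is lost when vectors are extended with constant
  components. Every correction term in the curvature formulas arises in this way: \<theta> vanishes
  at the point, its derivative \<omega> does not.\<close>

lemma dd_eqI: "(f has_derivative f') (at x) \<Longrightarrow> dd f x = f'"
  unfolding dd_def by (rule ext) (metis frechet_derivative_at)

lemma has_derivative_dd: "f differentiable (at x) \<Longrightarrow> (f has_derivative dd f x) (at x)"
  using frechet_derivative_works by (metis dd_eqI)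

lemma linear_dd: "f differentiable (at x) \<Longrightarrow> linear (dd f x)"
  using has_derivative_dd has_derivative_linear by blast

lemma differentiable_cong_open:
  assumes "open S" "x \<in> S" "\<And>y. y \<in> S \<Longrightarrow> f y = g y" "f differentiable (at x)"
  shows "g differentiable (at x)"
  using assms has_derivative_transform_within_open[of f _ x UNIV S g]
  unfolding differentiable_def by blast

text \<open>\<open>dd\<close> is a choice, so the equation has to hold also where no derivative
  exists: both functions satisfy the same predicate at \<open>x\<close>, and the choice depends on
  that predicate alone.\<close>

lemma dd_cong_open:
  assumes "open S" "x \<in> S" "\<And>y. y \<in> S \<Longrightarrow> f y = g y"
  shows "dd f x = dd g x"
proof -
  have "(f has_derivative D) (at x) \<longleftrightarrow> (g has_derivative D) (at x)" for D
    using has_derivative_transform_within_open[of f D x UNIV S g]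
      has_derivative_transform_within_open[of g D x UNIV S f] assms by auto
  thus ?thesis
    unfolding dd_def frechet_derivative_def by simp
qed

lemma dd_const [simp]: "dd (\<lambda>_. c) x v = 0"
  by (simp add: dd_eqI[OF has_derivative_const])

section \<open>Closure properties of the finite differentiability classes\<close>

lemma C_k_on_cong:
  assumes "open S" "\<And>x. x \<in> S \<Longrightarrow> f x = g x" "C_k_on k S f"
  shows "C_k_on k S g"
  using assms(2,3)
proof (induction k arbitrary: f g)
  case 0
  then show ?case by (metis C_k_on.simps(1) continuous_on_cong)
next
  case (Suc k)
  have "g differentiable (at x)" if "x \<in> S" for x
    using differentiable_cong_open[OF assms(1) that, of f g] Suc.prems that by auto
  moreover have "C_k_on k S (\<lambda>x. dd g x v)" for v
    by (rule Suc.IH[of "\<lambda>x. dd f x v"])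
      (use dd_cong_open[OF assms(1), of _ f g] Suc.prems in auto)
  ultimately show ?case by simp
qed

lemma C_k_on_subset: "C_k_on k S f \<Longrightarrow> T \<subseteq> S \<Longrightarrow> C_k_on k T f"
  by (induction k arbitrary: f) (auto intro: continuous_on_subset)

lemma C_k_on_local:
  assumes "\<And>x. x \<in> S \<Longrightarrow> \<exists>T. open T \<and> x \<in> T \<and> C_k_on k T f"
  shows "C_k_on k S f"
  using assms
proof (induction k arbitrary: f)
  case 0
  then show ?case
    by (metis C_k_on.simps(1) continuous_at_imp_continuous_on continuous_on_eq_continuous_at)
next
  case (Suc k)
  have "f differentiable (at x)" if "x \<in> S" for x
    using Suc.prems[OF that] by auto
  moreover have "C_k_on k S (\<lambda>x. dd f x v)" for v
    by (rule Suc.IH) (use Suc.prems in fastforce)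
  ultimately show ?case by simp
qed

text \<open>The recursion passes from \<open>f\<close> to its derivatives and does not literally
  nest the classes. The product rule needs the nesting, because it leaves one factor
  undifferentiated.\<close>

lemma C_k_on_Suc_D: "C_k_on (Suc k) S f \<Longrightarrow> C_k_on k S f"
proof (induction k arbitrary: f)
  case 0
  then show ?case
    by (auto intro!: continuous_at_imp_continuous_on differentiable_imp_continuous_within)
next
  case (Suc k)
  have "C_k_on k S (\<lambda>x. dd f x v)" for v
    by (rule Suc.IH) (use Suc.prems in simp)
  with Suc.prems show ?case by simp
qed

lemma C_k_on_const: "C_k_on k S (\<lambda>_. c)"
  by (induction k arbitrary: c) simp_all

lemma C_k_on_add:
  assumes "open S" "C_k_on k S f" "C_k_on k S g"
  shows "C_k_on k S (\<lambda>x. f x + g x)"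
  using assms(2,3)
proof (induction k arbitrary: f g)
  case 0
  then show ?case by (simp add: continuous_on_add)
next
  case (Suc k)
  have "dd f x v + dd g x v = dd (\<lambda>x. f x + g x) x v" if "x \<in> S" for x v
    using Suc.prems that
    by (subst dd_eqI[OF has_derivative_add[OF has_derivative_dd has_derivative_dd]]) auto
  then have "C_k_on k S (\<lambda>x. dd (\<lambda>x. f x + g x) x v)" for v
    by (rule C_k_on_cong[OF assms(1)])
      (use Suc.IH[of "\<lambda>x. dd f x v" "\<lambda>x. dd g x v"] Suc.prems in auto)
  with Suc.prems show ?case by (auto intro: differentiable_add)
qed

lemma C_k_on_sum:
  assumes "open S" "\<And>i. i \<in> I \<Longrightarrow> C_k_on k S (f i)"
  shows "C_k_on k S (\<lambda>x. \<Sum>i\<in>I. f i x)"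
  using assms(2)
  by (induction I rule: infinite_finite_induct)
    (auto intro: C_k_on_const C_k_on_add[OF assms(1)])

lemma C_k_on_linear:
  assumes "open S" "bounded_linear L" "C_k_on k S f"
  shows "C_k_on k S (\<lambda>x. L (f x))"
  using assms(3)
proof (induction k arbitrary: f)
  case 0
  then show ?case using bounded_linear.continuous_on[OF assms(2)] by auto
next
  case (Suc k)
  have D: "((\<lambda>x. L (f x)) has_derivative (\<lambda>v. L (dd f x v))) (at x)" if "x \<in> S" for x
    by (rule bounded_linear.has_derivative[OF assms(2)])
      (use Suc.prems that in \<open>auto intro!: has_derivative_dd\<close>)
  have "C_k_on k S (\<lambda>x. dd (\<lambda>x. L (f x)) x v)" for v
    by (rule C_k_on_cong[OF assms(1) _ Suc.IH[of "\<lambda>x. dd f x v"]])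
      (use Suc.prems dd_eqI[OF D] in auto)
  with D show ?case by (auto simp: differentiable_def)
qed

lemma C_k_on_bilinear:
  assumes "open S" "bounded_bilinear pr" "C_k_on k S f" "C_k_on k S g"
  shows "C_k_on k S (\<lambda>x. pr (f x) (g x))"
  using assms(3,4)
proof (induction k arbitrary: f g)
  case 0
  then show ?case using bounded_bilinear.continuous_on[OF assms(2)] by auto
next
  case (Suc k)
  have D: "((\<lambda>x. pr (f x) (g x)) has_derivative
      (\<lambda>v. pr (f x) (dd g x v) + pr (dd f x v) (g x))) (at x)" if "x \<in> S" for x
    by (rule bounded_bilinear.FDERIV[OF assms(2)])
      (use Suc.prems that in \<open>auto intro!: has_derivative_dd\<close>)
  have "C_k_on k S (\<lambda>x. dd (\<lambda>x. pr (f x) (g x)) x v)" for v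
  proof (rule C_k_on_cong[OF assms(1)])
    show "C_k_on k S (\<lambda>x. pr (f x) (dd g x v) + pr (dd f x v) (g x))"
      using Suc.prems Suc.prems[THEN C_k_on_Suc_D]
      by (intro C_k_on_add[OF assms(1)] Suc.IH) auto
  qed (use dd_eqI[OF D] in auto)
  with D show ?case by (auto simp: differentiable_def)
qed

section \<open>Closure properties of smooth functions\<close>

lemma smooth_on_cong:
  "open S \<Longrightarrow> (\<And>x. x \<in> S \<Longrightarrow> f x = g x) \<Longrightarrow> smooth_on S f \<Longrightarrow> smooth_on S g"
  unfolding smooth_on_def using C_k_on_cong by blast

lemma smooth_on_subset: "smooth_on S f \<Longrightarrow> T \<subseteq> S \<Longrightarrow> smooth_on T f"
  unfolding smooth_on_def using C_k_on_subset by blast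

lemma smooth_on_local:
  assumes "\<And>x. x \<in> S \<Longrightarrow> \<exists>T. open T \<and> x \<in> T \<and> smooth_on T f"
  shows "smooth_on S f"
  unfolding smooth_on_def
  by (intro allI C_k_on_local) (use assms smooth_on_def in blast)

lemma smooth_on_const [intro!, simp]: "smooth_on S (\<lambda>_. c)"
  by (simp add: smooth_on_def C_k_on_const)

lemma smooth_on_dd: "smooth_on S f \<Longrightarrow> smooth_on S (\<lambda>x. dd f x v)"
  unfolding smooth_on_def using C_k_on.simps(2) by blast

lemma smooth_on_imp_differentiable: "smooth_on S f \<Longrightarrow> x \<in> S \<Longrightarrow> f differentiable (at x)"
  unfolding smooth_on_def using C_k_on.simps(2)[of 0] by blast

lemma smooth_on_imp_continuous_on: "smooth_on S f \<Longrightarrow> continuous_on S f"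
  unfolding smooth_on_def using C_k_on.simps(1) by blast

lemma smooth_on_has_derivative:
  "smooth_on S f \<Longrightarrow> x \<in> S \<Longrightarrow> (f has_derivative dd f x) (at x)"
  using smooth_on_imp_differentiable has_derivative_dd by blast

lemma smooth_on_add:
  "open S \<Longrightarrow> smooth_on S f \<Longrightarrow> smooth_on S g \<Longrightarrow> smooth_on S (\<lambda>x. f x + g x)"
  by (simp add: smooth_on_def C_k_on_add)

lemma smooth_on_sum:
  "open S \<Longrightarrow> (\<And>i. i \<in> I \<Longrightarrow> smooth_on S (f i)) \<Longrightarrow> smooth_on S (\<lambda>x. \<Sum>i\<in>I. f i x)"
  by (simp add: smooth_on_def C_k_on_sum)

lemma smooth_on_linear:
  "open S \<Longrightarrow> bounded_linear L \<Longrightarrow> smooth_on S f \<Longrightarrow> smooth_on S (\<lambda>x. L (f x))"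
  by (simp add: smooth_on_def C_k_on_linear)

lemma smooth_on_bilinear:
  "open S \<Longrightarrow> bounded_bilinear pr \<Longrightarrow> smooth_on S f \<Longrightarrow> smooth_on S g \<Longrightarrow>
    smooth_on S (\<lambda>x. pr (f x) (g x))"
  by (simp add: smooth_on_def C_k_on_bilinear)

lemmas smooth_on_scaleR = smooth_on_bilinear[OF _ bounded_bilinear_scaleR]
lemmas smooth_on_mult = smooth_on_bilinear[OF _ bounded_bilinear_mult]

lemma smooth_on_minus: "open S \<Longrightarrow> smooth_on S f \<Longrightarrow> smooth_on S (\<lambda>x. - f x)"
  by (rule smooth_on_linear[OF _ bounded_linear_minus[OF bounded_linear_ident]])

lemma smooth_on_diff:
  "open S \<Longrightarrow> smooth_on S f \<Longrightarrow> smooth_on S g \<Longrightarrow> smooth_on S (\<lambda>x. f x - g x)"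
  using smooth_on_add[of S f "\<lambda>x. - g x"] smooth_on_minus[of S g] by simp

section \<open>Orthonormal bases\<close>

lemma span_finite_UNIV: "\<exists>E::'v::findim_inner set. finite E \<and> span E = UNIV"
proof -
  obtain E :: "'v set" where E: "finite E" "\<forall>x. \<exists>c. x = (\<Sum>e\<in>E. c e *\<^sub>R e)"
    using finite_spanning by blast
  then have "span E = UNIV"
    by (auto simp: span_finite[OF E(1)])
  with E show ?thesis by blast
qed

lemma finite_basis:
  fixes W :: "'v::findim_inner set"
  assumes "subspace W"
  shows "\<exists>B. finite B \<and> independent B \<and> span B = W"
proof -
  obtain B where B: "B \<subseteq> W" "independent B" "W \<subseteq> span B"
    using maximal_independent_subset[of W] by blast
  moreover have "span B = W" using B assms by (metis span_minimal subset_antisym)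
  moreover obtain E :: "'v set" where "finite E" "span E = UNIV" using span_finite_UNIV by blast
  then have "finite B" using independent_span_bound[of E B] B by auto
  ultimately show ?thesis by blast
qed

definition inner_prod :: "('v::real_vector \<Rightarrow> 'v \<Rightarrow> real) \<Rightarrow> bool" where
  "inner_prod b \<longleftrightarrow> bilinear b \<and> (\<forall>u v. b u v = b v u) \<and> (\<forall>u. u \<noteq> 0 \<longrightarrow> b u u > 0)"

lemma inner_prodD:
  assumes "inner_prod b"
  shows "bilinear b" "b u v = b v u" "u \<noteq> 0 \<Longrightarrow> b u u > 0" "b u u = 0 \<longleftrightarrow> u = 0"
proof -
  show "bilinear b" "b u v = b v u" "u \<noteq> 0 \<Longrightarrow> b u u > 0"
    using assms by (auto simp: inner_prod_def)
  then show "b u u = 0 \<longleftrightarrow> u = 0" using bilinear_lzero by fastforce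
qed

lemma inner_prod_inner: "inner_prod (inner :: 'v::real_inner \<Rightarrow> _)"
  by (auto simp: inner_prod_def bilinear_def inner_commute inner_add_right
      intro!: linearI inner_add_left)

lemma bilinear_linear:
  assumes "bilinear b"
  shows "linear (\<lambda>x. b x y)" "linear (\<lambda>y. b x y)"
  using assms by (auto simp: bilinear_def)

lemmas bilinear_simps = bilinear_ladd bilinear_radd bilinear_lmul bilinear_rmul bilinear_lneg
  bilinear_rneg bilinear_lsub bilinear_rsub bilinear_lzero bilinear_rzero

lemma bilinear_lsum: "bilinear b \<Longrightarrow> b (\<Sum>i\<in>I. f i) y = (\<Sum>i\<in>I. b (f i) y)"
  using linear_sum[OF bilinear_linear(1)] by fastforce

lemma bilinear_rsum: "bilinear b \<Longrightarrow> b x (\<Sum>i\<in>I. f i) = (\<Sum>i\<in>I. b x (f i))"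
  using linear_sum[OF bilinear_linear(2)] by fastforce

lemma orthonormal_independent:
  fixes b :: "'v::real_vector \<Rightarrow> 'v \<Rightarrow> real"
  assumes "bilinear b" "finite E" "\<forall>e\<in>E. \<forall>e'\<in>E. b e e' = (if e = e' then 1 else 0)"
  shows "independent E"
proof (rule independent_if_scalars_zero[OF assms(2)])
  fix f e assume e: "(\<Sum>x\<in>E. f x *\<^sub>R x) = 0" "e \<in> E"
  have "0 = b (\<Sum>x\<in>E. f x *\<^sub>R x) e" using e bilinear_lzero[OF assms(1)] by simp
  also have "\<dots> = (\<Sum>x\<in>E. f x * (if x = e then 1 else 0))"
    using e(2) assms(3) by (simp add: bilinear_lsum[OF assms(1)] bilinear_lmul[OF assms(1)])
  also have "\<dots> = f e" using e assms(2) by (simp add: if_distrib cong: if_cong)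
  finally show "f e = 0" by simp
qed

lemma orthonormal_expansion:
  assumes "inner_prod b" "orthonormal_basis b W E" "x \<in> W"
  shows "x = (\<Sum>e\<in>E. b x e *\<^sub>R e)"
proof -
  have E: "finite E" "span E = W" and o: "\<And>e e'. e \<in> E \<Longrightarrow> e' \<in> E \<Longrightarrow> b e e' = (if e = e' then 1 else 0)"
    using assms by (auto simp: orthonormal_basis_def)
  have b: "bilinear b" using assms inner_prodD by blast
  obtain c where c: "x = (\<Sum>e\<in>E. c e *\<^sub>R e)"
    using assms(3) E span_finite[OF E(1)] by auto
  have "b x e = c e" if "e \<in> E" for e
  proof -
    have "b x e = (\<Sum>x\<in>E. c x * (if x = e then 1 else 0))"
      unfolding c using that o by (simp add: bilinear_lsum[OF b] bilinear_lmul[OF b])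
    also have "\<dots> = c e" using that E by (simp add: if_distrib cong: if_cong)
    finally show ?thesis .
  qed
  with c show ?thesis by simp
qed

lemma orthonormal_parseval:
  assumes "inner_prod b" "orthonormal_basis b W E" "x \<in> W"
  shows "b x y = (\<Sum>e\<in>E. b x e * b y e)"
proof -
  have b: "bilinear b" using assms inner_prodD by blast
  have "b x y = b (\<Sum>e\<in>E. b x e *\<^sub>R e) y"
    using orthonormal_expansion[OF assms] by simp
  also have "\<dots> = (\<Sum>e\<in>E. b x e * b e y)"
    by (simp add: bilinear_lsum[OF b] bilinear_lmul[OF b])
  finally show ?thesis using inner_prodD(2)[OF assms(1)] by (metis (no_types, lifting) sum.cong)
qed

text \<open>Expand the left slot of \<open>\<beta> e e\<close> in \<open>E'\<close>, exchange the
  sums, and recognise the expansion of the right slot in \<open>E\<close>.\<close>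

lemma trace_basis_independent:
  fixes \<beta> :: "'v::real_vector \<Rightarrow> 'v \<Rightarrow> real"
  assumes "inner_prod b" "bilinear \<beta>" "orthonormal_basis b W E" "orthonormal_basis b W E'"
  shows "(\<Sum>e\<in>E. \<beta> e e) = (\<Sum>e\<in>E'. \<beta> e e)"
proof -
  have E: "finite E" "span E = W" "finite E'" "span E' = W"
    using assms by (auto simp: orthonormal_basis_def)
  have W: "E \<subseteq> W" "E' \<subseteq> W" using E span_superset by auto
  have "(\<Sum>e\<in>E. \<beta> e e) = (\<Sum>e\<in>E. \<Sum>f\<in>E'. b e f * \<beta> f e)"
  proof (rule sum.cong[OF refl])
    fix e assume "e \<in> E"
    then have "\<beta> e e = \<beta> (\<Sum>f\<in>E'. b e f *\<^sub>R f) e"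
      using orthonormal_expansion[OF assms(1,4), of e] W by (metis subsetD)
    then show "\<beta> e e = (\<Sum>f\<in>E'. b e f * \<beta> f e)"
      by (simp add: bilinear_lsum[OF assms(2)] bilinear_lmul[OF assms(2)])
  qed
  also have "\<dots> = (\<Sum>f\<in>E'. \<Sum>e\<in>E. b e f * \<beta> f e)" by (rule sum.swap)
  also have "\<dots> = (\<Sum>f\<in>E'. \<beta> f f)"
  proof (rule sum.cong[OF refl])
    fix f assume "f \<in> E'"
    then have "\<beta> f f = \<beta> f (\<Sum>e\<in>E. b f e *\<^sub>R e)"
      using orthonormal_expansion[OF assms(1,3), of f] W by (metis subsetD)
    also have "\<dots> = (\<Sum>e\<in>E. b f e * \<beta> f e)"
      by (simp add: bilinear_rsum[OF assms(2)] bilinear_rmul[OF assms(2)])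
    finally show "(\<Sum>e\<in>E. b e f * \<beta> f e) = \<beta> f f"
      using inner_prodD(2)[OF assms(1)] by (metis (no_types, lifting) sum.cong)
  qed
  finally show ?thesis .
qed

text \<open>Bilinearity is asked of a substitute that agrees with \<beta> on the diagonal of
  \<open>W\<close>: the expression inside \<open>oneill_A_norm\<close> is identified with a bilinear
  form only on horizontal vectors.\<close>

lemma metric_trace_eq:
  assumes "inner_prod b" "bilinear \<beta>'" "\<And>e. e \<in> W \<Longrightarrow> \<beta> e e = \<beta>' e e" "orthonormal_basis b W E"
  shows "metric_trace b W \<beta> = (\<Sum>e\<in>E. \<beta> e e)"
proof -
  define E0 where "E0 = (SOME E. orthonormal_basis b W E)"
  have E0: "orthonormal_basis b W E0" unfolding E0_def using assms(4) by (rule someI)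
  have W: "E \<subseteq> W" "E0 \<subseteq> W" using E0 assms(4) span_superset[of E] span_superset[of E0]
    by (auto simp: orthonormal_basis_def)
  have "metric_trace b W \<beta> = (\<Sum>e\<in>E0. \<beta>' e e)"
    unfolding metric_trace_def E0_def[symmetric] using W assms(3) by (auto intro!: sum.cong)
  also have "\<dots> = (\<Sum>e\<in>E. \<beta>' e e)" by (rule trace_basis_independent[OF assms(1,2) E0 assms(4)])
  also have "\<dots> = (\<Sum>e\<in>E. \<beta> e e)" using W assms(3) by (auto intro!: sum.cong)
  finally show ?thesis .
qed


text \<open>Gram-Schmidt. A possibly dependent \<open>B\<close> costs only the case
  \<open>v = s\<close>, in which the new vector is skipped.\<close>

lemma orthonormal_basis_span:
  assumes b: "inner_prod b" and "finite B"
  shows "\<exists>E. orthonormal_basis b (span B) E"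
  using assms(2)
proof induction
  case empty
  show ?case by (rule exI[of _ "{}"]) (simp add: orthonormal_basis_def)
next
  case (insert v B)
  have bl: "bilinear b" using b inner_prodD by blast
  obtain E where E: "finite E" "span E = span B"
    and o: "\<And>e e'. e \<in> E \<Longrightarrow> e' \<in> E \<Longrightarrow> b e e' = (if e = e' then 1 else 0)"
    using insert.IH by (auto simp: orthonormal_basis_def)
  define s where "s = (\<Sum>e\<in>E. b v e *\<^sub>R e)"
  have s: "s \<in> span E" unfolding s_def by (intro span_sum span_scale span_base)
  have orth: "b (v - s) e = 0" if "e \<in> E" for e
  proof -
    have "b s e = (\<Sum>x\<in>E. b v x * (if x = e then 1 else 0))"
      unfolding s_def using that o by (simp add: bilinear_lsum[OF bl] bilinear_lmul[OF bl])
    also have "\<dots> = b v e" using that E by (simp add: if_distrib cong: if_cong)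
    finally show ?thesis by (simp add: bilinear_lsub[OF bl])
  qed
  show ?case
  proof (cases "v = s")
    case True
    then have "span (insert v B) = span B" using s E(2) span_redundant by metis
    with E o show ?thesis by (auto simp: orthonormal_basis_def)
  next
    case False
    define w where "w = (1 / sqrt (b (v - s) (v - s))) *\<^sub>R (v - s)"
    have pos: "b (v - s) (v - s) > 0" using False inner_prodD(3)[OF b] by simp
    have ww: "b w w = 1" and we: "\<And>e. e \<in> E \<Longrightarrow> b w e = 0" "\<And>e. e \<in> E \<Longrightarrow> b e w = 0"
      using pos orth inner_prodD(2)[OF b]
      by (auto simp: w_def bilinear_lmul[OF bl] bilinear_rmul[OF bl])
    have "v = s + sqrt (b (v - s) (v - s)) *\<^sub>R w" using pos by (simp add: w_def)
    then have "v \<in> span (insert w E)"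
      using s by (metis insertI1 span_add span_base span_mono span_scale subsetD subset_insertI)
    then have "insert v B \<subseteq> span (insert w E)"
      using E(2) by (metis insert_subset span_mono span_superset subset_insertI subset_trans)
    moreover have "insert w E \<subseteq> span (insert v B)"
    proof -
      have "span E \<subseteq> span (insert v B)" unfolding E(2) by (rule span_mono) auto
      moreover have "v \<in> span (insert v B)" by (rule span_base) simp
      ultimately show ?thesis using s span_superset[of E]
        by (auto simp: w_def intro!: span_scale span_diff)
    qed
    ultimately have "span (insert w E) = span (insert v B)"
      by (metis span_minimal subspace_span subset_antisym)
    moreover have "w \<notin> E" using ww we by fastforce
    ultimately have "orthonormal_basis b (span (insert v B)) (insert w E)"
      using E(1) o ww we by (auto simp: orthonormal_basis_def)
    then show ?thesis by blast
  qed
qed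

lemma orthonormal_basis_exists:
  fixes W :: "'v::findim_inner set"
  assumes "inner_prod b" "subspace W"
  obtains E where "orthonormal_basis b W E"
  using finite_basis[OF assms(2)] orthonormal_basis_span[OF assms(1)] by metis

text \<open>Coordinates for the class \<open>findim_inner\<close>, in which dimension 0 is possible.
  The basis is orthonormal for the inner product of the model space, not for the metric of the
  manifold.\<close>

definition obasis :: "'v::findim_inner set" where
  "obasis = (SOME E. orthonormal_basis inner UNIV E)"

lemma obasis: "orthonormal_basis inner UNIV (obasis :: 'v::findim_inner set)"
  unfolding obasis_def
  using orthonormal_basis_exists[OF inner_prod_inner subspace_UNIV] by (metis someI)

lemma finite_obasis [simp]: "finite obasis"
  using obasis by (auto simp: orthonormal_basis_def)

lemma obasis_expansion: "x = (\<Sum>e\<in>obasis. (x \<bullet> e) *\<^sub>R e)"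
  using orthonormal_expansion[OF inner_prod_inner obasis] by blast

lemma linear_obasis:
  assumes "linear f"
  shows "f x = (\<Sum>e\<in>obasis. (x \<bullet> e) *\<^sub>R f e)"
proof -
  have "f x = f (\<Sum>e\<in>obasis. (x \<bullet> e) *\<^sub>R e)"
    by (rule arg_cong[OF obasis_expansion])
  then show ?thesis by (simp add: linear_sum[OF assms] linear_cmul[OF assms])
qed

lemma findim_bounded_linear:
  fixes f :: "'v::findim_inner \<Rightarrow> 'w::real_normed_vector"
  assumes "linear f"
  shows "bounded_linear f"
proof -
  have "f = (\<lambda>x. \<Sum>e\<in>obasis. (x \<bullet> e) *\<^sub>R f e)" using linear_obasis[OF assms] by blast
  moreover have "bounded_linear (\<lambda>x. \<Sum>e\<in>obasis. (x \<bullet> e) *\<^sub>R f e)"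
    by (intro bounded_linear_sum bounded_linear_scaleR_const bounded_linear_inner_left)
  ultimately show ?thesis by simp
qed

section \<open>Families of linear maps, composition and smooth frames\<close>

text \<open>A product rule for \<open>L y (a y)\<close> when \<open>L\<close> is known to be
  differentiable only with its argument frozen. Writing \<open>a y\<close> in \<open>obasis\<close>
  turns the expression into a finite sum of scalars times vectors.\<close>

lemma linear_family_has_derivative:
  fixes L :: "'v::real_normed_vector \<Rightarrow> 'a::findim_inner \<Rightarrow> 'b::real_normed_vector"
  assumes S: "open S" "x \<in> S" and lin: "\<And>y. y \<in> S \<Longrightarrow> linear (L y)"
    and L: "\<And>v. (\<lambda>y. L y v) differentiable (at x)"
    and a: "(a has_derivative a') (at x)"
  shows "((\<lambda>y. L y (a y)) has_derivative (\<lambda>u. dd (\<lambda>y. L y (a x)) x u + L x (a' u))) (at x)"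
proof -
  let ?D = "\<lambda>c u. \<Sum>e\<in>obasis. (c \<bullet> e) *\<^sub>R dd (\<lambda>y. L y e) x u"
  have D0: "((\<lambda>y. L y c) has_derivative ?D c) (at x)" for c
  proof (rule has_derivative_transform_within_open[OF _ S])
    show "((\<lambda>y. \<Sum>e\<in>obasis. (c \<bullet> e) *\<^sub>R L y e) has_derivative ?D c) (at x)"
      by (intro has_derivative_sum has_derivative_scaleR_right has_derivative_dd L)
  qed (simp add: linear_obasis[OF lin, symmetric])
  have "((\<lambda>y. \<Sum>e\<in>obasis. (a y \<bullet> e) *\<^sub>R L y e) has_derivative
      (\<lambda>u. \<Sum>e\<in>obasis. (a x \<bullet> e) *\<^sub>R dd (\<lambda>y. L y e) x u + (a' u \<bullet> e) *\<^sub>R L x e)) (at x)"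
    by (intro has_derivative_sum has_derivative_scaleR has_derivative_inner_left a
        has_derivative_dd L)
  then have "((\<lambda>y. L y (a y)) has_derivative
      (\<lambda>u. \<Sum>e\<in>obasis. (a x \<bullet> e) *\<^sub>R dd (\<lambda>y. L y e) x u + (a' u \<bullet> e) *\<^sub>R L x e)) (at x)"
    by (rule has_derivative_transform_within_open[OF _ S])
      (simp add: linear_obasis[OF lin, symmetric])
  then show ?thesis
    by (rule has_derivative_eq_rhs)
      (intro ext, simp only: sum.distrib fun_cong[OF dd_eqI[OF D0[of "a x"]]]
        linear_obasis[OF lin[OF S(2)], of "a' _"])
qed

lemma smooth_on_linear_family:
  fixes L :: "'v::real_normed_vector \<Rightarrow> 'a::findim_inner \<Rightarrow> 'b::real_normed_vector"
  assumes S: "open S" and lin: "\<And>y. y \<in> S \<Longrightarrow> linear (L y)"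
    and L: "\<And>v. smooth_on S (\<lambda>y. L y v)" and a: "smooth_on S a"
  shows "smooth_on S (\<lambda>y. L y (a y))"
proof (rule smooth_on_cong[OF S])
  show "smooth_on S (\<lambda>y. \<Sum>e\<in>obasis. (a y \<bullet> e) *\<^sub>R L y e)"
    by (intro smooth_on_sum S smooth_on_scaleR L
        smooth_on_linear[OF S bounded_linear_inner_left a])
qed (simp add: linear_obasis[OF lin, symmetric])

lemma smooth_on_bilinear_family:
  fixes \<beta> :: "'v::real_normed_vector \<Rightarrow> 'a::findim_inner \<Rightarrow> 'c::findim_inner \<Rightarrow> 'b::real_normed_vector"
  assumes S: "open S" and lin: "\<And>y. y \<in> S \<Longrightarrow> bilinear (\<beta> y)"
    and L: "\<And>u v. smooth_on S (\<lambda>y. \<beta> y u v)" and a: "smooth_on S a" "smooth_on S b"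
  shows "smooth_on S (\<lambda>y. \<beta> y (a y) (b y))"
proof (rule smooth_on_linear_family[OF S _ _ a(2)])
  show "linear (\<beta> y (a y))" if "y \<in> S" for y using bilinear_linear(2)[OF lin[OF that]] .
  show "smooth_on S (\<lambda>y. \<beta> y (a y) v)" for v
    by (rule smooth_on_linear_family[OF S _ L a(1)]) (use bilinear_linear(1)[OF lin] in blast)
qed

lemma bilinear_family_has_derivative:
  fixes \<beta> :: "'v::real_normed_vector \<Rightarrow> 'a::findim_inner \<Rightarrow> 'c::findim_inner \<Rightarrow> 'b::real_normed_vector"
  assumes S: "open S" "x \<in> S" and lin: "\<And>y. y \<in> S \<Longrightarrow> bilinear (\<beta> y)"
    and L: "\<And>u v. (\<lambda>y. \<beta> y u v) differentiable (at x)"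
    and a: "(a has_derivative a') (at x)" "(b has_derivative b') (at x)"
  shows "((\<lambda>y. \<beta> y (a y) (b y)) has_derivative
    (\<lambda>u. dd (\<lambda>y. \<beta> y (a x) (b x)) x u + \<beta> x (a' u) (b x) + \<beta> x (a x) (b' u))) (at x)"
proof -
  have 1: "((\<lambda>y. \<beta> y (a y) v) has_derivative
      (\<lambda>u. dd (\<lambda>y. \<beta> y (a x) v) x u + \<beta> x (a' u) v)) (at x)" for v
    by (rule linear_family_has_derivative[OF S _ L a(1)])
      (use bilinear_linear(1)[OF lin] in blast)
  have "((\<lambda>y. \<beta> y (a y) (b y)) has_derivative
    (\<lambda>u. dd (\<lambda>y. \<beta> y (a y) (b x)) x u + \<beta> x (a x) (b' u))) (at x)"
    by (rule linear_family_has_derivative[OF S bilinear_linear(2)[OF lin] _ a(2)])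
      (use 1 differentiable_def in blast)+
  then show ?thesis by (simp add: dd_eqI[OF 1] add.assoc)
qed

section \<open>Chain rule and smoothness of composites\<close>

lemma has_derivative_compose_dd:
  assumes "(f has_derivative f') (at x)" "g differentiable (at (f x))"
  shows "((\<lambda>y. g (f y)) has_derivative (\<lambda>u. dd g (f x) (f' u))) (at x)"
  using diff_chain_at[OF assms(1) has_derivative_dd[OF assms(2)]] by (simp add: o_def)

lemma C_k_on_compose:
  fixes F :: "'v::real_normed_vector \<Rightarrow> 'w::findim_inner"
  assumes "open S" "\<And>x. x \<in> S \<Longrightarrow> F x \<in> T" "C_k_on k S F" "C_k_on k T f"
  shows "C_k_on k S (\<lambda>x. f (F x))"
  using assms(3,4)
proof (induction k arbitrary: f)
  case 0
  then show ?case
    using assms(2) continuous_on_compose2[of T f S F] by auto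
next
  case (Suc k)
  have D: "((\<lambda>x. f (F x)) has_derivative (\<lambda>u. dd f (F x) (dd F x u))) (at x)" if "x \<in> S" for x
    using Suc.prems that assms(2) by (auto intro!: has_derivative_compose_dd has_derivative_dd)
  have lin: "linear (dd f (F x))" if "x \<in> S" for x
    using Suc.prems that assms(2) by (auto intro!: linear_dd)
  have "C_k_on k S (\<lambda>x. dd (\<lambda>x. f (F x)) x v)" for v
  proof (rule C_k_on_cong[OF assms(1)])
    \<comment> \<open>\<open>C_k_on\<close> controls derivatives in fixed directions, whereas the
      chain rule differentiates \<open>f\<close> in the moving direction \<open>dd F x v\<close>.
      Coordinates in \<open>obasis\<close> separate the two.\<close>
    show "C_k_on k S (\<lambda>x. \<Sum>e\<in>obasis. (dd F x v \<bullet> e) *\<^sub>R dd f (F x) e)"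
    proof (intro C_k_on_sum C_k_on_bilinear[OF _ bounded_bilinear_scaleR] assms(1))
      fix e :: 'w
      show "C_k_on k S (\<lambda>x. dd F x v \<bullet> e)"
        by (rule C_k_on_linear[OF assms(1) bounded_linear_inner_left]) (use Suc.prems in auto)
      show "C_k_on k S (\<lambda>x. dd f (F x) e)"
        by (rule Suc.IH[OF C_k_on_Suc_D[OF Suc.prems(1)]]) (use Suc.prems in auto)
    qed
  qed (simp add: dd_eqI[OF D] linear_obasis[OF lin, symmetric])
  with D show ?case by (auto simp: differentiable_def)
qed

lemma smooth_on_compose:
  fixes F :: "'v::real_normed_vector \<Rightarrow> 'w::findim_inner"
  shows "open S \<Longrightarrow> (\<And>x. x \<in> S \<Longrightarrow> F x \<in> T) \<Longrightarrow> smooth_on S F \<Longrightarrow> smooth_on T f \<Longrightarrow>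
    smooth_on S (\<lambda>x. f (F x))"
  unfolding smooth_on_def using C_k_on_compose by blast

lemma smooth_on_powr: "smooth_on {0<..} (\<lambda>t::real. t powr r)"
proof -
  \<comment> \<open>Generalised over \<open>c\<close> and \<open>r\<close> so that the family is
    closed under differentiation; the direction \<open>v\<close> is absorbed into the
    factor.\<close>
  have "C_k_on k {0<..} (\<lambda>t::real. c * t powr r)" for k c
  proof (induction k arbitrary: c r)
    case 0
    then show ?case by (auto intro!: continuous_intros)
  next
    case (Suc k)
    have D: "((\<lambda>t. c * t powr r) has_derivative (\<lambda>v. v * (c * r * x powr (r - 1)))) (at x)"
      if "x > 0" for x :: real
      using that by (auto intro!: derivative_eq_intros simp: fun_eq_iff powr_diff field_simps)
    have "C_k_on k {0<..} (\<lambda>t. dd (\<lambda>t. c * t powr r) t v)" for v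
      by (rule C_k_on_cong[OF _ _ Suc.IH[of "v * (c * r)" "r - 1"]]) (auto simp: dd_eqI[OF D])
    with D show ?case by (auto simp: differentiable_def)
  qed
  from this[of _ 1] show ?thesis by (simp add: smooth_on_def)
qed

lemma smooth_on_rsqrt:
  fixes f :: "'v::real_normed_vector \<Rightarrow> real"
  assumes "open S" "smooth_on S f" "\<And>x. x \<in> S \<Longrightarrow> f x > 0"
  shows "smooth_on S (\<lambda>x. 1 / sqrt (f x))"
proof (rule smooth_on_cong[OF assms(1)])
  show "smooth_on S (\<lambda>x. f x powr (- (1/2)))"
    by (rule smooth_on_compose[OF assms(1) _ assms(2) smooth_on_powr]) (use assms(3) in simp)
qed (metis assms(3) less_imp_le powr_half_sqrt powr_minus_divide)

section \<open>Smooth orthonormal frames and metric duals\<close>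

definition smooth_metric :: "'v::findim_inner set \<Rightarrow> 'v lmetric \<Rightarrow> bool" where
  "smooth_metric S G \<longleftrightarrow>
    open S \<and> (\<forall>y\<in>S. inner_prod (G y)) \<and> (\<forall>u v. smooth_on S (\<lambda>y. G y u v))"

text \<open>Gram-Schmidt on constant fields. At every point the frame spans the fixed space
  \<open>span B\<close>, and \<open>v\<close> lies outside it, so the remainder \<open>w\<close>
  vanishes nowhere and the frame lives on all of \<open>S\<close>.\<close>

lemma smooth_orthonormal_frame:
  assumes G: "smooth_metric S G" and "finite B" "independent B"
  shows "\<exists>e. (\<forall>b\<in>B. smooth_on S (e b)) \<and>
    (\<forall>y\<in>S. (\<forall>b\<in>B. \<forall>b'\<in>B. G y (e b y) (e b' y) = (if b = b' then 1 else 0)) \<and>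
       span ((\<lambda>b. e b y) ` B) = span B)"
  using assms(2,3)
proof induction
  case empty
  show ?case by simp
next
  case (insert v B)
  have S: "open S" and ip: "\<And>y. y \<in> S \<Longrightarrow> inner_prod (G y)" and sm: "\<And>u v. smooth_on S (\<lambda>y. G y u v)"
    using G by (auto simp: smooth_metric_def)
  have bl: "\<And>y. y \<in> S \<Longrightarrow> bilinear (G y)" using ip inner_prodD by blast
  have iB: "independent B" and v: "v \<notin> span B"
    using insert by (auto simp: independent_insert)
  obtain e where E: "(\<forall>b\<in>B. smooth_on S (e b)) \<and>
    (\<forall>y\<in>S. (\<forall>b\<in>B. \<forall>b'\<in>B. G y (e b y) (e b' y) = (if b = b' then 1 else 0)) \<and>
       span ((\<lambda>b. e b y) ` B) = span B)"
    using insert.IH[OF iB] by (elim exE)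
  have e: "smooth_on S (e b)" if "b \<in> B" for b using E that by blast
  have o: "G y (e b y) (e b' y) = (if b = b' then 1 else 0)" if "y \<in> S" "b \<in> B" "b' \<in> B" for y b b'
    using E that by blast
  have sp: "span ((\<lambda>b. e b y) ` B) = span B" if "y \<in> S" for y using E that by blast
  define s where "s y = (\<Sum>b\<in>B. G y v (e b y) *\<^sub>R e b y)" for y
  define w where "w y = v - s y" for y
  define n where "n y = (1 / sqrt (G y (w y) (w y))) *\<^sub>R w y" for y
  have s: "s y \<in> span ((\<lambda>b. e b y) ` B)" for y
    unfolding s_def by (intro span_sum span_scale span_base) auto
  have pos: "G y (w y) (w y) > 0" if "y \<in> S" for y
  proof -
    have "w y \<noteq> 0" using s[of y] v sp[OF that] by (auto simp: w_def)
    then show ?thesis by (rule inner_prodD(3)[OF ip[OF that]])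
  qed
  have "smooth_on S s"
    unfolding s_def
    by (intro smooth_on_sum S smooth_on_scaleR e smooth_on_bilinear_family[OF S bl sm]) auto
  then have w: "smooth_on S w"
    unfolding w_def by (intro smooth_on_diff S) auto
  have n: "smooth_on S n"
    unfolding n_def
    by (intro smooth_on_scaleR S w smooth_on_rsqrt smooth_on_bilinear_family[OF S bl sm] pos) auto
  have ws: "G y (w y) (e b y) = 0" if "b \<in> B" "y \<in> S" for b y
  proof -
    have "G y (s y) (e b y) = (\<Sum>x\<in>B. G y v (e x y) * (if x = b then 1 else 0))"
      unfolding s_def using that o by (simp add: bilinear_lsum[OF bl] bilinear_lmul[OF bl])
    also have "\<dots> = G y v (e b y)" using that insert.hyps by (simp add: if_distrib cong: if_cong)
    finally show ?thesis using that by (simp add: w_def bilinear_lsub[OF bl])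
  qed
  have nn: "G y (n y) (n y) = 1" "b \<in> B \<Longrightarrow> G y (n y) (e b y) = 0" "b \<in> B \<Longrightarrow> G y (e b y) (n y) = 0"
    if "y \<in> S" for y b
    using pos[OF that] ws[OF _ that] inner_prodD(2)[OF ip[OF that]]
    by (auto simp: n_def bilinear_lmul[OF bl[OF that]] bilinear_rmul[OF bl[OF that]])
  have span: "span (insert (n y) ((\<lambda>b. e b y) ` B)) = span (insert v B)" (is "span ?E = _")
    if y: "y \<in> S" for y
  proof -
    have "v = s y + sqrt (G y (w y) (w y)) *\<^sub>R n y" using pos[OF y] by (simp add: n_def w_def)
    moreover have "s y \<in> span ?E" using s[of y] span_mono[of _ ?E] by blast
    moreover have "n y \<in> span ?E" by (rule span_base) simp
    ultimately have "v \<in> span ?E" by (metis span_add span_scale)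
    moreover have "B \<subseteq> span ?E"
      using sp[OF y] span_mono[of "(\<lambda>b. e b y) ` B" ?E] span_superset[of B] by blast
    moreover have "?E \<subseteq> span (insert v B)"
    proof -
      have *: "span B \<subseteq> span (insert v B)" by (rule span_mono) auto
      moreover have "v \<in> span (insert v B)" by (rule span_base) simp
      moreover have "s y \<in> span (insert v B)" using s[of y] sp[OF y] * by auto
      moreover have "(\<lambda>b. e b y) ` B \<subseteq> span B"
        using span_superset[of "(\<lambda>b. e b y) ` B"] unfolding sp[OF y] .
      ultimately show ?thesis
        by (auto simp: n_def w_def intro!: span_scale span_diff)
    qed
    ultimately show ?thesis
      by (intro subset_antisym span_minimal subspace_span) auto
  qed
  have "v \<notin> B" by fact
  then have img: "(\<lambda>b. (e(v := n)) b y) ` insert v B = insert (n y) ((\<lambda>b. e b y) ` B)" for y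
    by auto
  show ?case
  proof (rule exI[of _ "e(v := n)"], intro conjI ballI, goal_cases)
    case (1 b)
    then show ?case using e n by (cases "b = v") auto
  next
    case (2 y b b')
    then show ?case
      using o nn by (cases "b = v"; cases "b' = v") auto
  next
    case (3 y)
    then show ?case unfolding img by (rule span)
  qed
qed

text \<open>In a smooth orthonormal frame the dual vector is a finite sum of smooth terms, so no
  inverse matrix has to be differentiated. The form with \<open>THE\<close> is that of
  \<open>christoffel\<close>.\<close>

lemma riesz_smooth:
  fixes G :: "'v::findim_inner lmetric"
  assumes G: "smooth_metric S G" and b: "\<And>y. y \<in> S \<Longrightarrow> linear (b y)" "\<And>v. smooth_on S (\<lambda>y. b y v)"
  shows "smooth_on S (\<lambda>y. THE z. \<forall>w. G y z w = b y w)"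
    and "y \<in> S \<Longrightarrow> G y (THE z. \<forall>w. G y z w = b y w) w = b y w"
proof -
  have S: "open S" and ip: "\<And>y. y \<in> S \<Longrightarrow> inner_prod (G y)"
    using G by (auto simp: smooth_metric_def)
  obtain B :: "'v set" where B: "finite B" "independent B" "span B = UNIV"
    using finite_basis[OF subspace_UNIV] by blast
  obtain e where e: "\<And>b. b \<in> B \<Longrightarrow> smooth_on S (e b)"
    and o: "\<And>y b b'. y \<in> S \<Longrightarrow> b \<in> B \<Longrightarrow> b' \<in> B \<Longrightarrow> G y (e b y) (e b' y) = (if b = b' then 1 else 0)"
    and sp: "\<And>y. y \<in> S \<Longrightarrow> span ((\<lambda>b. e b y) ` B) = UNIV"
    using smooth_orthonormal_frame[OF G B(1,2)] unfolding B(3) by metis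
  define z where "z y = (\<Sum>c\<in>B. b y (e c y) *\<^sub>R e c y)" for y
  have z: "G y (z y) w = b y w" if y: "y \<in> S" for y w
  proof -
    have bl: "bilinear (G y)" using ip[OF y] inner_prodD by blast
    have *: "G y (z y) (e a y) = b y (e a y)" if "a \<in> B" for a
    proof -
      have "G y (z y) (e a y) = (\<Sum>c\<in>B. b y (e c y) * (if c = a then 1 else 0))"
        unfolding z_def using that o y by (simp add: bilinear_lsum[OF bl] bilinear_lmul[OF bl])
      also have "\<dots> = b y (e a y)" using that B by (simp add: if_distrib cong: if_cong)
      finally show ?thesis .
    qed
    have "w \<in> span ((\<lambda>b. e b y) ` B)" using sp[OF y] by simp
    then show ?thesis
      by (rule linear_eq_on[OF bilinear_linear(2)[OF bl] b(1)[OF y]]) (use * in auto)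
  qed
  have the: "(THE z. \<forall>w. G y z w = b y w) = z y" if y: "y \<in> S" for y
  proof (rule the_equality)
    fix z' assume z': "\<forall>w. G y z' w = b y w"
    have "G y (z' - z y) (z' - z y) = 0"
      using z z' y inner_prodD(1)[OF ip[OF y]] by (simp add: bilinear_lsub)
    then show "z' = z y" using inner_prodD(4)[OF ip[OF y]] by simp
  qed (use z y in simp)
  show "y \<in> S \<Longrightarrow> G y (THE z. \<forall>w. G y z w = b y w) w = b y w" using the z by simp
  have "smooth_on S z"
    unfolding z_def by (intro smooth_on_sum S smooth_on_scaleR e smooth_on_linear_family[OF S b])
  then show "smooth_on S (\<lambda>y. THE z. \<forall>w. G y z w = b y w)"
    by (rule smooth_on_cong[OF S, rotated]) (use the in auto)
qed

section \<open>Symmetry of second derivatives\<close>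

text \<open>The mean value theorem twice: in direction \<open>u\<close> for the increment of
  \<open>f\<close> along \<open>h *\<^sub>R v\<close>, then in direction \<open>v\<close> for the
  derivative along \<open>u\<close>.\<close>

lemma second_difference:
  fixes f :: "'v::real_normed_vector \<Rightarrow> real"
  assumes h: "h > 0" and f: "\<And>s t. 0 \<le> s \<Longrightarrow> s \<le> h \<Longrightarrow> 0 \<le> t \<Longrightarrow> t \<le> h \<Longrightarrow>
      x + s *\<^sub>R u + t *\<^sub>R v \<in> S"
    and S: "\<And>y. y \<in> S \<Longrightarrow> f differentiable (at y)"
      "\<And>y. y \<in> S \<Longrightarrow> (\<lambda>y. dd f y u) differentiable (at y)"
  shows "\<exists>s t. 0 \<le> s \<and> s \<le> h \<and> 0 \<le> t \<and> t \<le> h \<and>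
    f (x + h *\<^sub>R u + h *\<^sub>R v) - f (x + h *\<^sub>R u) - f (x + h *\<^sub>R v) + f x =
      h * h * dd (\<lambda>y. dd f y u) (x + s *\<^sub>R u + t *\<^sub>R v) v"
proof -
  have path: "((\<lambda>s. g (p + s *\<^sub>R a)) has_real_derivative dd g (p + s *\<^sub>R a) a) (at s)"
    if "g differentiable (at (p + s *\<^sub>R a))" for g :: "'v \<Rightarrow> real" and p a s
  proof -
    have "((\<lambda>s. p + s *\<^sub>R a) has_derivative (\<lambda>s. s *\<^sub>R a)) (at s)"
      by (auto intro!: derivative_eq_intros)
    from has_derivative_compose_dd[OF this that]
    have "((\<lambda>s. g (p + s *\<^sub>R a)) has_derivative (\<lambda>r. dd g (p + s *\<^sub>R a) (r *\<^sub>R a))) (at s)" .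
    then show ?thesis
      by (simp add: has_field_derivative_def linear_cmul[OF linear_dd[OF that]] mult.commute[of _ "dd _ _ _"])
  qed
  have "\<exists>s. 0 < s \<and> s < h \<and>
      (f (x + h *\<^sub>R v + h *\<^sub>R u) - f (x + h *\<^sub>R u)) - (f (x + h *\<^sub>R v + 0 *\<^sub>R u) - f (x + 0 *\<^sub>R u)) =
      (h - 0) * (dd f (x + h *\<^sub>R v + s *\<^sub>R u) u - dd f (x + s *\<^sub>R u) u)"
  proof (rule MVT2[OF h, of "\<lambda>s. f (x + h *\<^sub>R v + s *\<^sub>R u) - f (x + s *\<^sub>R u)"])
    fix s assume s: "0 \<le> s" "s \<le> h"
    have "x + h *\<^sub>R v + s *\<^sub>R u \<in> S" "x + s *\<^sub>R u \<in> S"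
      using f[OF s, of h] f[OF s, of 0] h by (simp_all add: algebra_simps)
    then show "((\<lambda>s. f (x + h *\<^sub>R v + s *\<^sub>R u) - f (x + s *\<^sub>R u)) has_real_derivative
        dd f (x + h *\<^sub>R v + s *\<^sub>R u) u - dd f (x + s *\<^sub>R u) u) (at s)"
      by (intro DERIV_diff path S)
  qed
  then obtain s where s: "0 < s" "s < h"
    "f (x + h *\<^sub>R u + h *\<^sub>R v) - f (x + h *\<^sub>R u) - f (x + h *\<^sub>R v) + f x =
      h * (dd f (x + s *\<^sub>R u + h *\<^sub>R v) u - dd f (x + s *\<^sub>R u) u)"
    by (auto simp: algebra_simps)
  have "\<exists>t. 0 < t \<and> t < h \<and> dd f (x + s *\<^sub>R u + h *\<^sub>R v) u - dd f (x + s *\<^sub>R u + 0 *\<^sub>R v) u =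
      (h - 0) * dd (\<lambda>y. dd f y u) (x + s *\<^sub>R u + t *\<^sub>R v) v"
    by (rule MVT2[OF h, of "\<lambda>t. dd f (x + s *\<^sub>R u + t *\<^sub>R v) u"])
      (use s f in \<open>intro path S; simp\<close>)
  then obtain t where t: "0 < t" "t < h" "dd f (x + s *\<^sub>R u + h *\<^sub>R v) u - dd f (x + s *\<^sub>R u) u =
      h * dd (\<lambda>y. dd f y u) (x + s *\<^sub>R u + t *\<^sub>R v) v" by auto
  show ?thesis
    by (rule exI[of _ s], rule exI[of _ t]) (use s t in simp)
qed

text \<open>The second difference over a parallelogram does not change when \<open>u\<close> and
  \<open>v\<close> are exchanged, so a value of one mixed derivative near \<open>x\<close> equals a
  value of the other near \<open>x\<close>; continuity then excludes a gap at
  \<open>x\<close>.\<close>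

lemma dd_dd_commute_real:
  fixes f :: "'v::real_normed_vector \<Rightarrow> real"
  assumes S: "open S" "x \<in> S" and f: "smooth_on S f"
  shows "dd (\<lambda>y. dd f y u) x v = dd (\<lambda>y. dd f y v) x u"
proof (rule ccontr)
  let ?A = "\<lambda>y. dd (\<lambda>y. dd f y u) y v" and ?B = "\<lambda>y. dd (\<lambda>y. dd f y v) y u"
  assume ne: "?A x \<noteq> ?B x"
  define d where "d = \<bar>?A x - ?B x\<bar> / 2"
  have d: "d > 0" using ne by (simp add: d_def)
  have "continuous_on S ?A" "continuous_on S ?B"
    using f by (auto intro!: smooth_on_imp_continuous_on smooth_on_dd)
  then have "isCont ?A x" "isCont ?B x" using S by (auto simp: continuous_on_eq_continuous_at)
  then obtain r1 r2 where r: "r1 > 0" "\<And>y. dist y x < r1 \<Longrightarrow> \<bar>?A y - ?A x\<bar> < d"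
      "r2 > 0" "\<And>y. dist y x < r2 \<Longrightarrow> \<bar>?B y - ?B x\<bar> < d"
    using d unfolding continuous_at_eps_delta dist_real_def by metis
  obtain r3 where r3: "r3 > 0" "ball x r3 \<subseteq> S" using S open_contains_ball by blast
  define r where "r = min r1 (min r2 r3)"
  have "r > 0" using r r3 by (simp add: r_def)
  \<comment> \<open>The summand 1 keeps \<open>K\<close> positive for \<open>u = v = 0\<close>.
    Since \<open>h * K = r / 2\<close>, the whole parallelogram lies within distance
    \<open>r\<close> of \<open>x\<close>.\<close>
  define K where "K = norm u + norm v + 1"
  define h where "h = r / K / 2"
  have N: "K > 0" unfolding K_def by (smt (verit) norm_ge_zero)
  have h: "h > 0" using \<open>r > 0\<close> N by (simp add: h_def)
  have hN: "h * K = r / 2" using N by (simp add: h_def)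
  have near: "dist (x + s *\<^sub>R u + t *\<^sub>R v) x < r" if "0 \<le> s" "s \<le> h" "0 \<le> t" "t \<le> h" for s t
  proof -
    have "dist (x + s *\<^sub>R u + t *\<^sub>R v) x \<le> s * norm u + t * norm v"
      using norm_triangle_ineq[of "s *\<^sub>R u" "t *\<^sub>R v"] that by (simp add: dist_norm)
    also have "\<dots> \<le> h * norm u + h * norm v"
      using that by (intro add_mono mult_right_mono) auto
    also have "\<dots> < r" using hN h \<open>r > 0\<close> by (simp add: K_def algebra_simps)
    finally show ?thesis .
  qed
  have inS: "x + s *\<^sub>R u + t *\<^sub>R v \<in> S" if "0 \<le> s" "s \<le> h" "0 \<le> t" "t \<le> h" for s t
    using near[OF that] r3 by (auto simp: r_def dist_commute)
  have df: "f differentiable (at y)" "(\<lambda>y. dd f y u) differentiable (at y)" if "y \<in> S" for u y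
    using f that by (auto intro!: smooth_on_imp_differentiable smooth_on_dd)
  obtain s t where st: "0 \<le> s" "s \<le> h" "0 \<le> t" "t \<le> h"
    "f (x + h *\<^sub>R u + h *\<^sub>R v) - f (x + h *\<^sub>R u) - f (x + h *\<^sub>R v) + f x = h * h * ?A (x + s *\<^sub>R u + t *\<^sub>R v)"
    using second_difference[OF h inS df] by blast
  have inS': "x + s *\<^sub>R v + t *\<^sub>R u \<in> S" if "0 \<le> s" "s \<le> h" "0 \<le> t" "t \<le> h" for s t
    using inS[of t s] that by (simp add: algebra_simps)
  obtain s' t' where st': "0 \<le> s'" "s' \<le> h" "0 \<le> t'" "t' \<le> h"
    "f (x + h *\<^sub>R v + h *\<^sub>R u) - f (x + h *\<^sub>R v) - f (x + h *\<^sub>R u) + f x = h * h * ?B (x + s' *\<^sub>R v + t' *\<^sub>R u)"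
    using second_difference[OF h inS' df] by blast
  have "h * h * ?A (x + s *\<^sub>R u + t *\<^sub>R v) = h * h * ?B (x + s' *\<^sub>R v + t' *\<^sub>R u)"
    using st(5) st'(5) by (simp add: algebra_simps)
  then have eq: "?A (x + s *\<^sub>R u + t *\<^sub>R v) = ?B (x + t' *\<^sub>R u + s' *\<^sub>R v)"
    using h by (simp add: algebra_simps)
  have "\<bar>?A (x + s *\<^sub>R u + t *\<^sub>R v) - ?A x\<bar> < d" "\<bar>?B (x + t' *\<^sub>R u + s' *\<^sub>R v) - ?B x\<bar> < d"
    using near[OF st(1-4)] near[OF st'(3,4,1,2)] r by (auto simp: r_def)
  then show False using eq by (simp add: d_def abs_if split: if_splits)
qed

lemma dd_dd_commute:
  fixes f :: "'v::real_normed_vector \<Rightarrow> 'w::findim_inner"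
  assumes S: "open S" "x \<in> S" and f: "smooth_on S f"
  shows "dd (\<lambda>y. dd f y u) x v = dd (\<lambda>y. dd f y v) x u"
proof -
  have 1: "dd (\<lambda>y. g y \<bullet> a) y w = dd g y w \<bullet> a" if "smooth_on S g" "y \<in> S" for g :: "'v \<Rightarrow> 'w" and y w a
    by (subst dd_eqI[OF has_derivative_inner_left[OF smooth_on_has_derivative[OF that]]]) simp
  have 2: "dd (\<lambda>y. dd (\<lambda>y. f y \<bullet> a) y u) x v = dd (\<lambda>y. dd f y u) x v \<bullet> a" for u v a
    by (subst dd_cong_open[OF S 1[OF f]], assumption, rule 1[OF smooth_on_dd[OF f] S(2)])
  have "smooth_on S (\<lambda>y. f y \<bullet> a)" for a
    by (rule smooth_on_linear[OF S(1) bounded_linear_inner_left f])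
  then have "dd (\<lambda>y. dd f y u) x v \<bullet> a = dd (\<lambda>y. dd f y v) x u \<bullet> a" for a
    using dd_dd_commute_real[OF S] 2 by metis
  then show ?thesis by (metis vector_eq_rdot)
qed

section \<open>The Levi-Civita connection in a chart\<close>

lemma linear_dd_family:
  assumes S: "open S" "x \<in> S" and lin: "\<And>y. y \<in> S \<Longrightarrow> linear (L y)"
    and L: "\<And>v. (\<lambda>y. L y v) differentiable (at x)"
  shows "linear (\<lambda>v. dd (\<lambda>y. L y v) x u)"
proof (rule linearI)
  fix a b
  have "((\<lambda>y. L y (a + b)) has_derivative (\<lambda>u. dd (\<lambda>y. L y a) x u + dd (\<lambda>y. L y b) x u)) (at x)"
    by (rule has_derivative_transform_within_open
        [OF has_derivative_add[OF has_derivative_dd[OF L] has_derivative_dd[OF L]] S])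
      (simp add: linear_add[OF lin])
  then show "dd (\<lambda>y. L y (a + b)) x u = dd (\<lambda>y. L y a) x u + dd (\<lambda>y. L y b) x u"
    by (simp add: dd_eqI)
next
  fix r a
  have "((\<lambda>y. L y (r *\<^sub>R a)) has_derivative (\<lambda>u. r *\<^sub>R dd (\<lambda>y. L y a) x u)) (at x)"
    by (rule has_derivative_transform_within_open
        [OF has_derivative_scaleR_right[OF has_derivative_dd[OF L]] S])
      (simp add: linear_cmul[OF lin])
  then show "dd (\<lambda>y. L y (r *\<^sub>R a)) x u = r *\<^sub>R dd (\<lambda>y. L y a) x u"
    by (simp add: dd_eqI)
qed

locale riem =
  fixes S :: "'v::findim_inner set" and G :: "'v lmetric"
  assumes smooth_metric: "smooth_metric S G"
begin

abbreviation \<Gamma> where "\<Gamma> \<equiv> christoffel G"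

lemma open_S: "open S"
  using smooth_metric by (simp add: smooth_metric_def)

lemma inner_prod_G: "y \<in> S \<Longrightarrow> inner_prod (G y)"
  using smooth_metric by (simp add: smooth_metric_def)

lemma smooth_G: "smooth_on S (\<lambda>y. G y u v)"
  using smooth_metric by (simp add: smooth_metric_def)

lemma bilinear_G: "y \<in> S \<Longrightarrow> bilinear (G y)"
  using inner_prod_G inner_prodD by blast

lemmas G_simps = bilinear_simps[OF bilinear_G]

lemma G_commute: "y \<in> S \<Longrightarrow> G y u v = G y v u"
  using inner_prod_G inner_prodD by blast

lemma G_ext: "y \<in> S \<Longrightarrow> (\<And>w. G y a w = G y b w) \<Longrightarrow> a = b"
  using inner_prodD(4)[OF inner_prod_G, of y "a - b"] by (simp add: G_simps)

lemma dG_commute: "y \<in> S \<Longrightarrow> dd (\<lambda>y. G y u v) y = dd (\<lambda>y. G y v u) y"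
  by (rule dd_cong_open[OF open_S]) (auto simp: G_commute)

lemma linear_dG:
  assumes "y \<in> S"
  shows "linear (dd (\<lambda>y. G y v w) y)" "linear (\<lambda>v. dd (\<lambda>y. G y v w) y u)"
    "linear (\<lambda>w. dd (\<lambda>y. G y v w) y u)"
proof -
  have d: "(\<lambda>y. G y v w) differentiable (at y)" for v w
    using assms smooth_G smooth_on_imp_differentiable by blast
  show "linear (dd (\<lambda>y. G y v w) y)" by (rule linear_dd[OF d])
  show "linear (\<lambda>v. dd (\<lambda>y. G y v w) y u)"
    by (rule linear_dd_family[OF open_S assms bilinear_linear(1)[OF bilinear_G] d])
  show "linear (\<lambda>w. dd (\<lambda>y. G y v w) y u)"
    by (rule linear_dd_family[OF open_S assms bilinear_linear(2)[OF bilinear_G] d])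
qed

lemma christoffel_smooth: "smooth_on S (\<lambda>y. \<Gamma> y u v)"
  and christoffel_eq: "y \<in> S \<Longrightarrow> 2 * G y (\<Gamma> y u v) w =
    dd (\<lambda>y. G y v w) y u + dd (\<lambda>y. G y u w) y v - dd (\<lambda>y. G y u v) y w"
proof -
  define b where "b y w = (dd (\<lambda>y. G y v w) y u + dd (\<lambda>y. G y u w) y v - dd (\<lambda>y. G y u v) y w) / 2"
    for y w
  have lin: "linear (b y)" if "y \<in> S" for y
    by (rule linearI)
      (simp_all add: b_def linear_add[OF linear_dG(1)[OF that]] linear_add[OF linear_dG(3)[OF that]]
        linear_cmul[OF linear_dG(1)[OF that]] linear_cmul[OF linear_dG(3)[OF that]] algebra_simps
        add_divide_distrib diff_divide_distrib)
  have sm: "smooth_on S (\<lambda>y. b y w)" for w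
    unfolding b_def divide_inverse
    by (intro smooth_on_mult open_S smooth_on_diff smooth_on_add smooth_on_dd smooth_G smooth_on_const)
  have eq: "\<Gamma> y u v = (THE z. \<forall>w. G y z w = b y w)" for y
    unfolding christoffel_def b_def by (rule arg_cong[where f = The]) (simp add: fun_eq_iff field_simps)
  show "smooth_on S (\<lambda>y. \<Gamma> y u v)"
    unfolding eq by (rule riesz_smooth(1)[OF smooth_metric lin sm])
  show "2 * G y (\<Gamma> y u v) w =
    dd (\<lambda>y. G y v w) y u + dd (\<lambda>y. G y u w) y v - dd (\<lambda>y. G y u v) y w" if "y \<in> S"
  proof -
    have "G y (\<Gamma> y u v) w = b y w"
      unfolding eq by (rule riesz_smooth(2)[OF smooth_metric lin sm that])
    then show ?thesis by (simp add: b_def)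
  qed
qed

lemma christoffel_commute:
  assumes "y \<in> S"
  shows "\<Gamma> y u v = \<Gamma> y v u"
proof (rule G_ext[OF assms])
  show "G y (\<Gamma> y u v) w = G y (\<Gamma> y v u) w" for w
    using christoffel_eq[OF assms, of u v w] christoffel_eq[OF assms, of v u w]
      dG_commute[OF assms, of u v] by simp
qed

lemma bilinear_christoffel:
  assumes y: "y \<in> S"
  shows "bilinear (\<Gamma> y)"
proof -
  have E: "G y (\<Gamma> y u v) w =
    (dd (\<lambda>y. G y v w) y u + dd (\<lambda>y. G y u w) y v - dd (\<lambda>y. G y u v) y w) / 2" for u v w
    using christoffel_eq[OF y, of u v w] by simp
  note lins = linear_add[OF linear_dG(1)[OF y]] linear_add[OF linear_dG(2)[OF y]]
      linear_cmul[OF linear_dG(1)[OF y]] linear_cmul[OF linear_dG(2)[OF y]]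
  have 1: "linear (\<lambda>u. \<Gamma> y u v)" for v
    by (rule linearI; rule G_ext[OF y])
      (simp_all add: G_simps y E lins algebra_simps add_divide_distrib diff_divide_distrib)
  then show ?thesis
    using christoffel_commute[OF y] unfolding bilinear_def by (metis (no_types, lifting) ext)
qed

lemmas \<Gamma>_simps = bilinear_simps[OF bilinear_christoffel]

text \<open>Metric compatibility for constant fields: two Koszul formulas with the last two
  arguments exchanged are added, and only the derivative along \<open>u\<close> survives.\<close>

lemma dG_eq: "y \<in> S \<Longrightarrow> dd (\<lambda>y. G y v w) y u = G y (\<Gamma> y u v) w + G y v (\<Gamma> y u w)"
  using christoffel_eq[of y u v w] christoffel_eq[of y u w v] dG_commute[of y v w]
    G_commute[of y v "\<Gamma> y u w"] dG_commute[of y u w] dG_commute[of y u v] by simp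

lemma christoffel_differentiable: "y \<in> S \<Longrightarrow> (\<lambda>y. \<Gamma> y u v) differentiable (at y)"
  by (rule smooth_on_imp_differentiable[OF christoffel_smooth])

lemma G_differentiable: "y \<in> S \<Longrightarrow> (\<lambda>y. G y u v) differentiable (at y)"
  by (rule smooth_on_imp_differentiable[OF smooth_G])

lemma G_has_derivative:
  assumes "y \<in> S" "(a has_derivative a') (at y)" "(b has_derivative b') (at y)"
  shows "((\<lambda>y. G y (a y) (b y)) has_derivative (\<lambda>u. G y (a' u + \<Gamma> y u (a y)) (b y) +
    G y (a y) (b' u + \<Gamma> y u (b y)))) (at y)"
  by (rule has_derivative_eq_rhs[OF bilinear_family_has_derivative
        [OF open_S assms(1) bilinear_G G_differentiable assms(2,3)]])
    (use assms(1) in \<open>simp_all add: dG_eq fun_eq_iff G_simps\<close>)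

section \<open>The curvature tensor in coordinates and its traces\<close>

definition Riem :: "'v \<Rightarrow> 'v \<Rightarrow> 'v \<Rightarrow> 'v \<Rightarrow> 'v" where
  "Riem y a b c = dd (\<lambda>y. \<Gamma> y b c) y a - dd (\<lambda>y. \<Gamma> y a c) y b + \<Gamma> y a (\<Gamma> y b c) - \<Gamma> y b (\<Gamma> y a c)"

text \<open>Constant fields commute, so the bracket term of \<open>curvature\<close> drops out, and
  what remains is linear in each argument.\<close>

lemma curvature_eq:
  assumes "y \<in> S"
  shows "curvature G (\<lambda>_. a) (\<lambda>_. b) (\<lambda>_. c) y = Riem y a b c"
proof -
  have n: "nabla G (\<lambda>_. b) (\<lambda>_. c) = (\<lambda>y. \<Gamma> y b c)" for b c
    by (simp add: nabla_def fun_eq_iff)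
  show ?thesis
    unfolding curvature_def n
    using assms by (simp add: nabla_def lie_bracket_def Riem_def \<Gamma>_simps)
qed

lemma linear_d_christoffel:
  assumes "y \<in> S"
  shows "linear (dd (\<lambda>y. \<Gamma> y v w) y)" "linear (\<lambda>v. dd (\<lambda>y. \<Gamma> y v w) y u)"
    "linear (\<lambda>w. dd (\<lambda>y. \<Gamma> y v w) y u)"
proof -
  show "linear (dd (\<lambda>y. \<Gamma> y v w) y)" by (rule linear_dd[OF christoffel_differentiable[OF assms]])
  show "linear (\<lambda>v. dd (\<lambda>y. \<Gamma> y v w) y u)"
    by (rule linear_dd_family[OF open_S assms bilinear_linear(1)[OF bilinear_christoffel]
          christoffel_differentiable[OF assms]])
  show "linear (\<lambda>w. dd (\<lambda>y. \<Gamma> y v w) y u)"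
    by (rule linear_dd_family[OF open_S assms bilinear_linear(2)[OF bilinear_christoffel]
          christoffel_differentiable[OF assms]])
qed

lemma Riem_linear:
  assumes y: "y \<in> S"
  shows "linear (\<lambda>a. Riem y a b c)" "linear (\<lambda>b. Riem y a b c)" "linear (\<lambda>c. Riem y a b c)"
proof -
  note s = linear_add[OF linear_d_christoffel(1)[OF y]] linear_add[OF linear_d_christoffel(2)[OF y]]
    linear_add[OF linear_d_christoffel(3)[OF y]] linear_cmul[OF linear_d_christoffel(1)[OF y]]
    linear_cmul[OF linear_d_christoffel(2)[OF y]] linear_cmul[OF linear_d_christoffel(3)[OF y]]
    \<Gamma>_simps[OF y] Riem_def scaleR_add_right scaleR_diff_right
  show "linear (\<lambda>a. Riem y a b c)" "linear (\<lambda>b. Riem y a b c)" "linear (\<lambda>c. Riem y a b c)"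
    by (rule linearI; simp add: s)+
qed

lemma Riem_antisym: "Riem y a b c = - Riem y b a c"
  by (simp add: Riem_def)

text \<open>Differentiate \<open>G y c d\<close> twice with \<open>dG_eq\<close>. The terms with a
  Christoffel symbol in each slot of \<open>G\<close> are symmetric in \<open>a\<close> and
  \<open>b\<close>, so the symmetry of second derivatives leaves only the curvature terms.\<close>

lemma Riem_skew:
  assumes y: "y \<in> S"
  shows "G y (Riem y a b c) d + G y c (Riem y a b d) = 0"
proof -
  have D: "dd (\<lambda>y. dd (\<lambda>y. G y c d) y b) y a =
      G y (dd (\<lambda>y. \<Gamma> y b c) y a + \<Gamma> y a (\<Gamma> y b c)) d + G y (\<Gamma> y b c) (\<Gamma> y a d)
      + (G y (\<Gamma> y a c) (\<Gamma> y b d) + G y c (dd (\<lambda>y. \<Gamma> y b d) y a + \<Gamma> y a (\<Gamma> y b d)))" for a b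
  proof -
    have h: "((\<lambda>y. \<Gamma> y b c) has_derivative dd (\<lambda>y. \<Gamma> y b c) y) (at y)" for c
      by (rule has_derivative_dd[OF christoffel_differentiable[OF y]])
    have "dd (\<lambda>y. dd (\<lambda>y. G y c d) y b) y a = dd (\<lambda>y. G y (\<Gamma> y b c) d + G y c (\<Gamma> y b d)) y a"
      by (rule fun_cong[OF dd_cong_open[OF open_S y]]) (rule dG_eq)
    also have "\<dots> = G y (dd (\<lambda>y. \<Gamma> y b c) y a + \<Gamma> y a (\<Gamma> y b c)) d + G y (\<Gamma> y b c) (0 + \<Gamma> y a d)
      + (G y (0 + \<Gamma> y a c) (\<Gamma> y b d) + G y c (dd (\<lambda>y. \<Gamma> y b d) y a + \<Gamma> y a (\<Gamma> y b d)))"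
      by (rule fun_cong[OF dd_eqI]) (intro has_derivative_add G_has_derivative y h has_derivative_const)
    finally show ?thesis by simp
  qed
  have "dd (\<lambda>y. dd (\<lambda>y. G y c d) y b) y a = dd (\<lambda>y. dd (\<lambda>y. G y c d) y a) y b"
    by (rule dd_dd_commute_real[OF open_S y smooth_G])
  then show ?thesis
    unfolding D Riem_def by (simp add: G_simps[OF y])
qed

lemma ricci_eq:
  assumes y: "y \<in> S" and E: "orthonormal_basis (G y) UNIV E"
  shows "ricci G y u v = (\<Sum>e\<in>E. G y (Riem y e u v) e)"
proof -
  have "bilinear (\<lambda>e. G y (Riem y e u v))"
    unfolding bilinear_def
    using linear_compose[OF Riem_linear(1)[OF y] bilinear_linear(1)[OF bilinear_G[OF y]]]
      bilinear_linear(2)[OF bilinear_G[OF y]] by (auto simp: o_def)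
  from metric_trace_eq[where \<beta> = "\<lambda>e. G y (Riem y e u v)", OF inner_prod_G[OF y] this _ E]
  show ?thesis unfolding ricci_def curvature_eq[OF y] by simp
qed

lemma bilinear_ricci:
  assumes y: "y \<in> S"
  shows "bilinear (ricci G y)"
proof -
  obtain E where E: "orthonormal_basis (G y) UNIV E"
    using orthonormal_basis_exists[OF inner_prod_G[OF y] subspace_UNIV] .
  have "linear (\<lambda>u. G y (Riem y e u v) e)" "linear (\<lambda>v. G y (Riem y e u v) e)" for e u v
    using linear_compose[OF Riem_linear(2)[OF y] bilinear_linear(1)[OF bilinear_G[OF y]]]
      linear_compose[OF Riem_linear(3)[OF y] bilinear_linear(1)[OF bilinear_G[OF y]]]
    by (auto simp: o_def)
  then show ?thesis
    unfolding bilinear_def ricci_eq[OF y E] by (auto intro!: linear_compose_sum)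
qed

lemma scal_eq:
  assumes y: "y \<in> S" and E: "orthonormal_basis (G y) UNIV E"
  shows "scal G y = (\<Sum>e\<in>E. ricci G y e e)"
  unfolding scal_def
  using metric_trace_eq[where \<beta> = "ricci G y", OF inner_prod_G[OF y] bilinear_ricci[OF y] _ E]
  by simp

end

section \<open>Riemannian submersions with a unit vertical field\<close>

text \<open>The isometry condition is imposed on all vectors: unlike a statement about horizontal
  vectors, \<open>metric_split\<close> can be differentiated with \<open>u\<close> and
  \<open>v\<close> constant. It also forces the kernel of \<open>dd F y\<close> to be the line
  through \<open>U y\<close>.\<close>

locale framed_submersion = M: riem S G + N: riem Q H
  for S :: "'v::findim_inner set" and G :: "'v lmetric"
    and Q :: "'w::findim_inner set" and H :: "'w lmetric" +
  fixes F :: "'v \<Rightarrow> 'w" and U :: "'v \<Rightarrow> 'v" and V :: "'v \<Rightarrow> 'v set"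
  assumes smooth_F: "smooth_on S F" and F_into: "y \<in> S \<Longrightarrow> F y \<in> Q"
    and surj_dF: "y \<in> S \<Longrightarrow> surj (dd F y)"
    and V_eq: "y \<in> S \<Longrightarrow> V y = {u. dd F y u = 0}"
    and smooth_U: "smooth_on S U"
    and unit_U: "y \<in> S \<Longrightarrow> G y (U y) (U y) = 1"
    and dF_U: "y \<in> S \<Longrightarrow> dd F y (U y) = 0"
    and metric_split: "y \<in> S \<Longrightarrow>
      G y u v = H (F y) (dd F y u) (dd F y v) + G y u (U y) * G y v (U y)"
begin

abbreviation \<Gamma> where "\<Gamma> \<equiv> christoffel G"
abbreviation \<Gamma>' where "\<Gamma>' \<equiv> christoffel H"
abbreviation D2F where "D2F y u v \<equiv> dd (\<lambda>y. dd F y v) y u"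

definition \<theta> where "\<theta> y u = G y u (U y)"
definition \<phi> where "\<phi> y u = dd U y u + \<Gamma> y u (U y)"
definition \<omega> where "\<omega> y u v = G y (\<phi> y u) v"

lemmas open_S = M.open_S
lemmas G_simps = M.G_simps
lemmas \<Gamma>_simps = M.\<Gamma>_simps

lemma linear_dF: "y \<in> S \<Longrightarrow> linear (dd F y)"
  using linear_dd smooth_on_imp_differentiable[OF smooth_F] by blast

lemma D2F_commute: "y \<in> S \<Longrightarrow> D2F y u v = D2F y v u"
  by (rule dd_dd_commute[OF open_S _ smooth_F])

lemmas dF_simps = linear_add[OF linear_dF] linear_diff[OF linear_dF] linear_cmul[OF linear_dF]
  linear_neg[OF linear_dF] linear_0[OF linear_dF]

lemma dF_has_derivative:
  assumes "x \<in> S" "(a has_derivative a') (at x)"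
  shows "((\<lambda>y. dd F y (a y)) has_derivative (\<lambda>u. D2F x u (a x) + dd F x (a' u))) (at x)"
  by (rule linear_family_has_derivative[OF open_S assms(1) linear_dF _ assms(2)])
    (auto intro: smooth_on_imp_differentiable smooth_on_dd smooth_F assms(1))

lemma U_has_derivative: "x \<in> S \<Longrightarrow> (U has_derivative dd U x) (at x)"
  by (rule smooth_on_has_derivative[OF smooth_U])

lemma F_has_derivative: "x \<in> S \<Longrightarrow> (F has_derivative dd F x) (at x)"
  by (rule smooth_on_has_derivative[OF smooth_F])

lemma linear_dU: "x \<in> S \<Longrightarrow> linear (dd U x)"
  by (rule has_derivative_linear[OF U_has_derivative])

lemma linear_\<phi>: "x \<in> S \<Longrightarrow> linear (\<phi> x)"
  by (rule linearI) (simp_all add: \<phi>_def linear_add[OF linear_dU] linear_cmul[OF linear_dU]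
      \<Gamma>_simps scaleR_add_right)

lemmas \<phi>_simps = linear_add[OF linear_\<phi>] linear_diff[OF linear_\<phi>] linear_cmul[OF linear_\<phi>]
  linear_neg[OF linear_\<phi>] linear_0[OF linear_\<phi>]

lemma smooth_\<phi>: "smooth_on S (\<lambda>y. \<phi> y u)"
  unfolding \<phi>_def
  by (rule smooth_on_add[OF open_S smooth_on_dd[OF smooth_U] smooth_on_linear_family
        [OF open_S bilinear_linear(2)[OF M.bilinear_christoffel] M.christoffel_smooth smooth_U]])

text \<open>By metric compatibility the covariant derivative of \<theta> is \<omega>.\<close>

lemma \<theta>_has_derivative:
  assumes "x \<in> S" "(a has_derivative a') (at x)"
  shows "((\<lambda>y. \<theta> y (a y)) has_derivative (\<lambda>w. \<theta> x (a' w + \<Gamma> x w (a x)) + \<omega> x w (a x))) (at x)"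
  unfolding \<theta>_def
  by (rule has_derivative_eq_rhs[OF M.G_has_derivative[OF assms U_has_derivative[OF assms(1)]]])
    (use assms(1) in \<open>simp add: fun_eq_iff \<omega>_def \<phi>_def M.G_commute\<close>)

lemma \<theta>_simps:
  "x \<in> S \<Longrightarrow> \<theta> x (u + v) = \<theta> x u + \<theta> x v" "x \<in> S \<Longrightarrow> \<theta> x (u - v) = \<theta> x u - \<theta> x v"
  "x \<in> S \<Longrightarrow> \<theta> x (- u) = - \<theta> x u" "x \<in> S \<Longrightarrow> \<theta> x (r *\<^sub>R u) = r * \<theta> x u" "x \<in> S \<Longrightarrow> \<theta> x 0 = 0"
  "x \<in> S \<Longrightarrow> \<theta> x (U x) = 1"
  by (simp_all add: \<theta>_def G_simps unit_U)

lemma \<omega>_U: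
  assumes "x \<in> S"
  shows "\<omega> x u (U x) = 0"
proof -
  have "((\<lambda>y. \<theta> y (U y)) has_derivative (\<lambda>w. \<theta> x (dd U x w + \<Gamma> x w (U x)) + \<omega> x w (U x))) (at x)"
    by (rule \<theta>_has_derivative[OF assms U_has_derivative[OF assms]])
  moreover have "((\<lambda>y. \<theta> y (U y)) has_derivative (\<lambda>w. 0)) (at x)"
    by (rule has_derivative_transform_within_open[OF has_derivative_const open_S assms])
      (simp add: \<theta>_def unit_U)
  ultimately have "\<theta> x (dd U x u + \<Gamma> x u (U x)) + \<omega> x u (U x) = 0"
    using has_derivative_unique by (metis (no_types, lifting))
  then show ?thesis by (simp add: \<omega>_def \<theta>_def \<phi>_def)
qed

lemma \<theta>_\<phi>: "x \<in> S \<Longrightarrow> \<theta> x (\<phi> x u) = 0"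
  using \<omega>_U by (simp add: \<theta>_def \<omega>_def)

lemma H_dF: "x \<in> S \<Longrightarrow> H (F x) (dd F x u) (dd F x v) = G x u v - \<theta> x u * \<theta> x v"
  using metric_split[of x u v] by (simp add: \<theta>_def)

lemma D2F_U: "x \<in> S \<Longrightarrow> D2F x u (U x) = - dd F x (dd U x u)"
proof -
  assume x: "x \<in> S"
  have "((\<lambda>y. dd F y (U y)) has_derivative (\<lambda>u. D2F x u (U x) + dd F x (dd U x u))) (at x)"
    by (rule dF_has_derivative[OF x U_has_derivative[OF x]])
  moreover have "((\<lambda>y. dd F y (U y)) has_derivative (\<lambda>w. 0)) (at x)"
    by (rule has_derivative_transform_within_open[OF has_derivative_const open_S x])
      (simp add: dF_U)
  ultimately have "D2F x u (U x) + dd F x (dd U x u) = 0"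
    using has_derivative_unique by (metis (no_types, lifting))
  then show ?thesis by (rule eq_neg_iff_add_eq_0[THEN iffD2])
qed

lemma compose_F_has_derivative:
  assumes "x \<in> S" "g differentiable (at (F x))"
  shows "((\<lambda>y. g (F y)) has_derivative (\<lambda>w. dd g (F x) (dd F x w))) (at x)"
  by (rule has_derivative_compose_dd[OF F_has_derivative[OF assms(1)] assms(2)])

text \<open>\<open>metric_split\<close> differentiated along \<open>w\<close> for constant
  \<open>u\<close> and \<open>v\<close>, with the derivatives of both metrics written through
  Christoffel symbols. The case \<open>w = U x\<close> gives \<open>killing\<close>; three permuted
  cases give \<open>hessian_F\<close>.\<close>

lemma metric_split_derivative:
  assumes x: "x \<in> S"
  shows "G x (\<Gamma> x w u) v + G x u (\<Gamma> x w v) =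
    H (F x) (D2F x w u + \<Gamma>' (F x) (dd F x w) (dd F x u)) (dd F x v)
    + H (F x) (dd F x u) (D2F x w v + \<Gamma>' (F x) (dd F x w) (dd F x v))
    + (\<theta> x (\<Gamma> x w u) + \<omega> x w u) * \<theta> x v + \<theta> x u * (\<theta> x (\<Gamma> x w v) + \<omega> x w v)"
proof -
  have Hb: "dd (\<lambda>y. H (F y) a b) x w = dd (\<lambda>z. H z a b) (F x) (dd F x w)" for a b w
    by (rule fun_cong[OF dd_eqI[OF compose_F_has_derivative[OF x N.G_differentiable[OF F_into[OF x]]]]])
  have dF': "((\<lambda>y. dd F y u) has_derivative (\<lambda>w. D2F x w u)) (at x)" for u
    using dF_has_derivative[OF x has_derivative_const] x by (simp add: dF_simps)
  have 1: "((\<lambda>y. H (F y) (dd F y u) (dd F y v)) has_derivative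
    (\<lambda>w. dd (\<lambda>y. H (F y) (dd F x u) (dd F x v)) x w + H (F x) (D2F x w u) (dd F x v)
      + H (F x) (dd F x u) (D2F x w v))) (at x)"
    by (rule bilinear_family_has_derivative[OF open_S x N.bilinear_G[OF F_into] _ dF' dF'])
      (use compose_F_has_derivative[OF x N.G_differentiable[OF F_into[OF x]]] differentiable_def in blast)+
  have 2: "((\<lambda>y. \<theta> y u) has_derivative (\<lambda>w. \<theta> x (\<Gamma> x w u) + \<omega> x w u)) (at x)" for u
    using \<theta>_has_derivative[OF x has_derivative_const] by simp
  have "((\<lambda>y. G y u v) has_derivative (\<lambda>w. dd (\<lambda>y. H (F y) (dd F x u) (dd F x v)) x w
      + H (F x) (D2F x w u) (dd F x v) + H (F x) (dd F x u) (D2F x w v)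
      + (\<theta> x u * (\<theta> x (\<Gamma> x w v) + \<omega> x w v) + (\<theta> x (\<Gamma> x w u) + \<omega> x w u) * \<theta> x v))) (at x)"
    by (rule has_derivative_transform_within_open
        [OF has_derivative_add[OF 1 has_derivative_mult[OF 2 2]] open_S x])
      (simp add: metric_split[of _ u v] \<theta>_def)
  from fun_cong[OF dd_eqI[OF this], of w] show ?thesis
    unfolding M.dG_eq[OF x] Hb N.dG_eq[OF F_into[OF x]]
    by (simp add: N.G_simps[OF F_into[OF x]])
qed

section \<open>The vertical distribution and O'Neill's tensor expressed through U\<close>

lemma kernel_dF:
  assumes "x \<in> S" "dd F x u = 0"
  shows "u = \<theta> x u *\<^sub>R U x"
proof (rule M.G_ext[OF assms(1)])
  show "G x u w = G x (\<theta> x u *\<^sub>R U x) w" for w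
    using metric_split[OF assms(1), of u w] assms
    by (simp add: G_simps N.G_simps F_into \<theta>_def M.G_commute[of x w])
qed

lemma V_iff:
  assumes "x \<in> S"
  shows "u \<in> V x \<longleftrightarrow> u = \<theta> x u *\<^sub>R U x"
proof
  assume "u = \<theta> x u *\<^sub>R U x"
  moreover have "dd F x (\<theta> x u *\<^sub>R U x) = 0" by (simp add: dF_simps assms dF_U)
  ultimately show "u \<in> V x" by (simp add: V_eq assms)
qed (use kernel_dF V_eq assms in blast)

lemma G_vertical:
  assumes "x \<in> S" "w \<in> V x"
  shows "G x u w = \<theta> x w * \<theta> x u"
proof -
  have "G x u w = G x u (\<theta> x w *\<^sub>R U x)"
    by (rule arg_cong[OF iffD1[OF V_iff[OF assms(1)] assms(2)]])
  then show ?thesis by (simp add: G_simps assms \<theta>_def)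
qed

lemma orth_compl_eq:
  assumes "x \<in> S"
  shows "orth_compl G V x = {u. \<theta> x u = 0}"
proof -
  have "U x \<in> V x" using V_iff[OF assms] by (simp add: \<theta>_simps assms)
  then show ?thesis
    unfolding orth_compl_def by (auto simp: G_vertical \<theta>_simps assms)
qed

lemma ver_eq:
  assumes "x \<in> S"
  shows "ver G V E x = \<theta> x (E x) *\<^sub>R U x"
  unfolding ver_def
proof (rule the_equality)
  have U: "U x \<in> V x" using V_iff[OF assms] by (simp add: \<theta>_simps assms)
  show "\<theta> x (E x) *\<^sub>R U x \<in> V x \<and> (\<forall>w\<in>V x. G x (E x - \<theta> x (E x) *\<^sub>R U x) w = 0)"
  proof (intro conjI ballI)
    show "\<theta> x (E x) *\<^sub>R U x \<in> V x" using V_iff[OF assms] by (simp add: \<theta>_simps assms)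
    fix w assume "w \<in> V x"
    then show "G x (E x - \<theta> x (E x) *\<^sub>R U x) w = 0"
      by (simp add: G_vertical \<theta>_simps assms)
  qed
  fix v assume v: "v \<in> V x \<and> (\<forall>w\<in>V x. G x (E x - v) w = 0)"
  then have "\<theta> x (E x - v) = 0" using U by (simp add: \<theta>_def)
  then have "\<theta> x v = \<theta> x (E x)" by (simp add: \<theta>_simps assms)
  then show "v = \<theta> x (E x) *\<^sub>R U x" using v V_iff[OF assms] by metis
qed

lemma hor_eq: "x \<in> S \<Longrightarrow> hor G V E x = E x - \<theta> x (E x) *\<^sub>R U x"
  by (simp add: hor_def ver_eq)

lemma nabla_ver:
  assumes x: "x \<in> S"
  shows "nabla G X (ver G V (\<lambda>_. u)) x =
    (\<theta> x (\<Gamma> x (X x) u) + \<omega> x (X x) u) *\<^sub>R U x + \<theta> x u *\<^sub>R \<phi> x (X x)"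
proof -
  have "(ver G V (\<lambda>_. u) has_derivative
     (\<lambda>w. \<theta> x u *\<^sub>R dd U x w + (\<theta> x (\<Gamma> x w u) + \<omega> x w u) *\<^sub>R U x)) (at x)"
    by (rule has_derivative_transform_within_open[OF has_derivative_scaleR
          [OF \<theta>_has_derivative[OF x has_derivative_const[of u], simplified add_0] U_has_derivative[OF x]] open_S x])
      (simp add: ver_eq)
  from dd_eqI[OF this] show ?thesis
    by (simp add: nabla_def ver_eq x \<phi>_def \<Gamma>_simps scaleR_add_right)
qed

text \<open>Since \<open>U\<close> has constant length, \<open>\<phi> x (U x)\<close> is already
  horizontal and the projection does not change it. Through this equation total geodesy becomes the
  assumption \<open>\<phi>_U\<close>.\<close>

lemma second_ff_U: "x \<in> S \<Longrightarrow> second_ff G V (\<lambda>_. U x) (\<lambda>_. U x) x = \<phi> x (U x)"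
  by (simp add: second_ff_def hor_eq nabla_ver ver_eq \<theta>_simps \<theta>_\<phi> scaleR_add_left)

text \<open>The constant extension of \<open>U x\<close> is in general vertical only at
  \<open>x\<close>. Its horizontal part vanishes there but may have a nonzero derivative; that
  derivative has no vertical component, so the second summand of \<open>oneill_A\<close> is
  zero.\<close>

lemma oneill_A_eq:
  assumes x: "x \<in> S" and u: "\<theta> x u = 0"
  shows "oneill_A G V (\<lambda>_. u) (\<lambda>_. U x) x = \<phi> x u"
proof -
  have hu: "hor G V (\<lambda>_. u) x = u" by (simp add: hor_eq x u)
  have h: "(ver G V (\<lambda>_. U x) has_derivative dd (ver G V (\<lambda>_. U x)) x) (at x)"
  proof (rule has_derivative_dd, rule differentiable_cong_open[OF open_S x])
    show "(\<lambda>y. \<theta> y (U x) *\<^sub>R U y) differentiable (at x)"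
      using has_derivative_scaleR[OF \<theta>_has_derivative[OF x has_derivative_const] U_has_derivative[OF x]]
      by (auto simp: differentiable_def)
  qed (simp add: ver_eq)
  have "dd (hor G V (\<lambda>_. U x)) x = (\<lambda>w. 0 - dd (ver G V (\<lambda>_. U x)) x w)"
    unfolding hor_def[abs_def]
    by (rule dd_eqI[OF has_derivative_diff[OF has_derivative_const h]])
  then have "nabla G (hor G V (\<lambda>_. u)) (hor G V (\<lambda>_. U x)) x =
      \<Gamma> x u (U x) - nabla G (hor G V (\<lambda>_. u)) (ver G V (\<lambda>_. U x)) x"
    by (simp add: nabla_def hor_eq ver_eq x \<theta>_simps \<Gamma>_simps u)
  also have "\<theta> x \<dots> = 0"
    unfolding nabla_ver[OF x] hu by (simp add: \<theta>_simps x \<theta>_\<phi> \<omega>_U)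
  finally show ?thesis
    by (simp add: oneill_A_def hor_eq ver_eq nabla_ver x hu \<theta>_simps \<theta>_\<phi> \<omega>_U)
qed

end

section \<open>Consequences of geodesic fibers\<close>

locale geodesic_submersion = framed_submersion +
  assumes \<phi>_U: "x \<in> S \<Longrightarrow> \<phi> x (U x) = 0"
begin

text \<open>At \<open>w = U x\<close> the Christoffel symbols of the base drop out because
  \<open>dd F x (U x) = 0\<close>, and the symmetry of \<open>D2F\<close> together with
  \<open>D2F_U\<close> trades second derivatives of \<open>F\<close> for \<open>dd U\<close>. What
  remains says that the symmetric part of \<omega> vanishes.\<close>

lemma killing:
  assumes x: "x \<in> S"
  shows "\<omega> x u v = - \<omega> x v u"
proof -
  have a: "H (F x) (dd F x (dd U x u)) (dd F x v) = G x (dd U x u) v + \<theta> x (\<Gamma> x u (U x)) * \<theta> x v" for u v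
  proof -
    have "\<theta> x (dd U x u) = - \<theta> x (\<Gamma> x u (U x))"
      using \<theta>_\<phi>[OF x, of u] by (simp add: \<phi>_def \<theta>_simps x)
    then show ?thesis by (simp add: H_dF x)
  qed
  have b: "H (F x) (dd F x v) (dd F x (dd U x u)) = G x (dd U x u) v + \<theta> x (\<Gamma> x u (U x)) * \<theta> x v" for u v
    using a N.G_commute[OF F_into[OF x]] by metis
  have "\<omega> x (U x) u = 0" for u by (simp add: \<omega>_def \<phi>_U x G_simps)
  moreover have "D2F x (U x) u = - dd F x (dd U x u)" for u
    by (rule trans[OF D2F_commute[OF x] D2F_U[OF x]])
  ultimately have "G x (\<Gamma> x (U x) u) v + G x u (\<Gamma> x (U x) v) = - G x (dd U x u) v - G x (dd U x v) u"
    using metric_split_derivative[OF x, of "U x" u v]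
    by (simp add: dF_U x N.\<Gamma>_simps F_into N.G_simps a b
        M.christoffel_commute[OF x, of "U x"])
  then show ?thesis
    by (simp add: \<omega>_def \<phi>_def G_simps x M.christoffel_commute[OF x, of "U x"] M.G_commute[OF x, of u])
qed

lemma \<omega>_self: "x \<in> S \<Longrightarrow> \<omega> x u u = 0"
  using killing[of x u u] by simp

lemma H_\<phi>: "x \<in> S \<Longrightarrow> H (F x) (dd F x (\<phi> x u)) (dd F x v) = \<omega> x u v"
  by (simp add: H_dF \<theta>_\<phi> \<omega>_def)

text \<open>The components of the Hessian follow from \<open>metric_split_derivative\<close> by the permutation of
  indices of the Koszul formula.\<close>

lemma hessian_F:
  assumes x: "x \<in> S"
  shows "D2F x w u = dd F x (\<Gamma> x w u) - \<Gamma>' (F x) (dd F x w) (dd F x u)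
    - \<theta> x u *\<^sub>R dd F x (\<phi> x w) - \<theta> x w *\<^sub>R dd F x (\<phi> x u)"
proof -
  define h where "h w u = D2F x w u + \<Gamma>' (F x) (dd F x w) (dd F x u) - dd F x (\<Gamma> x w u)" for w u
  define C where "C w u v = H (F x) (h w u) (dd F x v)" for w u v
  note F = F_into[OF x]
  have sym: "C w u v = C u w v" for w u v
    unfolding C_def h_def
    by (simp add: D2F_commute[OF x, of w u] N.christoffel_commute[OF F, of "dd F x w"]
        M.christoffel_commute[OF x, of w])
  have S: "C w u v + C w v u = - \<omega> x w u * \<theta> x v - \<theta> x u * \<omega> x w v" for w u v
    using metric_split_derivative[OF x, of w u v]
    by (simp add: C_def h_def N.G_simps[OF F] H_dF[OF x] N.G_commute[OF F, of "dd F x u"]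
        M.G_commute[OF x, of u] algebra_simps)
  \<comment> \<open>The first two instances of \<open>S\<close> minus the third. Skewness of
    \<omega> cancels the terms with \<open>\<theta> x v\<close> and doubles the others.\<close>
  have C: "C w u v = - \<theta> x u * \<omega> x w v - \<theta> x w * \<omega> x u v" for w u v
    using S[of w u v] S[of u w v] S[of v u w] sym[of w u v] sym[of w v u] sym[of u v w]
      killing[OF x, of u w] killing[OF x, of v w] killing[OF x, of v u]
    by (simp add: algebra_simps)
  have "h w u = - (\<theta> x u *\<^sub>R dd F x (\<phi> x w)) - \<theta> x w *\<^sub>R dd F x (\<phi> x u)"
  proof (rule N.G_ext[OF F])
    fix z
    obtain v where z: "z = dd F x v" using surj_dF[OF x] by blast
    show "H (F x) (h w u) z =
      H (F x) (- (\<theta> x u *\<^sub>R dd F x (\<phi> x w)) - \<theta> x w *\<^sub>R dd F x (\<phi> x u)) z"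
      using C[of w u v] by (simp add: C_def z N.G_simps[OF F] H_\<phi> x)
  qed
  then show ?thesis unfolding h_def by (simp add: algebra_simps)
qed

text \<open>Third derivatives of \<open>F\<close> commute, so \<open>hessian_F\<close> is
  differentiated along \<open>a\<close> and skew-symmetrised in \<open>a\<close> and
  \<open>b\<close>. At horizontal vectors the \<theta> terms vanish but their derivatives leave
  \<omega>; the term with \<open>\<phi> x c\<close> occurs in both orders with opposite signs of
  \<omega>, whence the factor 2.\<close>

lemma curvature_F:
  assumes x: "x \<in> S" and hor: "\<theta> x a = 0" "\<theta> x b = 0" "\<theta> x c = 0"
  shows "dd F x (M.Riem x a b c) = N.Riem (F x) (dd F x a) (dd F x b) (dd F x c)
    + (2 * \<omega> x a b) *\<^sub>R dd F x (\<phi> x c) + \<omega> x a c *\<^sub>R dd F x (\<phi> x b) - \<omega> x b c *\<^sub>R dd F x (\<phi> x a)"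
proof -
  note F = F_into[OF x]
  let ?R = "\<lambda>a b c. D2F x a (\<Gamma> x b c) + dd F x (dd (\<lambda>y. \<Gamma> y b c) x a)
      - (dd (\<lambda>z. \<Gamma>' z (dd F x b) (dd F x c)) (F x) (dd F x a)
          + \<Gamma>' (F x) (D2F x a b) (dd F x c) + \<Gamma>' (F x) (dd F x b) (D2F x a c))
      - (\<theta> x (\<Gamma> x a c) + \<omega> x a c) *\<^sub>R dd F x (\<phi> x b)
      - (\<theta> x (\<Gamma> x a b) + \<omega> x a b) *\<^sub>R dd F x (\<phi> x c)"
  \<comment> \<open>\<open>b\<close> and \<open>c\<close> are horizontal at \<open>x\<close> only,
    so \<theta> terms may be dropped after differentiating, where the remaining factors are taken at
    \<open>x\<close>, but not before.\<close>
  have D: "?R a b c = dd (\<lambda>y. D2F y b c) x a"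
    if \<theta>: "\<theta> x b = 0" "\<theta> x c = 0" for a b c
  proof -
    have dF': "((\<lambda>y. dd F y u) has_derivative (\<lambda>w. D2F x w u)) (at x)" for u
      using dF_has_derivative[OF x has_derivative_const] x by (simp add: dF_simps)
    have 1: "((\<lambda>y. dd F y (\<Gamma> y b c)) has_derivative
        (\<lambda>a. D2F x a (\<Gamma> x b c) + dd F x (dd (\<lambda>y. \<Gamma> y b c) x a))) (at x)"
      by (rule dF_has_derivative[OF x has_derivative_dd[OF M.christoffel_differentiable[OF x]]])
    have g: "((\<lambda>y. \<Gamma>' (F y) p q) has_derivative (\<lambda>w. dd (\<lambda>z. \<Gamma>' z p q) (F x) (dd F x w))) (at x)" for p q
      by (rule compose_F_has_derivative[OF x N.christoffel_differentiable[OF F]])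
    have 2: "((\<lambda>y. \<Gamma>' (F y) (dd F y b) (dd F y c)) has_derivative
      (\<lambda>a. dd (\<lambda>y. \<Gamma>' (F y) (dd F x b) (dd F x c)) x a + \<Gamma>' (F x) (D2F x a b) (dd F x c)
        + \<Gamma>' (F x) (dd F x b) (D2F x a c))) (at x)"
      by (rule bilinear_family_has_derivative[OF open_S x N.bilinear_christoffel[OF F_into] _ dF' dF'])
        (use g differentiable_def in blast)+
    have 3: "((\<lambda>y. \<theta> y u) has_derivative (\<lambda>w. \<theta> x (\<Gamma> x w u) + \<omega> x w u)) (at x)" for u
      using \<theta>_has_derivative[OF x has_derivative_const] by simp
    have 4: "((\<lambda>y. dd F y (\<phi> y u)) has_derivative
        (\<lambda>a. D2F x a (\<phi> x u) + dd F x (dd (\<lambda>y. \<phi> y u) x a))) (at x)" for u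
      by (rule dF_has_derivative[OF x smooth_on_has_derivative[OF smooth_\<phi> x]])
    note h = has_derivative_diff[OF has_derivative_diff[OF has_derivative_diff[OF 1 2]
          has_derivative_scaleR[OF 3[of c] 4[of b]]] has_derivative_scaleR[OF 3[of b] 4[of c]]]
    have "((\<lambda>y. D2F y b c) has_derivative (\<lambda>a. ?R a b c)) (at x)"
      by (rule has_derivative_transform_within_open
          [OF has_derivative_eq_rhs[OF h] open_S x])
        (simp_all only: hessian_F[symmetric] \<theta> dd_eqI[OF g] scaleR_zero_left add_0 simp_thms)
    then show ?thesis by (rule fun_cong[OF dd_eqI, symmetric])
  qed
  have "dd (\<lambda>y. D2F y b c) x a = dd (\<lambda>y. D2F y a c) x b"
    using dd_dd_commute[OF open_S x smooth_on_dd[OF smooth_F]] .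
  then have "?R a b c = ?R b a c"
    unfolding D[OF hor(2,3)] D[OF hor(1,3)] .
  moreover have "\<omega> x b a = - \<omega> x a b" "\<Gamma> x b a = \<Gamma> x a b" "D2F x b a = D2F x a b"
    by (rule killing[OF x], rule M.christoffel_commute[OF x], rule D2F_commute[OF x])
  moreover have "\<Gamma>' (F x) (D2F x a c) (dd F x b) = \<Gamma>' (F x) (dd F x b) (D2F x a c)"
    "\<Gamma>' (F x) (D2F x b c) (dd F x a) = \<Gamma>' (F x) (dd F x a) (D2F x b c)"
    by (rule N.christoffel_commute[OF F])+
  moreover have "D2F x a (\<Gamma> x b c) = dd F x (\<Gamma> x a (\<Gamma> x b c))
      - \<Gamma>' (F x) (dd F x a) (dd F x (\<Gamma> x b c)) - \<theta> x (\<Gamma> x b c) *\<^sub>R dd F x (\<phi> x a)"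
    if "\<theta> x a = 0" for a b c
    using hessian_F[OF x, where w = a and u = "\<Gamma> x b c"] that by simp
  moreover have "D2F x a c = dd F x (\<Gamma> x a c) - \<Gamma>' (F x) (dd F x a) (dd F x c)"
    if "\<theta> x a = 0" "\<theta> x c = 0" for a c
    using hessian_F[OF x, where w = a and u = c] that by simp
  ultimately show ?thesis
    unfolding M.Riem_def N.Riem_def
    by (simp add: hor dF_simps x N.\<Gamma>_simps[OF F] algebra_simps scaleR_2[symmetric])
qed

text \<open>Put \<open>a = f\<close> and \<open>b = c = e\<close> in \<open>curvature_F\<close>. The
  first correction contributes twice, and the second once, the product
  \<open>\<omega> x f e * \<omega> x e f\<close>, which is a negative square; the third contains
  \<open>\<omega> x e e = 0\<close>. Hence the 3.\<close>

lemma curvature_base: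
  assumes x: "x \<in> S" and hor: "\<theta> x e = 0" "\<theta> x f = 0"
  shows "H (F x) (N.Riem (F x) (dd F x f) (dd F x e) (dd F x e)) (dd F x f) =
    G x (M.Riem x f e e) f + 3 * (\<omega> x e f)\<^sup>2"
proof -
  have "H (F x) (dd F x (M.Riem x f e e)) (dd F x f) = G x (M.Riem x f e e) f"
    by (simp add: H_dF x hor)
  then show ?thesis
    unfolding curvature_F[OF x hor(2,1,1)]
    by (simp add: N.G_simps F_into x H_\<phi> \<omega>_self killing[OF x, of f e] power2_eq_square)
qed

text \<open>R(u, U)U is the covariant derivative of \<phi> along \<open>u\<close> applied to
  \<open>U\<close>, minus that along \<open>U\<close> applied to \<open>u\<close>. The first is
  \<open>- \<phi> x (\<phi> x u)\<close> because \<open>\<phi> y (U y) = 0\<close> near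
  \<open>x\<close>; the second is orthogonal to \<open>u\<close> because
  \<open>\<omega> y u u = 0\<close> near \<open>x\<close>.\<close>

lemma curvature_vertical:
  assumes x: "x \<in> S"
  shows "G x (M.Riem x u (U x) (U x)) u = G x (\<phi> x u) (\<phi> x u)"
proof -
  have h\<phi>: "((\<lambda>y. \<phi> y c) has_derivative dd (\<lambda>y. \<phi> y c) x) (at x)" for c
    by (rule smooth_on_has_derivative[OF smooth_\<phi> x])
  have D\<phi>: "dd (\<lambda>y. \<phi> y c) x a = dd (\<lambda>y. dd U y c) x a + (dd (\<lambda>y. \<Gamma> y c (U x)) x a + \<Gamma> x c (dd U x a))" for a c
    unfolding \<phi>_def
    by (rule fun_cong[OF dd_eqI[OF has_derivative_add]])
      (intro smooth_on_has_derivative[OF smooth_on_dd[OF smooth_U] x]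
        linear_family_has_derivative[OF open_S x bilinear_linear(2)[OF M.bilinear_christoffel]
          M.christoffel_differentiable[OF x] U_has_derivative[OF x]])+
  have R: "M.Riem x a b (U x) = dd (\<lambda>y. \<phi> y b) x a - dd (\<lambda>y. \<phi> y a) x b + \<Gamma> x a (\<phi> x b) - \<Gamma> x b (\<phi> x a)" for a b
    unfolding D\<phi> M.Riem_def dd_dd_commute[OF open_S x smooth_U, of b a]
    by (simp add: \<phi>_def \<Gamma>_simps x)
  have "((\<lambda>y. \<phi> y (U y)) has_derivative (\<lambda>w. dd (\<lambda>y. \<phi> y (U x)) x w + \<phi> x (dd U x w))) (at x)"
    by (rule linear_family_has_derivative[OF open_S x linear_\<phi> _ U_has_derivative[OF x]])
      (auto intro: smooth_on_imp_differentiable[OF smooth_\<phi> x])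
  moreover have "((\<lambda>y. \<phi> y (U y)) has_derivative (\<lambda>w. 0)) (at x)"
    by (rule has_derivative_transform_within_open[OF has_derivative_const open_S x]) (simp add: \<phi>_U)
  ultimately have "dd (\<lambda>y. \<phi> y (U x)) x u + \<phi> x (dd U x u) = 0"
    using has_derivative_unique by (metis (no_types, lifting))
  moreover have "dd U x u = \<phi> x u - \<Gamma> x u (U x)" by (simp add: \<phi>_def)
  ultimately have 1: "dd (\<lambda>y. \<phi> y (U x)) x u = \<phi> x (\<Gamma> x u (U x)) - \<phi> x (\<phi> x u)"
    by (simp add: \<phi>_simps x algebra_simps)
  have "((\<lambda>y. G y (\<phi> y u) u) has_derivative (\<lambda>w. G x (dd (\<lambda>y. \<phi> y u) x w + \<Gamma> x w (\<phi> x u)) u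
      + G x (\<phi> x u) (0 + \<Gamma> x w u))) (at x)"
    by (rule M.G_has_derivative[OF x h\<phi> has_derivative_const])
  moreover have "((\<lambda>y. G y (\<phi> y u) u) has_derivative (\<lambda>w. 0)) (at x)"
    by (rule has_derivative_transform_within_open[OF has_derivative_const open_S x])
      (use \<omega>_self in \<open>simp add: \<omega>_def\<close>)
  ultimately have 2: "G x (dd (\<lambda>y. \<phi> y u) x (U x) + \<Gamma> x (U x) (\<phi> x u)) u
      + G x (\<phi> x u) (0 + \<Gamma> x (U x) u) = 0"
    using has_derivative_unique by (metis (no_types, lifting))
  have 3: "G x (\<phi> x (\<Gamma> x u (U x))) u = - G x (\<phi> x u) (\<Gamma> x (U x) u)"
    "G x (\<phi> x (\<phi> x u)) u = - G x (\<phi> x u) (\<phi> x u)"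
    using killing[OF x, of "\<Gamma> x u (U x)" u] killing[OF x, of "\<phi> x u" u]
    by (simp_all add: \<omega>_def M.christoffel_commute[OF x, of u])
  show ?thesis
    unfolding R using 1 2 3 by (simp add: \<phi>_U \<Gamma>_simps G_simps x)
qed

text \<open>The two skew symmetries of the curvature lead back to \<open>curvature_vertical\<close>.
  For horizontal \<open>e\<close> this is the part of the Ricci curvature of M that has no
  counterpart on the base.\<close>

lemma curvature_mixed:
  assumes x: "x \<in> S"
  shows "G x (M.Riem x (U x) e e) (U x) = G x (\<phi> x e) (\<phi> x e)"
proof -
  have "G x (M.Riem x (U x) e e) (U x) = - G x (M.Riem x (U x) e (U x)) e"
    using M.Riem_skew[OF x, of "U x" e e "U x"] M.G_commute[OF x, of e "M.Riem x (U x) e (U x)"]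
    by linarith
  also have "\<dots> = G x (M.Riem x e (U x) (U x)) e"
    by (subst M.Riem_antisym) (simp only: G_simps(5)[OF x] minus_minus)
  finally show ?thesis by (simp only: curvature_vertical[OF x])
qed

section \<open>Traces in an orthonormal basis adapted to the fibers\<close>

lemma adapted_basis:
  assumes x: "x \<in> S" and E: "orthonormal_basis (G x) (orth_compl G V x) E"
  shows "finite E" "\<And>e. e \<in> E \<Longrightarrow> \<theta> x e = 0" "U x \<notin> E"
    "orthonormal_basis (G x) UNIV (insert (U x) E)"
proof -
  show fin: "finite E" using E by (simp add: orthonormal_basis_def)
  have sp: "span E = {u. \<theta> x u = 0}"
    using E orth_compl_eq[OF x] by (simp add: orthonormal_basis_def)
  then show \<theta>: "\<theta> x e = 0" if "e \<in> E" for e using that span_base by blast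
  then show "U x \<notin> E" using \<theta>_simps(6)[OF x] by fastforce
  have "u \<in> span (insert (U x) E)" for u
  proof -
    have "u - \<theta> x u *\<^sub>R U x \<in> span E" by (simp add: sp \<theta>_simps x)
    then show ?thesis unfolding span_insert by blast
  qed
  then have "span (insert (U x) E) = UNIV" by blast
  moreover have "G x e (U x) = 0" "G x (U x) e = 0" if "e \<in> E" for e
    using \<theta>[OF that] M.G_commute[OF x, of "U x" e] by (simp_all add: \<theta>_def)
  ultimately show "orthonormal_basis (G x) UNIV (insert (U x) E)"
    using E unit_U[OF x] \<open>U x \<notin> E\<close> by (auto simp: orthonormal_basis_def)
qed

text \<open>\<open>oneill_A_norm\<close> picks its own unit vertical vector at each point; the
  assumption on \<open>U x\<close> makes the frame agree with that choice at
  \<open>x\<close>.\<close>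

lemma oneill_A_norm_eq:
  assumes x: "x \<in> S" and U: "U x = (SOME u. u \<in> V x \<and> G x u u = 1)"
    and E: "orthonormal_basis (G x) (orth_compl G V x) E"
  shows "oneill_A_norm G V x = sqrt (\<Sum>e\<in>E. G x (\<phi> x e) (\<phi> x e))"
proof -
  have bil: "bilinear (\<lambda>u v. G x (\<phi> x u) (\<phi> x v))"
    unfolding bilinear_def by (auto intro!: linearI simp: \<phi>_simps G_simps x)
  have "metric_trace (G x) (orth_compl G V x) (\<lambda>y y'. G x (oneill_A G V (\<lambda>_. y) (\<lambda>_. U x) x)
      (oneill_A G V (\<lambda>_. y') (\<lambda>_. U x) x))
    = (\<Sum>e\<in>E. G x (oneill_A G V (\<lambda>_. e) (\<lambda>_. U x) x) (oneill_A G V (\<lambda>_. e) (\<lambda>_. U x) x))"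
    by (rule metric_trace_eq[OF M.inner_prod_G[OF x] bil _ E])
      (simp add: orth_compl_eq x oneill_A_eq)
  also have "\<dots> = (\<Sum>e\<in>E. G x (\<phi> x e) (\<phi> x e))"
    by (intro sum.cong refl) (simp add: oneill_A_eq x adapted_basis(2)[OF x E])
  finally show ?thesis by (simp add: oneill_A_norm_def U[symmetric])
qed

lemma ricci_vertical:
  assumes x: "x \<in> S" and E: "orthonormal_basis (G x) (orth_compl G V x) E"
  shows "ricci G x (U x) (U x) = (\<Sum>e\<in>E. G x (\<phi> x e) (\<phi> x e))"
  unfolding M.ricci_eq[OF x adapted_basis(4)[OF x E]]
  using adapted_basis[OF x E] by (simp add: curvature_vertical x \<phi>_U G_simps)

text \<open>For horizontal \<open>e\<close>, O'Neill's formula adds the squared length of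
  \<open>\<phi> x e\<close> three times, and the plane of \<open>e\<close> and \<open>U x\<close>,
  which is missing on the base, removes it once. The net coefficient is 2.\<close>

lemma scal_base:
  assumes x: "x \<in> S" and E: "orthonormal_basis (G x) (orth_compl G V x) E"
  shows "scal H (F x) = (\<Sum>e\<in>E. ricci G x e e) + 2 * (\<Sum>e\<in>E. G x (\<phi> x e) (\<phi> x e))"
proof -
  note B = adapted_basis[OF x E] and F = F_into[OF x]
  have o: "\<And>e f. e \<in> E \<Longrightarrow> f \<in> E \<Longrightarrow> G x e f = (if e = f then 1 else 0)"
    using E by (auto simp: orthonormal_basis_def)
  have Hef: "H (F x) (dd F x e) (dd F x f) = (if e = f then 1 else 0)" if "e \<in> E" "f \<in> E" for e f
    using that B(2) o by (simp add: H_dF x)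
  have inj: "inj_on (dd F x) E"
    using Hef by (intro inj_onI) (metis zero_neq_one)
  have "UNIV = dd F x ` span (insert (U x) E)"
    using surj_dF[OF x] B(4) by (simp add: orthonormal_basis_def)
  also have "\<dots> = span (dd F x ` insert (U x) E)"
    by (simp only: linear_span_image[OF linear_dF[OF x]])
  also have "\<dots> = span (dd F x ` E)" by (simp add: dF_U x span_insert_0)
  finally have E': "orthonormal_basis (H (F x)) UNIV (dd F x ` E)"
    using B(1) Hef inj by (auto simp: orthonormal_basis_def inj_on_eq_iff)
  have e: "ricci H (F x) (dd F x e) (dd F x e) = ricci G x e e + 2 * G x (\<phi> x e) (\<phi> x e)"
    if e: "e \<in> E" for e
  proof -
    \<comment> \<open>\<open>\<phi> x e\<close> has no component along \<open>U x\<close>, so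
      Parseval over the full basis reduces to a sum over \<open>E\<close>.\<close>
    have "G x (\<phi> x e) (\<phi> x e) = (\<Sum>f\<in>insert (U x) E. G x (\<phi> x e) f * G x (\<phi> x e) f)"
      by (rule orthonormal_parseval[OF M.inner_prod_G[OF x] B(4)]) simp
    also have "\<dots> = (\<Sum>f\<in>E. (\<omega> x e f)\<^sup>2)"
      using B(1,3) \<omega>_U[OF x, of e] by (simp add: \<omega>_def power2_eq_square)
    finally have p: "(\<Sum>f\<in>E. (\<omega> x e f)\<^sup>2) = G x (\<phi> x e) (\<phi> x e)" by simp
    have "ricci H (F x) (dd F x e) (dd F x e) =
        (\<Sum>f\<in>E. H (F x) (N.Riem (F x) (dd F x f) (dd F x e) (dd F x e)) (dd F x f))"
      unfolding N.ricci_eq[OF F E'] by (simp add: sum.reindex[OF inj])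
    also have "\<dots> = (\<Sum>f\<in>E. G x (M.Riem x f e e) f) + 3 * (\<Sum>f\<in>E. (\<omega> x e f)\<^sup>2)"
      by (simp add: curvature_base x B(2) e sum.distrib sum_distrib_left)
    also have "(\<Sum>f\<in>E. G x (M.Riem x f e e) f) = ricci G x e e - G x (\<phi> x e) (\<phi> x e)"
      unfolding M.ricci_eq[OF x B(4)] using B(1,3) by (simp add: curvature_mixed x)
    finally show ?thesis by (simp add: p)
  qed
  show ?thesis
    unfolding N.scal_eq[OF F E'] by (simp add: sum.reindex[OF inj] e sum.distrib sum_distrib_left)
qed

text \<open>Write Y = f U. On \<open>(u, u)\<close> the Lie derivative along Y is f times the one
  along the Killing field U, plus twice the derivative of f along \<open>u\<close> times
  \<open>\<theta> x u\<close>. Both parts vanish.\<close>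

lemma lie_derivative_vertical:
  assumes x: "x \<in> S" and Y: "Y differentiable (at x)" "\<And>y. y \<in> S \<Longrightarrow> Y y \<in> V y"
    and u: "\<theta> x u = 0"
  shows "lie_derivative_metric G Y x u u = 0" "G x (Y x) u = 0"
proof -
  define f where "f y = \<theta> y (Y y)" for y
  have Yf: "Y y = f y *\<^sub>R U y" if "y \<in> S" for y
    using Y(2)[OF that] V_iff[OF that] by (simp add: f_def)
  obtain f' where f': "(f has_derivative f') (at x)"
    unfolding f_def[abs_def] using \<theta>_has_derivative[OF x has_derivative_dd[OF Y(1)]] by blast
  have "(Y has_derivative (\<lambda>w. f x *\<^sub>R dd U x w + f' w *\<^sub>R U x)) (at x)"
    by (rule has_derivative_transform_within_open
        [OF has_derivative_scaleR[OF f' U_has_derivative[OF x]] open_S x]) (simp add: Yf)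
  then have dY: "dd Y x u = f x *\<^sub>R dd U x u + f' u *\<^sub>R U x" by (simp add: dd_eqI)
  have uU: "G x (U x) u = 0" "G x u (U x) = 0" using u M.G_commute[OF x] by (auto simp: \<theta>_def)
  show "G x (Y x) u = 0" by (simp add: Yf x G_simps uU)
  have "G x (dd U x u) u + G x (\<Gamma> x (U x) u) u = 0"
    using \<omega>_self[OF x, of u] M.christoffel_commute[OF x, of "U x"]
    by (simp add: \<omega>_def \<phi>_def G_simps x)
  then have "f x * G x (dd U x u) u + f x * G x (\<Gamma> x (U x) u) u = 0"
    by (simp flip: distrib_left)
  then show "lie_derivative_metric G Y x u u = 0"
    by (simp add: lie_derivative_metric_def lie_bracket_def dY Yf x M.dG_eq G_simps \<Gamma>_simps uU
        M.G_commute[OF x, of u])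
qed

end

section \<open>Tangent vectors of level sets\<close>

text \<open>Completeness of the target is what the fixed point theorem in
  \<open>level_set_near_kernel\<close> asks for.\<close>

lemma complete_findim: "complete (UNIV :: 'w::findim_inner set)"
proof (rule completeI)
  fix f :: "nat \<Rightarrow> 'w" assume f: "Cauchy f"
  have "\<exists>l. (\<lambda>n. f n \<bullet> e) \<longlonglongrightarrow> l" for e
    using bounded_linear.Cauchy[OF bounded_linear_inner_left f]
    by (simp add: Cauchy_convergent_iff convergent_def)
  then obtain l where l: "\<And>e. (\<lambda>n. f n \<bullet> e) \<longlonglongrightarrow> l e" by metis
  have "(\<lambda>n. \<Sum>e\<in>obasis. (f n \<bullet> e) *\<^sub>R e) \<longlonglongrightarrow> (\<Sum>e\<in>obasis. l e *\<^sub>R e)"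
    by (intro tendsto_sum tendsto_scaleR l tendsto_const)
  then have "f \<longlonglongrightarrow> (\<Sum>e\<in>obasis. l e *\<^sub>R e)"
    unfolding obasis_expansion[symmetric] .
  then show "\<exists>l\<in>UNIV. f \<longlonglongrightarrow> l" by blast
qed

text \<open>Continuity is known only for derivatives in fixed directions. The sum \<open>s\<close>
  over an orthonormal basis dominates the operator norm of \<open>dd F y - dd F x\<close>, so the
  mean value inequality applies to \<open>F\<close> minus its linearisation at
  \<open>x\<close>.\<close>

lemma smooth_strict_differentiable:
  fixes F :: "'v::findim_inner \<Rightarrow> 'w::real_normed_vector"
  assumes S: "open S" "x \<in> S" and F: "smooth_on S F" and "\<epsilon> > 0"
  shows "\<exists>\<delta>>0. ball x \<delta> \<subseteq> S \<and> (\<forall>y\<in>ball x \<delta>. \<forall>z\<in>ball x \<delta>.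
    norm (F z - F y - dd F x (z - y)) \<le> \<epsilon> * norm (z - y))"
proof -
  define s where "s y = (\<Sum>e\<in>obasis. norm (dd F y e - dd F x e))" for y
  have "isCont s x"
    unfolding s_def using S
    by (intro continuous_intros smooth_on_imp_continuous_on[OF smooth_on_dd[OF F], THEN continuous_on_interior])
      (simp add: interior_open)
  then obtain r where r: "r > 0" "\<And>y. dist y x < r \<Longrightarrow> dist (s y) (s x) < \<epsilon>"
    using \<open>\<epsilon> > 0\<close> unfolding continuous_at_eps_delta by metis
  obtain r' where r': "r' > 0" "ball x r' \<subseteq> S" using S open_contains_ball by blast
  define \<delta> where "\<delta> = min r r'"
  have \<delta>: "\<delta> > 0" "ball x \<delta> \<subseteq> S" using r r' by (auto simp: \<delta>_def)
  have on: "onorm (\<lambda>v. dd F y v - dd F x v) \<le> \<epsilon>" if y: "y \<in> ball x \<delta>" for y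
  proof (rule onorm_bound)
    fix v
    have lin: "linear (\<lambda>v. dd F y v - dd F x v)"
      using y \<delta>(2) S(2) F
      by (intro linear_compose_sub linear_dd) (auto intro: smooth_on_imp_differentiable)
    have "norm (dd F y v - dd F x v) = norm (\<Sum>e\<in>obasis. (v \<bullet> e) *\<^sub>R (dd F y e - dd F x e))"
      by (rule arg_cong[OF linear_obasis[OF lin]])
    also have "\<dots> \<le> (\<Sum>e\<in>obasis. norm v * norm (dd F y e - dd F x e))"
    proof (rule sum_norm_le)
      fix e :: 'v assume "e \<in> obasis"
      then have "norm e = 1" using obasis unfolding orthonormal_basis_def norm_eq_1 by metis
      then have "\<bar>v \<bullet> e\<bar> \<le> norm v" using Cauchy_Schwarz_ineq2[of v e] by simp
      then show "norm ((v \<bullet> e) *\<^sub>R (dd F y e - dd F x e)) \<le> norm v * norm (dd F y e - dd F x e)"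
        by (simp add: mult_right_mono)
    qed
    also have "\<dots> = s y * norm v" by (simp add: s_def sum_distrib_left mult.commute)
    also have "s y \<le> \<epsilon>"
      using r(2)[of y] y by (simp add: \<delta>_def dist_commute s_def dist_real_def)
    finally show "norm (dd F y v - dd F x v) \<le> \<epsilon> * norm v"
      by (simp add: mult_right_mono)
  qed (use \<open>\<epsilon> > 0\<close> in simp)
  have "norm (F z - F y - dd F x (z - y)) \<le> norm (z - y) * \<epsilon>" if yz: "y \<in> ball x \<delta>" "z \<in> ball x \<delta>" for y z
  proof (rule differentiable_bound_linearization[where S = "ball x \<delta>" and f' = "dd F"])
    show "y + t *\<^sub>R (z - y) \<in> ball x \<delta>" if "t \<in> {0..1}" for t
    proof -
      have "y + t *\<^sub>R (z - y) = (1 - t) *\<^sub>R y + t *\<^sub>R z" by (simp add: algebra_simps)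
      then show ?thesis using convexD[OF convex_ball yz, of "1 - t" t] that by simp
    qed
    show "(F has_derivative dd F w) (at w within ball x \<delta>)" if "w \<in> ball x \<delta>" for w
      using smooth_on_has_derivative[OF F] that \<delta>(2) has_derivative_at_withinI by blast
    show "onorm (dd F w - dd F x) \<le> \<epsilon>" if "w \<in> ball x \<delta>" for w
      using on[OF that] by (simp add: fun_diff_def)
  qed (use \<delta> in simp)
  then show ?thesis
    using \<delta> by (intro exI[of _ \<delta>]) (auto simp: mult.commute)
qed

text \<open>The point of the level set is found by solving \<open>F (x + t u + R w) = F x\<close> for \<open>w\<close>, where
  \<open>R\<close> is a right inverse of the derivative, as a fixed point of a contraction.\<close>

lemma level_set_near_kernel:
  fixes F :: "'v::findim_inner \<Rightarrow> 'w::findim_inner"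
  assumes S: "open S" "x \<in> S" and F: "smooth_on S F" and surj: "surj (dd F x)"
    and u: "dd F x u = 0" and "\<epsilon> > 0"
  shows "\<exists>t0>0. \<forall>t. 0 < t \<and> t < t0 \<longrightarrow>
    (\<exists>y\<in>S. F y = F x \<and> norm (y - x - t *\<^sub>R u) \<le> \<epsilon> * t)"
proof -
  have linF: "linear (dd F x)" by (rule linear_dd[OF smooth_on_imp_differentiable[OF F S(2)]])
  obtain R where R: "linear R" "dd F x \<circ> R = id"
    using linear_surjective_right_inverse[OF linF surj] by blast
  have dR: "dd F x (R w) = w" for w using R(2) by (metis comp_apply id_apply)
  obtain K where K: "K > 0" "\<And>w. norm (R w) \<le> norm w * K"
    using bounded_linear.pos_bounded[OF findim_bounded_linear[OF R(1)]] by blast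
  \<comment> \<open>On the ball of radius \<open>\<eta> * t\<close> the correction
    \<open>R w\<close> has norm at most \<open>\<eta> * t * K = \<epsilon> * t\<close>, the
    tolerated error.\<close>
  define \<eta> where "\<eta> = \<epsilon> / K"
  \<comment> \<open>The first bound makes \<open>T\<close> below a contraction with factor 1/2, the
    second keeps \<open>T 0\<close> within \<open>\<eta> * t / 2\<close> of the origin. Together
    they map the ball of radius \<open>\<eta> * t\<close> into itself.\<close>
  define e where "e = min (1 / (2 * K)) (\<eta> / (2 * (norm u + 1)))"
  have nu: "norm u + 1 > 0" by (smt (verit) norm_ge_zero)
  have \<eta>: "\<eta> > 0" using K \<open>\<epsilon> > 0\<close> by (simp add: \<eta>_def)
  have e: "e > 0" using K nu \<eta> by (simp add: e_def)
  have eK: "e * K \<le> 1 / 2"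
  proof -
    have "e * K \<le> 1 / (2 * K) * K" using K by (intro mult_right_mono) (auto simp: e_def)
    then show ?thesis using K by simp
  qed
  have eu: "e * norm u \<le> \<eta> / 2"
  proof -
    have "e * norm u \<le> \<eta> / (2 * (norm u + 1)) * (norm u + 1)"
      using e \<eta> nu by (intro mult_mono) (auto simp: e_def)
    moreover have "\<eta> / (2 * r) * r = \<eta> / 2" if "r > 0" for r
      using that by simp
    ultimately show ?thesis using nu by metis
  qed
  obtain \<delta> where \<delta>: "\<delta> > 0" "ball x \<delta> \<subseteq> S"
    and strict: "\<And>y z. y \<in> ball x \<delta> \<Longrightarrow> z \<in> ball x \<delta> \<Longrightarrow>
      norm (F z - F y - dd F x (z - y)) \<le> e * norm (z - y)"
    using smooth_strict_differentiable[OF S F e] by blast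
  \<comment> \<open>\<open>t * L\<close> bounds the distance from \<open>x\<close> to every
    \<open>P w\<close> below, so for \<open>t < t0\<close> these points stay in the ball of strict
    differentiability.\<close>
  define L where "L = norm u + \<eta> * K"
  have L: "L > 0" unfolding L_def using \<eta> K by (intro add_nonneg_pos) auto
  define t0 where "t0 = \<delta> / L"
  have t0: "t0 > 0" using \<delta> L by (simp add: t0_def)
  have "\<exists>y\<in>S. F y = F x \<and> norm (y - x - t *\<^sub>R u) \<le> \<epsilon> * t" if t: "0 < t" "t < t0" for t
  proof -
    define P where "P w = x + t *\<^sub>R u + R w" for w
    \<comment> \<open>A Newton step with the derivative frozen at \<open>x\<close>, written in the
      target by means of \<open>dR\<close>. Its fixed points are the solutions of
      \<open>F (P w) = F x\<close>.\<close>
    define T where "T w = w - (F (P w) - F x)" for w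
    have Pball: "P w \<in> ball x \<delta>" if "w \<in> cball 0 (\<eta> * t)" for w
    proof -
      have "norm (P w - x) \<le> t * norm u + norm w * K"
        using norm_triangle_ineq[of "t *\<^sub>R u" "R w"] K(2)[of w] t by (simp add: P_def add.assoc)
      also have "\<dots> \<le> t * norm u + \<eta> * t * K"
        using that K(1) by (intro add_left_mono mult_right_mono) auto
      also have "\<dots> = t * L" by (simp add: L_def algebra_simps)
      also have "\<dots> < \<delta>" using t L by (simp add: t0_def pos_less_divide_eq)
      finally show ?thesis by (simp add: dist_norm norm_minus_commute)
    qed
    have lip: "dist (T w) (T w') \<le> 1 / 2 * dist w w'"
      if "w \<in> cball 0 (\<eta> * t)" "w' \<in> cball 0 (\<eta> * t)" for w w'
    proof -
      have PP: "P w' - P w = R (w' - w)" by (simp add: P_def linear_diff[OF R(1)])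
      have "T w - T w' = F (P w') - F (P w) - dd F x (P w' - P w)"
        unfolding PP dR by (simp add: T_def algebra_simps)
      then have "dist (T w) (T w') \<le> e * norm (P w' - P w)"
        using strict[OF Pball Pball] that by (simp add: dist_norm)
      also have "\<dots> \<le> e * (norm (w' - w) * K)"
        unfolding PP using K(2) e by (intro mult_left_mono) auto
      also have "\<dots> = e * K * dist w w'" by (simp add: dist_norm norm_minus_commute)
      also have "\<dots> \<le> 1 / 2 * dist w w'" using eK by (intro mult_right_mono) auto
      finally show ?thesis .
    qed
    have 0: "0 \<in> cball 0 (\<eta> * t)" using \<eta> t by simp
    have T0: "norm (T 0) \<le> \<eta> * t / 2"
    proof -
      have P0: "P 0 - x = t *\<^sub>R u" by (simp add: P_def linear_0[OF R(1)])
      have "norm (F (P 0) - F x - dd F x (P 0 - x)) \<le> e * norm (P 0 - x)"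
        by (rule strict[OF _ Pball[OF 0]]) (use \<delta> in simp)
      then have "norm (T 0) \<le> e * (t * norm u)"
        unfolding P0 using t by (simp add: linear_cmul[OF linF] u T_def norm_minus_commute)
      also have "\<dots> = t * (e * norm u)" by simp
      also have "\<dots> \<le> t * (\<eta> / 2)" using eu t by (intro mult_left_mono) auto
      finally show ?thesis by (simp add: mult.commute)
    qed
    have "\<exists>!w\<in>cball 0 (\<eta> * t). T w = w"
    proof (rule Banach_fix[where c = "1 / 2"])
      show "complete (cball (0::'w) (\<eta> * t))"
        by (rule complete_closed_subset[OF closed_cball subset_UNIV complete_findim])
      show "cball (0::'w) (\<eta> * t) \<noteq> {}" using 0 by blast
      show "T ` cball 0 (\<eta> * t) \<subseteq> cball 0 (\<eta> * t)"
      proof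
        fix z assume "z \<in> T ` cball 0 (\<eta> * t)"
        then obtain w where w: "w \<in> cball 0 (\<eta> * t)" "z = T w" by blast
        have "norm z \<le> dist (T w) (T 0) + norm (T 0)"
          using norm_triangle_ineq[of "T w - T 0" "T 0"] by (simp add: w dist_norm)
        also have "\<dots> \<le> 1 / 2 * dist w 0 + \<eta> * t / 2"
          by (rule add_mono[OF lip[OF w(1) 0] T0])
        also have "\<dots> \<le> \<eta> * t" using w by simp
        finally show "z \<in> cball 0 (\<eta> * t)" by simp
      qed
    qed (use lip in auto)
    then obtain w where w: "w \<in> cball 0 (\<eta> * t)" "T w = w" by blast
    have "norm (P w - x - t *\<^sub>R u) \<le> norm w * K" using K(2) by (simp add: P_def)
    also have "\<dots> \<le> \<eta> * t * K" using w K(1) by (intro mult_right_mono) auto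
    also have "\<dots> = \<epsilon> * t" using K(1) by (simp add: \<eta>_def)
    finally show ?thesis
      using w(2) Pball[OF w(1)] \<delta>(2) by (intro bexI[of _ "P w"]) (auto simp: T_def)
  qed
  then show ?thesis using t0 by blast
qed

text \<open>Tolerance and scale are both at most \<open>e n\<close>: the tolerance makes the
  rescaled secants converge to \<open>u\<close>, the scale makes the points converge to
  \<open>x\<close>.\<close>

lemma kernel_tangent_sequence:
  fixes F :: "'v::findim_inner \<Rightarrow> 'w::findim_inner"
  assumes S: "open S" "x \<in> S" and F: "smooth_on S F" and surj: "surj (dd F x)"
    and u: "dd F x u = 0"
  shows "\<exists>xs t. (\<forall>n. xs n \<in> S \<and> F (xs n) = F x \<and> t n > 0) \<and> xs \<longlonglongrightarrow> x \<and>
    (\<lambda>n. (xs n - x) /\<^sub>R t n) \<longlonglongrightarrow> u"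
proof -
  define e :: "nat \<Rightarrow> real" where "e n = 1 / real (Suc n)" for n
  have e: "e n > 0" for n by (simp add: e_def)
  have elim: "e \<longlonglongrightarrow> 0" unfolding e_def[abs_def] by (rule LIMSEQ_Suc[OF lim_1_over_n])
  have "\<exists>t y. 0 < t \<and> t < e n \<and> y \<in> S \<and> F y = F x \<and> norm (y - x - t *\<^sub>R u) \<le> e n * t" for n
  proof -
    obtain t0 where t0: "t0 > 0" "\<And>t. 0 < t \<Longrightarrow> t < t0 \<Longrightarrow>
      (\<exists>y\<in>S. F y = F x \<and> norm (y - x - t *\<^sub>R u) \<le> e n * t)"
      using level_set_near_kernel[OF assms e[of n]] by blast
    have "0 < min t0 (e n) / 2" "min t0 (e n) / 2 < t0" "min t0 (e n) / 2 < e n"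
      using t0(1) e[of n] by auto
    then show ?thesis using t0(2) by blast
  qed
  then obtain t xs where h: "\<And>n. 0 < t n" "\<And>n. t n < e n" "\<And>n. xs n \<in> S" "\<And>n. F (xs n) = F x"
    "\<And>n. norm (xs n - x - t n *\<^sub>R u) \<le> e n * t n" by metis
  have "norm ((xs n - x) /\<^sub>R t n - u) \<le> e n" for n
  proof -
    have "(xs n - x) /\<^sub>R t n - u = (xs n - x - t n *\<^sub>R u) /\<^sub>R t n"
      using h(1)[of n] by (simp add: scaleR_diff_right)
    then have "norm ((xs n - x) /\<^sub>R t n - u) = norm (xs n - x - t n *\<^sub>R u) / t n"
      using h(1)[of n] by (simp add: divide_inverse mult.commute)
    then show ?thesis using h(5)[of n] h(1)[of n] by (simp add: pos_divide_le_eq)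
  qed
  then have q: "(\<lambda>n. (xs n - x) /\<^sub>R t n) \<longlonglongrightarrow> u"
    by (intro LIM_zero_cancel[OF Lim_null_comparison[OF _ elim]]) auto
  have "t \<longlonglongrightarrow> 0"
    by (rule Lim_null_comparison[OF _ elim]) (use h(1,2) in \<open>auto simp: less_imp_le\<close>)
  then have "(\<lambda>n. x + t n *\<^sub>R ((xs n - x) /\<^sub>R t n)) \<longlonglongrightarrow> x + 0 *\<^sub>R u"
    by (intro tendsto_intros q)
  moreover have "x + t n *\<^sub>R ((xs n - x) /\<^sub>R t n) = xs n" for n using h(1)[of n] by simp
  ultimately have "xs \<longlonglongrightarrow> x" by simp
  with h q show ?thesis by blast
qed

text \<open>The ratio of \<open>s n - s0\<close> to \<open>t n\<close> is not controlled, so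
  \<open>u\<close> is tested against vectors \<open>a\<close> orthogonal to \<open>d\<close>. A
  chord \<open>q\<close> differs from \<open>h *\<^sub>R d\<close> by at most
  \<open>\<epsilon> * \<bar>h\<bar>\<close>, and for \<epsilon> at most \<open>norm d / 2\<close>
  this error can be absorbed, which bounds \<open>\<bar>h\<bar>\<close> by a multiple of the length
  of the chord.\<close>

lemma tangent_of_curve:
  fixes \<gamma> :: "real \<Rightarrow> 'v::real_inner"
  assumes \<gamma>: "(\<gamma> has_derivative (\<lambda>r. r *\<^sub>R d)) (at s0)" and d: "d \<noteq> 0"
    and s: "s \<longlonglongrightarrow> s0" and t: "\<And>n. t n > (0::real)"
    and u: "(\<lambda>n. (\<gamma> (s n) - \<gamma> s0) /\<^sub>R t n) \<longlonglongrightarrow> u"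
  shows "\<exists>c. u = c *\<^sub>R d"
proof -
  have ortho: "u \<bullet> a = 0" if a: "d \<bullet> a = 0" for a
  proof -
    have bound: "\<bar>u \<bullet> a\<bar> \<le> \<epsilon> * (2 * norm u * norm a / norm d)" if \<epsilon>: "0 < \<epsilon>" "\<epsilon> \<le> norm d / 2" for \<epsilon>
    proof -
      obtain \<delta> where \<delta>: "\<delta> > 0" "\<And>r. norm (r - s0) < \<delta> \<Longrightarrow>
        norm (\<gamma> r - \<gamma> s0 - (r - s0) *\<^sub>R d) \<le> \<epsilon> * norm (r - s0)"
        using \<gamma> \<epsilon>(1) unfolding has_derivative_at_alt by blast
      have ev: "\<forall>\<^sub>F n in sequentially. norm (s n - s0) < \<delta>"
        using s \<delta>(1) by (simp add: tendsto_iff dist_norm)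
      have le: "\<forall>\<^sub>F n in sequentially. \<bar>((\<gamma> (s n) - \<gamma> s0) /\<^sub>R t n) \<bullet> a\<bar>
          \<le> \<epsilon> * (2 * norm ((\<gamma> (s n) - \<gamma> s0) /\<^sub>R t n) * norm a / norm d)"
        using ev
      proof eventually_elim
        case (elim n)
        define q where "q = \<gamma> (s n) - \<gamma> s0"
        define h where "h = s n - s0"
        have 1: "norm (q - h *\<^sub>R d) \<le> \<epsilon> * \<bar>h\<bar>" using \<delta>(2)[OF elim] by (simp add: q_def h_def)
        have "norm (h *\<^sub>R d) \<le> norm q + norm (q - h *\<^sub>R d)"
          by (metis norm_minus_commute norm_triangle_sub)
        then have "\<bar>h\<bar> * norm d \<le> norm q + \<epsilon> * \<bar>h\<bar>" using 1 by simp
        moreover have "\<epsilon> * \<bar>h\<bar> \<le> norm d / 2 * \<bar>h\<bar>" using \<epsilon> by (intro mult_right_mono) auto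
        ultimately have 2: "\<bar>h\<bar> * norm d \<le> 2 * norm q" by (simp add: algebra_simps)
        have "\<bar>q \<bullet> a\<bar> = \<bar>(q - h *\<^sub>R d) \<bullet> a\<bar>" by (simp add: inner_diff_left a)
        also have "\<dots> \<le> norm (q - h *\<^sub>R d) * norm a" by (rule Cauchy_Schwarz_ineq2)
        also have "\<dots> \<le> \<epsilon> * \<bar>h\<bar> * norm a" using 1 by (intro mult_right_mono) auto
        also have "\<dots> \<le> \<epsilon> * (2 * norm q / norm d) * norm a"
          using 2 \<epsilon> d by (intro mult_right_mono mult_left_mono) (auto simp: pos_le_divide_eq)
        finally have "\<bar>q \<bullet> a\<bar> / t n \<le> \<epsilon> * (2 * norm q / norm d) * norm a / t n"
          using t[of n] by (intro divide_right_mono) auto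
        then show ?case
          using t[of n] unfolding q_def[symmetric] by (simp add: abs_mult divide_inverse ac_simps)
      qed
      have lim1: "(\<lambda>n. \<bar>((\<gamma> (s n) - \<gamma> s0) /\<^sub>R t n) \<bullet> a\<bar>) \<longlonglongrightarrow> \<bar>u \<bullet> a\<bar>"
        by (intro tendsto_intros u)
      have lim2: "(\<lambda>n. \<epsilon> * (2 * norm ((\<gamma> (s n) - \<gamma> s0) /\<^sub>R t n) * norm a / norm d))
          \<longlonglongrightarrow> \<epsilon> * (2 * norm u * norm a / norm d)"
        by (intro tendsto_intros u) (use d in simp)
      show ?thesis by (rule tendsto_le[OF sequentially_bot lim2 lim1 le])
    qed
    define B where "B = 2 * norm u * norm a / norm d"
    have B: "B \<ge> 0" by (simp add: B_def)
    show ?thesis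
    proof (rule ccontr)
      assume "u \<bullet> a \<noteq> 0"
      \<comment> \<open>With \<open>B + 1\<close> in place of \<open>B\<close> the quotient makes
        sense for \<open>B = 0\<close>, and \<open>\<epsilon> * B\<close> is at most half of
        \<open>\<bar>u \<bullet> a\<bar>\<close>.\<close>
      define \<epsilon> where "\<epsilon> = min (norm d / 2) (\<bar>u \<bullet> a\<bar> / (2 * (B + 1)))"
      have \<epsilon>: "0 < \<epsilon>" using d \<open>u \<bullet> a \<noteq> 0\<close> B by (simp add: \<epsilon>_def)
      have \<epsilon>': "\<epsilon> \<le> norm d / 2" unfolding \<epsilon>_def by (rule min.cobounded1)
      have "\<bar>u \<bullet> a\<bar> \<le> \<epsilon> * B" using bound[OF \<epsilon> \<epsilon>'] by (simp add: B_def)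
      also have "\<dots> \<le> \<bar>u \<bullet> a\<bar> / (2 * (B + 1)) * (B + 1)"
        using \<epsilon> B by (intro mult_mono) (auto simp: \<epsilon>_def)
      also have "\<dots> = \<bar>u \<bullet> a\<bar> / 2"
      proof -
        have "r / (2 * q) * q = r / 2" if "q > 0" for r q :: real using that by simp
        moreover have "B + 1 > 0" using B by simp
        ultimately show ?thesis by blast
      qed
      finally show False using \<open>u \<bullet> a \<noteq> 0\<close> by simp
    qed
  qed
  define c where "c = (u \<bullet> d) / (d \<bullet> d)"
  have "d \<bullet> (u - c *\<^sub>R d) = 0" using d by (simp add: c_def inner_diff_right inner_commute)
  with ortho[OF this] have "(u - c *\<^sub>R d) \<bullet> (u - c *\<^sub>R d) = 0"
    by (simp add: inner_diff_left)
  then show ?thesis by (intro exI[of _ c]) simp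
qed

section \<open>The pointwise conclusion\<close>

lemma smooth_metric_subset:
  "smooth_metric S G \<Longrightarrow> open T \<Longrightarrow> T \<subseteq> S \<Longrightarrow> smooth_metric T G"
  unfolding smooth_metric_def using smooth_on_subset by blast

text \<open>Here, in contrast to \<open>framed_submersion\<close>, the vertical distribution is
  known only point by point, as the global notions provide it; \<open>local_frame\<close> produces
  the field.\<close>

locale submersion = M: riem D G + N: riem Q H
  for D :: "'v::findim_inner set" and G :: "'v lmetric"
    and Q :: "'w::findim_inner set" and H :: "'w lmetric" +
  fixes F :: "'v \<Rightarrow> 'w" and V :: "'v \<Rightarrow> 'v set"
  assumes smooth_F: "smooth_on D F" and F_into: "y \<in> D \<Longrightarrow> F y \<in> Q"
    and surj_dF: "y \<in> D \<Longrightarrow> surj (dd F y)"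
    and V_eq: "y \<in> D \<Longrightarrow> V y = {u. dd F y u = 0}"
    and line: "y \<in> D \<Longrightarrow> \<exists>k. k \<noteq> 0 \<and> V y = range (\<lambda>c. c *\<^sub>R k)"
    and isometry: "y \<in> D \<Longrightarrow> u \<in> orth_compl G V y \<Longrightarrow> v \<in> orth_compl G V y \<Longrightarrow>
      H (F y) (dd F y u) (dd F y v) = G y u v"
    and geodesic: "y \<in> D \<Longrightarrow> second_ff G V (\<lambda>_. u) (\<lambda>_. v) y = 0"
begin

lemma linear_dF: "y \<in> D \<Longrightarrow> linear (dd F y)"
  using linear_dd smooth_on_imp_differentiable[OF smooth_F] by blast

lemma unit_vertical:
  assumes y: "y \<in> D"
  obtains k where "V y = range (\<lambda>c. c *\<^sub>R k)" "G y k k = 1"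
proof -
  obtain k where k: "k \<noteq> 0" "V y = range (\<lambda>c. c *\<^sub>R k)" using line[OF y] by blast
  define r where "r = sqrt (G y k k)"
  have pos: "G y k k > 0" by (rule inner_prodD(3)[OF M.inner_prod_G[OF y] k(1)])
  then have r: "r > 0" "r * r = G y k k" by (simp_all add: r_def)
  have "V y = range (\<lambda>c. c *\<^sub>R (k /\<^sub>R r))"
    unfolding k(2)
  proof (intro subset_antisym image_subsetI)
    show "c *\<^sub>R k \<in> range (\<lambda>c. c *\<^sub>R (k /\<^sub>R r))" for c
      using r by (intro range_eqI[of _ _ "c * r"]) simp
    show "c *\<^sub>R (k /\<^sub>R r) \<in> range (\<lambda>c. c *\<^sub>R k)" for c
      by (intro range_eqI[of _ _ "c / r"]) (simp add: divide_inverse)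
  qed
  moreover have "G y (k /\<^sub>R r) (k /\<^sub>R r) = 1"
    using r(1) by (simp add: M.G_simps y r(2)[symmetric] field_simps)
  ultimately show ?thesis using that by blast
qed

lemma split_at:
  assumes y: "y \<in> D" and k: "V y = range (\<lambda>c. c *\<^sub>R k)" "G y k k = 1"
  shows "G y u v = H (F y) (dd F y u) (dd F y v) + G y u k * G y v k"
proof -
  have kV: "c *\<^sub>R k \<in> V y" for c using k by blast
  have dk: "dd F y k = 0" using kV[of 1] V_eq[OF y] by simp
  have o: "w - G y w k *\<^sub>R k \<in> orth_compl G V y" for w
    unfolding orth_compl_def using k by (auto simp: M.G_simps y)
  have d: "dd F y (w - G y w k *\<^sub>R k) = dd F y w" for w
    by (simp add: linear_diff[OF linear_dF[OF y]] linear_cmul[OF linear_dF[OF y]] dk)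
  have "H (F y) (dd F y u) (dd F y v) = G y (u - G y u k *\<^sub>R k) (v - G y v k *\<^sub>R k)"
    using isometry[OF y o o] by (simp add: d)
  then show ?thesis using M.G_commute[OF y, of k v] by (simp add: M.G_simps y k(2))
qed

text \<open>A local unit vertical field: the normalised vertical part of the constant field \<open>n\<close>. The
  vertical part is smooth because it is metrically dual to \<open>G(n, \<cdot>) - (F\<^sup>* H)(n, \<cdot>)\<close>.\<close>

lemma local_frame:
  assumes x: "x \<in> D" and n: "n \<in> V x" "G x n n = 1"
  shows "\<exists>S U. x \<in> S \<and> S \<subseteq> D \<and> geodesic_submersion S G Q H F U V \<and> U x = n"
proof -
  define b where "b y w = G y n w - H (F y) (dd F y n) (dd F y w)" for y w
  define N where "N y = (THE z. \<forall>w. G y z w = b y w)" for y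
  have bl: "linear (b y)" if "y \<in> D" for y
    by (rule linearI)
      (simp_all add: b_def M.G_simps that N.G_simps F_into linear_add[OF linear_dF]
        linear_cmul[OF linear_dF] algebra_simps)
  have bs: "smooth_on D (\<lambda>y. b y w)" for w
    unfolding b_def
  proof (intro smooth_on_diff M.open_S M.smooth_G)
    show "smooth_on D (\<lambda>y. H (F y) (dd F y n) (dd F y w))"
      by (rule smooth_on_bilinear_family[OF M.open_S N.bilinear_G[OF F_into]
            smooth_on_compose[OF M.open_S F_into smooth_F N.smooth_G]
            smooth_on_dd[OF smooth_F] smooth_on_dd[OF smooth_F]])
  qed
  have Ns: "smooth_on D N"
    unfolding N_def by (rule riesz_smooth(1)[OF M.smooth_metric bl bs])
  have NG: "G y (N y) w = b y w" if "y \<in> D" for y w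
    unfolding N_def by (rule riesz_smooth(2)[OF M.smooth_metric bl bs that])
  \<comment> \<open>At each point \<open>N\<close> is the orthogonal projection of the constant
    vector \<open>n\<close> to the vertical line. The formula does not change when \<open>k\<close>
    is replaced by \<open>- k\<close>, so any unit vector serves.\<close>
  have Nk: "N y = G y n k *\<^sub>R k" if "y \<in> D" "V y = range (\<lambda>c. c *\<^sub>R k)" "G y k k = 1" for y k
  proof (rule M.G_ext[OF that(1)])
    fix w
    have "G y (N y) w = G y n k * G y w k"
      using split_at[OF that, of n w] by (simp add: NG that b_def)
    then show "G y (N y) w = G y (G y n k *\<^sub>R k) w"
      using M.G_commute[OF that(1), of k w] by (simp add: M.G_simps that)
  qed
  have Nx: "N x = n"
  proof -
    obtain k where k: "V x = range (\<lambda>c. c *\<^sub>R k)" "G x k k = 1" using unit_vertical[OF x] .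
    obtain c where "n = c *\<^sub>R k" using n k by blast
    then show ?thesis using Nk[OF x k] k by (simp add: M.G_simps x)
  qed
  \<comment> \<open>The set on which the projection of \<open>n\<close> is nonzero; \<open>x\<close>
    lies in it because \<open>N x = n\<close>.\<close>
  define S where "S = D \<inter> (\<lambda>y. G y (N y) (N y)) -` {0<..}"
  define U where "U y = (1 / sqrt (G y (N y) (N y))) *\<^sub>R N y" for y
  have NNs: "smooth_on D (\<lambda>y. G y (N y) (N y))"
    by (rule smooth_on_bilinear_family[OF M.open_S M.bilinear_G M.smooth_G Ns Ns])
  have S: "open S" "S \<subseteq> D"
    unfolding S_def
    by (rule continuous_open_preimage[OF smooth_on_imp_continuous_on[OF NNs] M.open_S]) auto
  have "x \<in> S" using x n by (simp add: S_def Nx)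
  have "U x = n" using n by (simp add: U_def Nx)
  \<comment> \<open>The pointwise \<open>k\<close> carries no smoothness; it serves only to check
    pointwise identities of \<open>U\<close>. These do not see the sign.\<close>
  have Uk: "\<exists>k. V y = range (\<lambda>c. c *\<^sub>R k) \<and> G y k k = 1 \<and> (U y = k \<or> U y = - k)" if y: "y \<in> S" for y
  proof -
    have yD: "y \<in> D" and pos: "G y (N y) (N y) > 0" using y by (auto simp: S_def)
    obtain k where k: "V y = range (\<lambda>c. c *\<^sub>R k)" "G y k k = 1" using unit_vertical[OF yD] .
    define c where "c = G y n k"
    have N: "N y = c *\<^sub>R k" using Nk[OF yD k] by (simp add: c_def)
    then have "G y (N y) (N y) = c * c" using k by (simp add: M.G_simps yD)
    then have "U y = (c / \<bar>c\<bar>) *\<^sub>R k" "c \<noteq> 0" using pos by (auto simp: U_def N)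
    then show ?thesis using k by (intro exI[of _ k]) (auto simp: abs_if)
  qed
  have fs: "framed_submersion S G Q H F U V"
  proof
    show "smooth_metric S G" by (rule smooth_metric_subset[OF M.smooth_metric S])
    show "smooth_on S F" by (rule smooth_on_subset[OF smooth_F S(2)])
    show "smooth_on S U"
      unfolding U_def
      by (intro smooth_on_scaleR S(1) smooth_on_rsqrt smooth_on_subset[OF NNs S(2)]
          smooth_on_subset[OF Ns S(2)]) (simp add: S_def)
    fix y assume y: "y \<in> S"
    then have yD: "y \<in> D" using S by blast
    show "F y \<in> Q" "surj (dd F y)" "V y = {u. dd F y u = 0}"
      using F_into surj_dF V_eq yD by blast+
    obtain k where k: "V y = range (\<lambda>c. c *\<^sub>R k)" "G y k k = 1" and Uk: "U y = k \<or> U y = - k"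
      using Uk[OF y] by blast
    show "G y (U y) (U y) = 1" using Uk k by (auto simp: M.G_simps yD)
    have "U y \<in> V y"
      unfolding k(1) using Uk by (metis range_eqI scaleR_minus1_left scaleR_one)
    then show "dd F y (U y) = 0" using V_eq[OF yD] by simp
    show "G y u v = H (F y) (dd F y u) (dd F y v) + G y u (U y) * G y v (U y)" for u v
      using split_at[OF yD k, of u v] Uk by (auto simp: M.G_simps yD)
  qed
  interpret L: framed_submersion S G Q H F U V by (rule fs)
  have "geodesic_submersion S G Q H F U V"
  proof
    show "L.\<phi> y (U y) = 0" if "y \<in> S" for y
      by (rule trans[OF L.second_ff_U[OF that, symmetric] geodesic[OF subsetD[OF S(2) that]]])
  qed
  then show ?thesis using \<open>x \<in> S\<close> S(2) \<open>U x = n\<close> by blast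
qed

lemma quasi_einstein_conclusion:
  assumes x: "x \<in> D" and Y: "smooth_on D Y" "\<And>y. y \<in> D \<Longrightarrow> Y y \<in> V y"
    and qe: "\<And>u v. ricci G x u v + 1 / 2 * lie_derivative_metric G Y x u v
      - 1 / m * (G x (Y x) u * G x (Y x) v) = \<Lambda> * G x u v"
  shows "oneill_A_norm G V x = sqrt (scal G x - (real (dim (UNIV :: 'v set)) - 1) * \<Lambda>)"
    and "scal H (F x) = 2 * scal G x - (real (dim (UNIV :: 'v set)) - 1) * \<Lambda>"
proof -
  \<comment> \<open>The choice made inside \<open>oneill_A_norm\<close>; the local field is built to
    pass through it.\<close>
  define n where "n = (SOME u. u \<in> V x \<and> G x u u = 1)"
  obtain k where k: "V x = range (\<lambda>c. c *\<^sub>R k)" "G x k k = 1" using unit_vertical[OF x] .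
  have "k \<in> V x" unfolding k(1) by (metis range_eqI scaleR_one)
  then have "n \<in> V x \<and> G x n n = 1"
    using someI[of "\<lambda>u. u \<in> V x \<and> G x u u = 1" k] k(2) unfolding n_def by blast
  then obtain S U where xS: "x \<in> S" and SD: "S \<subseteq> D" and gs: "geodesic_submersion S G Q H F U V"
    and Un: "U x = n" using local_frame[OF x] by blast
  interpret L: geodesic_submersion S G Q H F U V by (rule gs)
  have "orth_compl G V x = {u. L.\<theta> x u = 0}" by (rule L.orth_compl_eq[OF xS])
  then have "subspace (orth_compl G V x)" by (auto simp: subspace_def L.\<theta>_simps xS)
  then obtain E where E: "orthonormal_basis (G x) (orth_compl G V x) E"
    using orthonormal_basis_exists[OF M.inner_prod_G[OF x]] by blast
  note B = L.adapted_basis[OF xS E]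
  note C = B(4)[unfolded orthonormal_basis_def]
  note bas = C[THEN conjunct1] C[THEN conjunct2, THEN conjunct1] C[THEN conjunct2, THEN conjunct2]
  \<comment> \<open>The number of horizontal basis vectors is thereby expressed through the model
    space and cannot depend on \<open>x\<close>.\<close>
  have "card (insert (U x) E) = dim (UNIV :: 'v set)"
    by (rule basis_card_eq_dim[OF subset_UNIV _ orthonormal_independent
          [OF M.bilinear_G[OF x] bas(1,3)]]) (simp only: bas(2) subset_UNIV)
  then have card: "real (card E) = real (dim (UNIV :: 'v set)) - 1" using B(1,3) by simp
  have "ricci G x e e = \<Lambda>" if "e \<in> E" for e
  proof -
    have "lie_derivative_metric G Y x e e = 0" "G x (Y x) e = 0"
      using L.lie_derivative_vertical[OF xS smooth_on_imp_differentiable[OF Y(1) x] _ B(2)[OF that]]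
        Y(2) SD by blast+
    moreover have "G x e e = 1" using bas(3) that by (metis insertI2)
    ultimately show ?thesis using qe[of e e] by simp
  qed
  then have sum: "(\<Sum>e\<in>E. ricci G x e e) = (real (dim (UNIV :: 'v set)) - 1) * \<Lambda>"
    by (simp add: card)
  have "scal G x = ricci G x (U x) (U x) + (\<Sum>e\<in>E. ricci G x e e)"
    unfolding M.scal_eq[OF x B(4)] using B(1,3) by simp
  then have A: "(\<Sum>e\<in>E. G x (L.\<phi> x e) (L.\<phi> x e)) = scal G x - (real (dim (UNIV :: 'v set)) - 1) * \<Lambda>"
    unfolding L.ricci_vertical[OF xS E] sum by simp
  show "oneill_A_norm G V x = sqrt (scal G x - (real (dim (UNIV :: 'v set)) - 1) * \<Lambda>)"
    unfolding L.oneill_A_norm_eq[OF xS Un[unfolded n_def] E] A ..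
  show "scal H (F x) = 2 * scal G x - (real (dim (UNIV :: 'v set)) - 1) * \<Lambda>"
    unfolding L.scal_base[OF xS E] A sum by simp
qed

end

section \<open>Charts\<close>

locale manifold =
  fixes M :: "('a, 'v::findim_inner) mfd"
  assumes smooth_manifold: "smooth_manifold M"
begin

lemma charts_cover: "p \<in> topspace (mtop M) \<Longrightarrow> \<exists>c\<in>charts M. p \<in> fst c"
  using smooth_manifold unfolding smooth_manifold_def by blast

lemma chart_openin: "c \<in> charts M \<Longrightarrow> openin (mtop M) (fst c)"
  using smooth_manifold unfolding smooth_manifold_def by blast

lemma chart_img_open: "c \<in> charts M \<Longrightarrow> open (chart_img c)"
  using smooth_manifold unfolding smooth_manifold_def by blast

lemma chart_homeo: "c \<in> charts M \<Longrightarrow>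
    homeomorphic_map (subtopology (mtop M) (fst c)) (top_of_set (chart_img c)) (snd c)"
  using smooth_manifold unfolding smooth_manifold_def by blast

lemma transition_smooth: "c \<in> charts M \<Longrightarrow> d \<in> charts M \<Longrightarrow>
    smooth_on (snd c ` (fst c \<inter> fst d)) (snd d \<circ> chart_inv c)"
  using smooth_manifold unfolding smooth_manifold_def by blast

lemma chart_subset: "c \<in> charts M \<Longrightarrow> fst c \<subseteq> topspace (mtop M)"
  using chart_openin openin_subset by blast

lemma chart_inj: "c \<in> charts M \<Longrightarrow> inj_on (snd c) (fst c)"
  using homeomorphic_imp_injective_map[OF chart_homeo[of c]] chart_subset[of c]
  by (simp add: Int_absorb1)

lemma chart_inv_left: "c \<in> charts M \<Longrightarrow> p \<in> fst c \<Longrightarrow> chart_inv c (snd c p) = p"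
  unfolding chart_inv_def by (rule inv_into_f_f[OF chart_inj])

lemma chart_inv_right: "x \<in> chart_img c \<Longrightarrow> snd c (chart_inv c x) = x"
  unfolding chart_inv_def chart_img_def by (rule f_inv_into_f)

lemma chart_inv_in: "x \<in> chart_img c \<Longrightarrow> chart_inv c x \<in> fst c"
  unfolding chart_inv_def chart_img_def by (rule inv_into_into)

lemma chart_image_iff:
  assumes "c \<in> charts M"
  shows "x \<in> snd c ` (fst c \<inter> W) \<longleftrightarrow> x \<in> chart_img c \<and> chart_inv c x \<in> W"
proof
  assume "x \<in> snd c ` (fst c \<inter> W)"
  then obtain p where "x = snd c p" "p \<in> fst c" "p \<in> W" by blast
  then show "x \<in> chart_img c \<and> chart_inv c x \<in> W"
    using chart_inv_left[OF assms] by (simp add: chart_img_def)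
next
  assume x: "x \<in> chart_img c \<and> chart_inv c x \<in> W"
  then show "x \<in> snd c ` (fst c \<inter> W)"
    using chart_inv_right[of x c] chart_inv_in[of x c] by (metis IntI imageI)
qed

lemma chart_image_open:
  assumes c: "c \<in> charts M" and W: "openin (mtop M) W"
  shows "open (snd c ` (fst c \<inter> W))"
proof -
  have "openin (subtopology (mtop M) (fst c)) (fst c \<inter> W)"
    using W by (auto simp: openin_subtopology)
  then have "openin (top_of_set (chart_img c)) (snd c ` (fst c \<inter> W))"
    using homeomorphic_imp_open_map[OF chart_homeo[OF c]] by (auto simp: open_map_def)
  then show ?thesis
    using openin_open_trans[OF _ chart_img_open[OF c]] by blast
qed

lemma smooth_near_chart:
  assumes c: "c \<in> charts M" "p \<in> fst c" and f: "smooth_near M p f"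
  shows "\<exists>T. open T \<and> snd c p \<in> T \<and> smooth_on T (f \<circ> chart_inv c)"
proof -
  obtain W where W: "openin (mtop M) W" "p \<in> W" "smooth_on (snd c ` (fst c \<inter> W)) (f \<circ> chart_inv c)"
    using f c unfolding smooth_near_def by blast
  then show ?thesis using chart_image_open[OF c(1) W(1)] c(2) by blast
qed

lemma chart_coordinate_smooth_near:
  assumes c: "c \<in> charts M" "p \<in> fst c"
  shows "smooth_near M p (\<lambda>q. snd c q \<bullet> a)"
  unfolding smooth_near_def
proof (intro exI[of _ "fst c"] conjI ballI)
  fix d assume d: "d \<in> charts M"
  show "smooth_on (snd d ` (fst d \<inter> fst c)) ((\<lambda>q. snd c q \<bullet> a) \<circ> chart_inv d)"
    using smooth_on_linear[OF chart_image_open[OF d chart_openin[OF c(1)]] bounded_linear_inner_left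
        transition_smooth[OF d c(1)], of a] by (simp add: o_def)
qed (use c chart_openin in auto)

text \<open>One chain rule for three kinds of \<Phi>: the inverse of another chart, \<pi> after an
  inverse chart, and an embedded circle after an inverse chart of the circle.\<close>

lemma compose_chart:
  fixes \<Phi> :: "'u::real_normed_vector \<Rightarrow> 'a"
  assumes d: "d \<in> charts M" and T: "open T" "x \<in> T" "\<And>y. y \<in> T \<Longrightarrow> \<Phi> y \<in> fst d"
    and \<Phi>: "smooth_on T (snd d \<circ> \<Phi>)" and f: "smooth_near M (\<Phi> x) f"
  shows "\<exists>T'. open T' \<and> x \<in> T' \<and> smooth_on T' (f \<circ> \<Phi>)"
    and "dd (f \<circ> \<Phi>) x u = dd (f \<circ> chart_inv d) (snd d (\<Phi> x)) (dd (snd d \<circ> \<Phi>) x u)"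
proof -
  obtain R where R: "open R" "snd d (\<Phi> x) \<in> R" "smooth_on R (f \<circ> chart_inv d)"
    using smooth_near_chart[OF d T(3)[OF T(2)] f] by blast
  define T' where "T' = T \<inter> (snd d \<circ> \<Phi>) -` R"
  have T': "open T'" "x \<in> T'" "T' \<subseteq> T"
    unfolding T'_def using R T
    by (auto intro!: continuous_open_preimage[OF smooth_on_imp_continuous_on[OF \<Phi>]])
  have eq: "(f \<circ> chart_inv d) ((snd d \<circ> \<Phi>) y) = (f \<circ> \<Phi>) y" if "y \<in> T'" for y
    using T(3) T'(3) that d by (auto simp: chart_inv_left)
  have "smooth_on T' (\<lambda>y. (f \<circ> chart_inv d) ((snd d \<circ> \<Phi>) y))"
    by (rule smooth_on_compose[OF T'(1) _ smooth_on_subset[OF \<Phi> T'(3)] R(3)]) (simp add: T'_def)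
  then show "\<exists>T'. open T' \<and> x \<in> T' \<and> smooth_on T' (f \<circ> \<Phi>)"
    by (intro exI[of _ T'] conjI T'(1,2)) (rule smooth_on_cong[OF T'(1) eq])
  have "dd (f \<circ> \<Phi>) x = dd (\<lambda>y. (f \<circ> chart_inv d) ((snd d \<circ> \<Phi>) y)) x"
    by (rule dd_cong_open[OF T'(1,2)]) (simp only: eq)
  also have "\<dots> = (\<lambda>u. dd (f \<circ> chart_inv d) ((snd d \<circ> \<Phi>) x) (dd (snd d \<circ> \<Phi>) x u))"
    by (rule dd_eqI[OF has_derivative_compose_dd[OF smooth_on_has_derivative[OF \<Phi> T(2)]
          smooth_on_imp_differentiable[OF R(3)]]]) (use R in simp)
  finally show "dd (f \<circ> \<Phi>) x u = dd (f \<circ> chart_inv d) (snd d (\<Phi> x)) (dd (snd d \<circ> \<Phi>) x u)"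
    by simp
qed

text \<open>The components are recovered by applying the vector to the coordinate functions of the
  chart. Their arbitrary values outside the chart domain do no harm, since
  \<open>smooth_near\<close> asks for one neighbourhood only.\<close>

lemma coord_vec_inj:
  assumes c: "c \<in> charts M" and x: "x \<in> chart_img c" and eq: "coord_vec M c x u = coord_vec M c x v"
  shows "u = v"
proof -
  let ?p = "chart_inv c x"
  have "coord_vec M c x w (\<lambda>q. snd c q \<bullet> a) = w \<bullet> a" for w a
  proof -
    have "dd ((\<lambda>q. snd c q \<bullet> a) \<circ> chart_inv c) x = dd (\<lambda>y. y \<bullet> a) x"
      by (rule dd_cong_open[OF chart_img_open[OF c] x]) (simp add: chart_inv_right)
    also have "\<dots> = (\<lambda>y. y \<bullet> a)"
      by (rule dd_eqI[OF bounded_linear_imp_has_derivative[OF bounded_linear_inner_left]])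
    finally show ?thesis
      using chart_coordinate_smooth_near[OF c chart_inv_in[OF x], of a] by (simp add: coord_vec_def)
  qed
  then have "u \<bullet> a = v \<bullet> a" for a using eq by metis
  then show ?thesis using vector_eq_rdot by blast
qed

lemma coord_vec_zero:
  assumes c: "c \<in> charts M" and x: "x \<in> chart_img c"
  shows "coord_vec M c x 0 = (\<lambda>_. 0)"
proof -
  have "dd (f \<circ> chart_inv c) x 0 = 0" if f: "smooth_near M (chart_inv c x) f" for f
    using smooth_near_chart[OF c chart_inv_in[OF x] f] chart_inv_right[OF x]
      linear_0[OF linear_dd[OF smooth_on_imp_differentiable]] by metis
  then show ?thesis by (auto simp: coord_vec_def fun_eq_iff)
qed

lemma coord_vec_eq_zero_iff:
  assumes "c \<in> charts M" "x \<in> chart_img c"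
  shows "coord_vec M c x u = (\<lambda>_. 0) \<longleftrightarrow> u = 0"
  using coord_vec_inj[OF assms, of u 0] coord_vec_zero[OF assms] by auto

lemma coord_vec_change:
  assumes c: "c \<in> charts M" "d \<in> charts M" and p: "p \<in> fst c" "p \<in> fst d"
  shows "coord_vec M c (snd c p) u = coord_vec M d (snd d p) (dd (snd d \<circ> chart_inv c) (snd c p) u)"
proof
  fix f
  have x: "snd c p \<in> snd c ` (fst c \<inter> fst d)" using p by blast
  have "dd (f \<circ> chart_inv c) (snd c p) u =
      dd (f \<circ> chart_inv d) (snd d p) (dd (snd d \<circ> chart_inv c) (snd c p) u)" if "smooth_near M p f"
    using compose_chart(2)[OF c(2) chart_image_open[OF c(1) chart_openin[OF c(2)]] x _
        transition_smooth[OF c], of f u] that chart_inv_left[OF c(1)] p(1) by fastforce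
  then show "coord_vec M c (snd c p) u f =
      coord_vec M d (snd d p) (dd (snd d \<circ> chart_inv c) (snd c p) u) f"
    using chart_inv_left[OF c(1) p(1)] chart_inv_left[OF c(2) p(2)] by (simp add: coord_vec_def)
qed

text \<open>The definition collects the coordinate vectors of all charts at the point; by
  \<open>coord_vec_change\<close> one chart yields them all.\<close>

lemma tangent_space_eq:
  assumes c: "c \<in> charts M" and x: "x \<in> chart_img c"
  shows "tangent_space M (chart_inv c x) = range (coord_vec M c x)"
proof -
  have p: "chart_inv c x \<in> fst c" "snd c (chart_inv c x) = x"
    using chart_inv_in[OF x] chart_inv_right[OF x] by simp_all
  have "coord_vec M c x u \<in> tangent_space M (chart_inv c x)" for u
    unfolding tangent_space_def using c p by (intro CollectI exI[of _ c] exI[of _ u]) simp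
  moreover have "\<xi> \<in> range (coord_vec M c x)" if "\<xi> \<in> tangent_space M (chart_inv c x)" for \<xi>
  proof -
    obtain d u where "\<xi> = coord_vec M d (snd d (chart_inv c x)) u" "d \<in> charts M" "chart_inv c x \<in> fst d"
      using \<open>\<xi> \<in> _\<close> unfolding tangent_space_def by blast
    then show ?thesis using coord_vec_change[OF _ c _ p(1), of d u] p(2) by simp
  qed
  ultimately show ?thesis by blast
qed

lemma local_field_eq:
  assumes c: "c \<in> charts M" and x: "x \<in> chart_img c" and X: "X (chart_inv c x) \<in> tangent_space M (chart_inv c x)"
  shows "coord_vec M c x (local_field M X c x) = X (chart_inv c x)"
proof -
  obtain u where u: "X (chart_inv c x) = coord_vec M c x u"
    using X tangent_space_eq[OF c x] by blast
  show ?thesis unfolding local_field_def u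
    by (rule theI[of _ u]) (use coord_vec_inj[OF c x] in auto)
qed

lemma metric_chart:
  assumes "riemannian_metric M g" "c \<in> charts M"
  shows "smooth_metric (chart_img c) (local_metric M g c)"
  unfolding smooth_metric_def inner_prod_def
proof (intro conjI ballI allI impI)
  show "open (chart_img c)" by (rule chart_img_open[OF assms(2)])
  show "smooth_on (chart_img c) (\<lambda>y. local_metric M g c y u v)" for u v
    using assms unfolding riemannian_metric_def by blast
  fix y assume y: "y \<in> chart_img c"
  show "bilinear (local_metric M g c y)"
    using assms y unfolding riemannian_metric_def by blast
  show "local_metric M g c y u v = local_metric M g c y v u" for u v
    using assms y unfolding riemannian_metric_def by metis
  show "0 < local_metric M g c y u u" if "u \<noteq> 0" for u
    using assms y that unfolding riemannian_metric_def by metis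
qed

end

section \<open>Smooth maps in charts\<close>

locale smooth_mfd_map = M: manifold M + B: manifold B
  for M :: "('a, 'v::findim_inner) mfd" and B :: "('b, 'w::findim_inner) mfd" +
  fixes \<pi> :: "'a \<Rightarrow> 'b"
  assumes smooth_map: "smooth_map M B \<pi>"
begin

definition dom where "dom c d = snd c ` {p \<in> fst c. \<pi> p \<in> fst d}"
definition rep where "rep c d = snd d \<circ> \<pi> \<circ> chart_inv c"

lemma rep_smooth: "c \<in> charts M \<Longrightarrow> d \<in> charts B \<Longrightarrow> smooth_on (dom c d) (rep c d)"
  using smooth_map unfolding smooth_map_def dom_def rep_def by blast

lemma preimage_openin:
  assumes "openin (mtop B) W"
  shows "openin (mtop M) {p \<in> topspace (mtop M). \<pi> p \<in> W}"
  using smooth_map assms unfolding smooth_map_def by (blast intro: openin_continuous_map_preimage)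

lemma dom_eq:
  assumes "c \<in> charts M"
  shows "dom c d = snd c ` (fst c \<inter> {p \<in> topspace (mtop M). \<pi> p \<in> fst d})"
  unfolding dom_def using M.chart_subset[OF assms] by (intro arg_cong[of _ _ "(`) (snd c)"]) auto

lemma dom_open: "c \<in> charts M \<Longrightarrow> d \<in> charts B \<Longrightarrow> open (dom c d)"
  unfolding dom_eq by (rule M.chart_image_open[OF _ preimage_openin[OF B.chart_openin]])

lemma dom_iff:
  assumes c: "c \<in> charts M"
  shows "x \<in> dom c d \<longleftrightarrow> x \<in> chart_img c \<and> \<pi> (chart_inv c x) \<in> fst d"
  using M.chart_inv_in[of x c] M.chart_subset[OF c]
  by (auto simp: dom_eq[OF c] M.chart_image_iff[OF c])

lemma rep_in:
  assumes "c \<in> charts M" "d \<in> charts B" "x \<in> dom c d"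
  shows "rep c d x \<in> chart_img d" "chart_inv d (rep c d x) = \<pi> (chart_inv c x)"
  using assms by (auto simp: dom_iff rep_def chart_img_def B.chart_inv_left)

text \<open>\<open>coord_vec\<close> returns 0 on functions that are not smooth nearby. For
  \<open>f\<close> smooth near \<open>\<pi> p\<close> this lemma ensures that
  \<open>differential\<close> evaluates the vector on \<open>f \<circ> \<pi>\<close> by
  differentiation and not by that default.\<close>

lemma smooth_near_pullback:
  assumes p: "p \<in> topspace (mtop M)" and f: "smooth_near B (\<pi> p) f"
  shows "smooth_near M p (f \<circ> \<pi>)"
proof -
  obtain W where W: "openin (mtop B) W" "\<pi> p \<in> W"
    and fW: "\<forall>c\<in>charts B. smooth_on (snd c ` (fst c \<inter> W)) (f \<circ> chart_inv c)"
    using f unfolding smooth_near_def by blast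
  let ?W = "{p \<in> topspace (mtop M). \<pi> p \<in> W}"
  have "smooth_on (snd c ` (fst c \<inter> ?W)) (f \<circ> \<pi> \<circ> chart_inv c)" if c: "c \<in> charts M" for c
  proof (rule smooth_on_local)
    fix y assume "y \<in> snd c ` (fst c \<inter> ?W)"
    then have y: "y \<in> chart_img c" "\<pi> (chart_inv c y) \<in> W"
      by (auto simp: M.chart_image_iff[OF c])
    then have "\<pi> (chart_inv c y) \<in> topspace (mtop B)" using W(1) openin_subset by blast
    then obtain d where d: "d \<in> charts B" "\<pi> (chart_inv c y) \<in> fst d" using B.charts_cover by blast
    have yd: "y \<in> dom c d" using y d by (simp add: dom_iff c)
    have "smooth_near B ((\<pi> \<circ> chart_inv c) y) f"
      unfolding smooth_near_def using W(1) y(2) fW by auto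
    from B.compose_chart(1)[where \<Phi> = "\<pi> \<circ> chart_inv c", OF d(1) dom_open[OF c d(1)] yd _ _ this]
    show "\<exists>T. open T \<and> y \<in> T \<and> smooth_on T (f \<circ> \<pi> \<circ> chart_inv c)"
      using rep_smooth[OF c d(1)] by (auto simp: dom_iff c rep_def o_assoc)
  qed
  then show ?thesis
    unfolding smooth_near_def using preimage_openin[OF W(1)] p W(2) by blast
qed

lemma differential_coord:
  assumes c: "c \<in> charts M" and d: "d \<in> charts B" and x: "x \<in> dom c d"
  shows "differential B \<pi> (chart_inv c x) (coord_vec M c x u) =
    coord_vec B d (rep c d x) (dd (rep c d) x u)"
proof
  fix f
  have p: "chart_inv c x \<in> topspace (mtop M)"
    using x M.chart_inv_in[of x c] M.chart_subset[OF c] by (auto simp: dom_iff c)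
  have "dd (f \<circ> \<pi> \<circ> chart_inv c) x u = dd (f \<circ> chart_inv d) (rep c d x) (dd (rep c d) x u)"
    if "smooth_near B (\<pi> (chart_inv c x)) f"
    using B.compose_chart(2)[OF d dom_open[OF c d] x, of "\<pi> \<circ> chart_inv c" f u] that
      rep_smooth[OF c d] by (simp add: dom_iff c rep_def o_assoc)
  then show "differential B \<pi> (chart_inv c x) (coord_vec M c x u) f =
      coord_vec B d (rep c d x) (dd (rep c d) x u) f"
    using smooth_near_pullback[OF p] rep_in(2)[OF c d x]
    by (simp add: differential_def coord_vec_def)
qed

lemma local_vertical_eq:
  assumes c: "c \<in> charts M" and d: "d \<in> charts B" and x: "x \<in> dom c d"
  shows "local_vertical M B \<pi> c x = {u. dd (rep c d) x u = 0}"
proof -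
  have "coord_vec M c x u \<in> tangent_space M (chart_inv c x)" for u
    using M.tangent_space_eq[OF c] x by (simp add: dom_iff c)
  then show ?thesis
    unfolding local_vertical_def vertical_space_def
    by (simp add: differential_coord[OF assms] B.coord_vec_eq_zero_iff[OF d rep_in(1)[OF assms]])
qed

lemma rep_surj:
  assumes c: "c \<in> charts M" and d: "d \<in> charts B" and x: "x \<in> dom c d"
    and surj: "differential B \<pi> (chart_inv c x) ` tangent_space M (chart_inv c x) =
      tangent_space B (\<pi> (chart_inv c x))"
  shows "surj (dd (rep c d) x)"
proof -
  have xi: "x \<in> chart_img c" using x by (simp add: dom_iff c)
  have "w \<in> range (dd (rep c d) x)" for w
  proof -
    have "coord_vec B d (rep c d x) w \<in> tangent_space B (\<pi> (chart_inv c x))"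
      using B.tangent_space_eq[OF d rep_in(1)[OF c d x]] rep_in(2)[OF c d x] by auto
    then obtain u where "coord_vec B d (rep c d x) w = differential B \<pi> (chart_inv c x) (coord_vec M c x u)"
      unfolding surj[symmetric] M.tangent_space_eq[OF c xi] by blast
    then show ?thesis
      using B.coord_vec_inj[OF d rep_in(1)[OF c d x]] by (metis differential_coord[OF c d x] rangeI)
  qed
  then show ?thesis by blast
qed

lemma horizontal_coord:
  assumes c: "c \<in> charts M" and x: "x \<in> chart_img c"
    and u: "u \<in> orth_compl (local_metric M g c) (local_vertical M B \<pi> c) x"
  shows "coord_vec M c x u \<in> horizontal_space M g B \<pi> (chart_inv c x)"
  unfolding horizontal_space_def
proof (intro CollectI conjI ballI)
  show "coord_vec M c x u \<in> tangent_space M (chart_inv c x)"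
    using M.tangent_space_eq[OF c x] by blast
  fix \<eta> assume \<eta>: "\<eta> \<in> vertical_space M B \<pi> (chart_inv c x)"
  then obtain w where w: "\<eta> = coord_vec M c x w"
    using M.tangent_space_eq[OF c x] unfolding vertical_space_def by blast
  with \<eta> have "w \<in> local_vertical M B \<pi> c x" by (simp add: local_vertical_def)
  with u show "g (chart_inv c x) (coord_vec M c x u) \<eta> = 0"
    unfolding orth_compl_def local_metric_def w by blast
qed

end

section \<open>Circle fibers\<close>

lemma smooth_on_sin: "smooth_on S (\<lambda>t::real. sin (t + q))"
proof -
  \<comment> \<open>The cosine is the sine shifted by \<open>pi / 2\<close>; with \<open>r\<close>
    and \<open>q\<close> free, the family contains its own derivatives.\<close>
  have "C_k_on k UNIV (\<lambda>t::real. r * sin (t + q))" for k r q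
  proof (induction k arbitrary: r q)
    case 0
    then show ?case by (auto intro!: continuous_intros)
  next
    case (Suc k)
    have D: "((\<lambda>t. r * sin (t + q)) has_derivative (\<lambda>v. v * r * sin (x + (q + pi / 2)))) (at x)" for x
    proof -
      have "sin (x + (q + pi / 2)) = cos (x + q)" by (simp add: sin_add cos_add)
      then show ?thesis by (auto intro!: derivative_eq_intros simp: fun_eq_iff)
    qed
    show ?case using Suc.IH D by (auto simp: dd_eqI[OF D] differentiable_def)
  qed
  from this[of _ 1] have "smooth_on UNIV (\<lambda>t::real. sin (t + q))" by (simp add: smooth_on_def)
  then show ?thesis by (rule smooth_on_subset) simp
qed

definition circle_chart :: "real \<Rightarrow> (complex, real) chart" where
  "circle_chart a = (cis ` {a<..<a + 2 * pi}, the_inv_into {a<..<a + 2 * pi} cis)"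

lemma charts_circle: "charts circle = range circle_chart"
  by (auto simp: circle_def circle_chart_def)

lemma mtop_circle: "mtop circle = top_of_set (sphere 0 1)"
  by (simp add: circle_def)

lemma inj_on_cis: "inj_on cis {a<..<a + 2 * pi}"
proof (rule inj_onI)
  fix s t assume st: "s \<in> {a<..<a + 2 * pi}" "t \<in> {a<..<a + 2 * pi}" and eq: "cis s = cis t"
  have "cis (s - t) = 1" unfolding cis_divide[symmetric] eq by simp
  then have "cos (s - t) = 1" by (metis cis.sel(1) one_complex.sel(1))
  then obtain n :: int where n: "s - t = of_int n * 2 * pi" unfolding cos_one_2pi_int by blast
  have "\<bar>s - t\<bar> < 2 * pi" using st by auto
  then have "\<bar>of_int n :: real\<bar> < 1" unfolding n by (simp add: abs_mult)
  then have "n = 0" by linarith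
  then show "s = t" using n by simp
qed

lemma circle_chart_simps:
  "fst (circle_chart a) = cis ` {a<..<a + 2 * pi}"
  "t \<in> {a<..<a + 2 * pi} \<Longrightarrow> snd (circle_chart a) (cis t) = t"
  by (simp_all add: circle_chart_def the_inv_into_f_f[OF inj_on_cis])

lemma circle_chart_inv: "t \<in> {a<..<a + 2 * pi} \<Longrightarrow> chart_inv (circle_chart a) t = cis t"
  unfolding chart_inv_def circle_chart_def fst_conv snd_conv
  using inv_into_f_f[OF inj_on_the_inv_into[OF inj_on_cis], of "cis t" a]
  by (simp add: the_inv_into_f_f[OF inj_on_cis])

lemma circle_chart_image:
  "snd (circle_chart a) ` {z \<in> fst (circle_chart a). P z} = {t \<in> {a<..<a + 2 * pi}. P (cis t)}"
proof (intro set_eqI iffI)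
  fix t assume "t \<in> {t \<in> {a<..<a + 2 * pi}. P (cis t)}"
  then show "t \<in> snd (circle_chart a) ` {z \<in> fst (circle_chart a). P z}"
    by (intro image_eqI[of _ _ "cis t"]) (auto simp: circle_chart_simps)
qed (auto simp: circle_chart_simps)

text \<open>In the angle \<open>t\<close> this function is \<open>sin (t - s)\<close>, with
  derivative 1 at \<open>s\<close>. It detects that the unit coordinate vector of the circle at
  \<open>cis s\<close> is not zero.\<close>

lemma smooth_near_circle_sin: "smooth_near circle z (\<lambda>z. Im (z / cis s))" if "z \<in> sphere 0 1"
  unfolding smooth_near_def
proof (intro exI[of _ "sphere 0 1"] conjI ballI that)
  show "openin (mtop circle) (sphere 0 1)" by (simp add: mtop_circle)
  fix c assume "c \<in> charts circle"
  then obtain a where c: "c = circle_chart a" by (auto simp: charts_circle)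
  let ?I = "{a<..<a + 2 * pi}"
  have *: "snd c ` (fst c \<inter> sphere 0 1) \<subseteq> ?I" by (auto simp: c circle_chart_simps)
  have "smooth_on ?I ((\<lambda>z. Im (z / cis s)) \<circ> chart_inv c)"
    by (rule smooth_on_cong[OF _ _ smooth_on_sin[of _ "- s"]])
      (auto simp: c circle_chart_inv cis_divide)
  then show "smooth_on (snd c ` (fst c \<inter> sphere 0 1)) ((\<lambda>z. Im (z / cis s)) \<circ> chart_inv c)"
    using * smooth_on_subset by blast
qed

context manifold
begin

lemma circle_embedding_velocity:
  assumes \<sigma>: "smooth_embedding circle M \<sigma>" and c: "c \<in> charts M" and s: "\<sigma> (cis s) \<in> fst c"
  shows "\<exists>T. open T \<and> s \<in> T \<and> (\<forall>t\<in>T. \<sigma> (cis t) \<in> fst c) \<and>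
    smooth_on T (\<lambda>t. snd c (\<sigma> (cis t))) \<and> dd (\<lambda>t. snd c (\<sigma> (cis t))) s 1 \<noteq> 0"
proof -
  \<comment> \<open>Centres the chart interval at \<open>s\<close>, so that no reduction of angles
    modulo \<open>2 * pi\<close> is needed.\<close>
  define a where "a = s - pi"
  let ?I = "{a<..<a + 2 * pi}" and ?k = "circle_chart a" and ?\<gamma> = "\<lambda>t. snd c (\<sigma> (cis t))"
  have sI: "s \<in> ?I" by (simp add: a_def)
  have k: "?k \<in> charts circle" by (simp add: charts_circle)
  have \<sigma>s: "smooth_map circle M \<sigma>"
    and imm: "\<And>z \<xi>. z \<in> sphere 0 1 \<Longrightarrow> \<xi> \<in> tangent_space circle z \<Longrightarrow>
      differential M \<sigma> z \<xi> = (\<lambda>_. 0) \<Longrightarrow> \<xi> = (\<lambda>_. 0)"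
    using \<sigma> by (auto simp: smooth_embedding_def mtop_circle)
  define T where "T = {t \<in> ?I. \<sigma> (cis t) \<in> fst c}"
  have "openin (top_of_set (sphere 0 1)) {z \<in> sphere 0 1. \<sigma> z \<in> fst c}"
    using openin_continuous_map_preimage[of "mtop circle" "mtop M" \<sigma>, OF _ chart_openin[OF c]] \<sigma>s
    by (simp add: smooth_map_def mtop_circle)
  then obtain W where W: "open W" "{z \<in> sphere 0 1. \<sigma> z \<in> fst c} = sphere 0 1 \<inter> W"
    unfolding openin_open by blast
  have "\<sigma> (cis t) \<in> fst c \<longleftrightarrow> cis t \<in> W" for t
    using eqset_imp_iff[OF W(2), of "cis t"] by simp
  then have "T = ?I \<inter> cis -` W" by (auto simp: T_def)
  then have T: "open T"
    using continuous_open_preimage[OF continuous_on_cis[OF continuous_on_id, of ?I] _ W(1)] by simp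
  have sT: "s \<in> T" using sI s by (simp add: T_def)
  have "smooth_on (snd ?k ` {z \<in> fst ?k. \<sigma> z \<in> fst c}) (snd c \<circ> \<sigma> \<circ> chart_inv ?k)"
    using \<sigma>s c k unfolding smooth_map_def by blast
  then have "smooth_on T (snd c \<circ> \<sigma> \<circ> chart_inv ?k)"
    unfolding circle_chart_image T_def .
  then have sm': "smooth_on T (snd c \<circ> (\<sigma> \<circ> chart_inv ?k))" by (simp add: o_assoc)
  have eq: "(snd c \<circ> (\<sigma> \<circ> chart_inv ?k)) t = ?\<gamma> t" if "t \<in> T" for t
    using that by (simp add: T_def circle_chart_inv)
  have sm: "smooth_on T ?\<gamma>" by (rule smooth_on_cong[OF T eq sm'])
  have dd: "dd (snd c \<circ> (\<sigma> \<circ> chart_inv ?k)) s = dd ?\<gamma> s"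
    by (rule dd_cong_open[OF T sT eq])
  have "dd ?\<gamma> s 1 \<noteq> 0"
  proof
    \<comment> \<open>With zero velocity the differential of \<sigma> would kill the unit coordinate
      vector of the circle. An immersion then makes that vector zero, which the sine test function
      refutes.\<close>
    assume 0: "dd ?\<gamma> s 1 = 0"
    define \<xi> where "\<xi> = coord_vec circle ?k s 1"
    have ks: "chart_inv ?k s = cis s" by (rule circle_chart_inv[OF sI])
    have "\<xi> \<in> tangent_space circle (cis s)"
      unfolding tangent_space_def \<xi>_def using k sI
      by (intro CollectI exI[of _ ?k] exI[of _ 1]) (auto simp: circle_chart_simps)
    moreover have "differential M \<sigma> (cis s) \<xi> = (\<lambda>_. 0)"
    proof
      fix f
      show "differential M \<sigma> (cis s) \<xi> f = 0"
      proof (cases "smooth_near M (\<sigma> (cis s)) f")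
        case True
        then have f: "smooth_near M ((\<sigma> \<circ> chart_inv ?k) s) f" by (simp add: ks)
        have TT: "(\<sigma> \<circ> chart_inv ?k) t \<in> fst c" if "t \<in> T" for t
          using that by (simp add: T_def circle_chart_inv)
        obtain R where "open R" "snd c (\<sigma> (cis s)) \<in> R" "smooth_on R (f \<circ> chart_inv c)"
          using smooth_near_chart[OF c s True] by blast
        then have "linear (dd (f \<circ> chart_inv c) (snd c (\<sigma> (cis s))))"
          using linear_dd smooth_on_imp_differentiable by blast
        then have "dd (f \<circ> (\<sigma> \<circ> chart_inv ?k)) s 1 = 0"
          using compose_chart(2)[where \<Phi> = "\<sigma> \<circ> chart_inv ?k", OF c T sT TT sm' f, of 1]
          unfolding dd 0 by (simp add: o_assoc ks linear_0)
        then show ?thesis by (simp add: differential_def \<xi>_def coord_vec_def o_assoc)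
      qed (simp add: differential_def)
    qed
    ultimately have "\<xi> = (\<lambda>_. 0)" using imm[of "cis s" \<xi>] by simp
    moreover have "\<xi> (\<lambda>z. Im (z / cis s)) = 1"
    proof -
      have "dd ((\<lambda>z. Im (z / cis s)) \<circ> chart_inv ?k) s = dd (\<lambda>t. sin (t - s)) s"
        by (rule dd_cong_open[OF _ sI]) (auto simp: circle_chart_inv cis_divide)
      also have "\<dots> = (\<lambda>v. v)"
        by (rule dd_eqI) (auto intro!: derivative_eq_intros)
      finally show ?thesis
        using smooth_near_circle_sin[of "cis s" s] by (simp add: \<xi>_def coord_vec_def ks)
    qed
    ultimately show False by simp
  qed
  then show ?thesis using T sT sm by (auto simp: T_def intro!: exI[of _ T])
qed

text \<open>An embedding is a homeomorphism onto its image, so convergence of fiber points, seen in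
  a chart of M, pulls back to their parameters on the circle.\<close>

lemma circle_embedding_converge:
  assumes \<sigma>: "embedding_map (mtop circle) (mtop M) \<sigma>" and c: "c \<in> charts M"
    and z: "\<And>n. z n \<in> sphere 0 1" "z0 \<in> sphere 0 1" and x: "\<And>n. x n \<in> chart_img c" "x0 \<in> chart_img c"
    and \<sigma>z: "\<And>n. \<sigma> (z n) = chart_inv c (x n)" "\<sigma> z0 = chart_inv c x0" and lim: "x \<longlonglongrightarrow> x0"
  shows "z \<longlonglongrightarrow> z0"
proof (rule topological_tendstoI)
  fix W :: "complex set" assume W: "open W" "z0 \<in> W"
  let ?S = "sphere 0 1 :: complex set"
  have h: "homeomorphic_map (top_of_set ?S) (subtopology (mtop M) (\<sigma> ` ?S)) \<sigma>"
    using \<sigma> by (simp add: embedding_map_def mtop_circle)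
  have inj: "inj_on \<sigma> ?S" using homeomorphic_imp_injective_map[OF h] by simp
  have "openin (top_of_set ?S) (?S \<inter> W)" using W(1) by (simp add: openin_open_Int)
  then have "openin (subtopology (mtop M) (\<sigma> ` ?S)) (\<sigma> ` (?S \<inter> W))"
    using homeomorphic_imp_open_map[OF h] unfolding open_map_def by blast
  then obtain R where R: "openin (mtop M) R" "\<sigma> ` (?S \<inter> W) = R \<inter> \<sigma> ` ?S"
    unfolding openin_subtopology by blast
  have "\<sigma> z0 \<in> R" using R(2) z(2) W(2) by blast
  then have "x0 \<in> snd c ` (fst c \<inter> R)" using x(2) \<sigma>z(2) by (simp add: chart_image_iff[OF c])
  then have "\<forall>\<^sub>F n in sequentially. x n \<in> snd c ` (fst c \<inter> R)"
    using topological_tendstoD[OF lim chart_image_open[OF c R(1)]] by blast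
  then show "\<forall>\<^sub>F n in sequentially. z n \<in> W"
  proof eventually_elim
    case (elim n)
    then have "\<sigma> (z n) \<in> R \<inter> \<sigma> ` ?S"
      using \<sigma>z(1)[of n] imageI[OF z(1)[of n], of \<sigma>] by (simp add: chart_image_iff[OF c])
    then have "\<sigma> (z n) \<in> \<sigma> ` (?S \<inter> W)" using R(2) by simp
    then obtain w where w: "w \<in> ?S" "w \<in> W" "\<sigma> (z n) = \<sigma> w" by blast
    then show ?case using inj_onD[OF inj w(3) z(1) w(1)] by simp
  qed
qed

end

text \<open>Division by \<open>cis s0\<close> moves the limit to 1, where \<open>Arg\<close> is
  continuous, so the angles can be chosen convergent to \<open>s0\<close>.\<close>

lemma circle_lift_sequence:
  assumes z: "\<And>n. z n \<in> sphere 0 1" and lim: "z \<longlonglongrightarrow> cis s0"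
  shows "\<exists>s. (\<forall>n. cis (s n) = z n) \<and> s \<longlonglongrightarrow> s0"
proof -
  define s where "s n = s0 + Arg (z n / cis s0)" for n
  have nz: "norm (z n) = 1" for n using z[of n] by simp
  have "cis (s n) = z n" for n
  proof -
    have "cis (Arg (z n / cis s0)) = z n / cis s0"
      using nz[of n] by (subst cis_Arg) (auto simp: sgn_div_norm norm_divide)
    then show ?thesis by (simp add: s_def cis_mult[symmetric])
  qed
  moreover have "s \<longlonglongrightarrow> s0"
  proof -
    have "(\<lambda>n. z n / cis s0) \<longlonglongrightarrow> cis s0 / cis s0" by (intro tendsto_intros lim) simp
    then have "(\<lambda>n. z n / cis s0) \<longlonglongrightarrow> 1" by simp
    from isCont_tendsto_compose[OF continuous_at_Arg this]
    have "(\<lambda>n. Arg (z n / cis s0)) \<longlonglongrightarrow> 0" by simp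
    from tendsto_add[OF tendsto_const[of s0] this] show ?thesis by (simp add: s_def[abs_def])
  qed
  ultimately show ?thesis by blast
qed

context smooth_mfd_map
begin

lemma kernel_line:
  assumes c: "c \<in> charts M" and d: "d \<in> charts B" and x: "x \<in> dom c d"
    and \<sigma>: "smooth_embedding circle M \<sigma>"
    and fiber: "\<sigma> ` sphere 0 1 = {p \<in> topspace (mtop M). \<pi> p = \<pi> (chart_inv c x)}"
    and surj: "surj (dd (rep c d) x)"
  shows "\<exists>k. k \<noteq> 0 \<and> {u. dd (rep c d) x u = 0} = range (\<lambda>r. r *\<^sub>R k)"
proof -
  have xi: "x \<in> chart_img c" using x by (simp add: dom_iff c)
  have fib: "\<exists>z\<in>sphere 0 1. \<sigma> z = chart_inv c y"
    if "y \<in> chart_img c" "\<pi> (chart_inv c y) = \<pi> (chart_inv c x)" for y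
  proof -
    have "chart_inv c y \<in> topspace (mtop M)" using M.chart_inv_in[OF that(1)] M.chart_subset[OF c] by blast
    then have "chart_inv c y \<in> \<sigma> ` sphere 0 1" using that(2) fiber by simp
    then show ?thesis by force
  qed
  obtain z0 where z0: "z0 \<in> sphere 0 1" "\<sigma> z0 = chart_inv c x" using fib[OF xi refl] by blast
  have "cis (Arg z0) = z0" using z0(1) by (subst cis_Arg) (auto simp: sgn_div_norm)
  then obtain s0 where s0: "z0 = cis s0" by metis
  define \<gamma> where "\<gamma> t = snd c (\<sigma> (cis t))" for t
  define k where "k = dd \<gamma> s0 1"
  have "\<sigma> (cis s0) \<in> fst c" using z0(2) M.chart_inv_in[OF xi] by (simp add: s0)
  from M.circle_embedding_velocity[OF \<sigma> c this] obtain T where T: "open T" "s0 \<in> T"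
    "\<And>t. t \<in> T \<Longrightarrow> \<sigma> (cis t) \<in> fst c" "smooth_on T \<gamma>" and k0: "k \<noteq> 0"
    unfolding \<gamma>_def[abs_def] k_def by blast
  have \<gamma>0: "\<gamma> s0 = x" using z0(2) M.chart_inv_right[OF xi] by (simp add: \<gamma>_def s0)
  have d\<gamma>: "(\<gamma> has_derivative (\<lambda>r. r *\<^sub>R k)) (at s0)"
  proof -
    have h: "(\<gamma> has_derivative dd \<gamma> s0) (at s0)" by (rule smooth_on_has_derivative[OF T(4,2)])
    have "dd \<gamma> s0 r = r *\<^sub>R k" for r
      using linear_cmul[OF has_derivative_linear[OF h], of r 1] by (simp add: k_def)
    then have "dd \<gamma> s0 = (\<lambda>r. r *\<^sub>R k)" by (rule ext)
    then show ?thesis using h by simp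
  qed
  have diff: "rep c d differentiable (at x)"
    by (rule smooth_on_imp_differentiable[OF rep_smooth[OF c d] x])
  have "dd (rep c d) x k = 0"
  proof -
    have "((\<lambda>t. rep c d (\<gamma> t)) has_derivative (\<lambda>r. dd (rep c d) x (r *\<^sub>R k))) (at s0)"
      using has_derivative_compose_dd[OF d\<gamma>, of "rep c d"] diff by (simp add: \<gamma>0)
    moreover have "((\<lambda>t. rep c d (\<gamma> t)) has_derivative (\<lambda>r. 0)) (at s0)"
    proof (rule has_derivative_transform_within_open[OF has_derivative_const T(1,2)])
      fix t assume "t \<in> T"
      moreover have "cis t \<in> sphere 0 1" by simp
      then have "\<pi> (\<sigma> (cis t)) = \<pi> (chart_inv c x)" using fiber by blast
      ultimately show "snd d (\<pi> (chart_inv c x)) = rep c d (\<gamma> t)"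
        by (simp add: rep_def \<gamma>_def M.chart_inv_left[OF c] T(3))
    qed
    ultimately have "dd (rep c d) x (1 *\<^sub>R k) = 0"
      using has_derivative_unique by (metis (no_types, lifting))
    then show ?thesis by simp
  qed
  then have "range (\<lambda>r. r *\<^sub>R k) \<subseteq> {u. dd (rep c d) x u = 0}"
    by (auto simp: linear_cmul[OF linear_dd[OF diff]])
  moreover have "\<exists>r. u = r *\<^sub>R k" if u: "dd (rep c d) x u = 0" for u
  proof -
    \<comment> \<open>Points with equal values of \<open>rep c d\<close> lie on one fiber, so the
      sequence has parameters on the circle. These converge and lift to convergent angles, which
      puts the secants into the form required by \<open>tangent_of_curve\<close>.\<close>
    obtain xs t where xs: "\<And>n. xs n \<in> dom c d" "\<And>n. rep c d (xs n) = rep c d x" "\<And>n. t n > 0"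
      "xs \<longlonglongrightarrow> x" "(\<lambda>n. (xs n - x) /\<^sub>R t n) \<longlonglongrightarrow> u"
      using kernel_tangent_sequence[OF dom_open[OF c d] x rep_smooth[OF c d] surj u] by blast
    have xsi: "xs n \<in> chart_img c" for n using xs(1)[of n] by (simp add: dom_iff c)
    have "\<pi> (chart_inv c (xs n)) = \<pi> (chart_inv c x)" for n
      using rep_in(2)[OF c d xs(1)[of n]] rep_in(2)[OF c d x] xs(2)[of n] by simp
    then have "\<exists>z. \<forall>n. z n \<in> sphere 0 1 \<and> \<sigma> (z n) = chart_inv c (xs n)"
      using fib[OF xsi] by (intro choice) blast
    then obtain z where z: "\<And>n. z n \<in> sphere 0 1" "\<And>n. \<sigma> (z n) = chart_inv c (xs n)" by blast
    have "z \<longlonglongrightarrow> cis s0"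
      by (rule M.circle_embedding_converge[OF _ c z(1) _ xsi xi z(2) _ xs(4)])
        (use \<sigma> z0 s0 in \<open>auto simp: smooth_embedding_def\<close>)
    from circle_lift_sequence[OF z(1) this] obtain s where s: "\<And>n. cis (s n) = z n" "s \<longlonglongrightarrow> s0" by blast
    have "\<gamma> (s n) = xs n" for n by (simp add: \<gamma>_def s(1) z(2) M.chart_inv_right[OF xsi])
    then show ?thesis
      using tangent_of_curve[OF d\<gamma> k0 s(2) xs(3)] xs(5) by (simp add: \<gamma>0)
  qed
  ultimately show ?thesis using k0 by blast
qed

lemma chart_submersion:
  assumes g: "riemannian_metric M g" and h: "riemannian_metric B h"
    and sub: "riemannian_submersion M g B h \<pi>" and fib: "circle_fibers M B \<pi>"
    and tg: "totally_geodesic_fibers M g B \<pi>" and c: "c \<in> charts M" and d: "d \<in> charts B"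
  shows "submersion (dom c d) (local_metric M g c) (chart_img d) (local_metric B h d) (rep c d)
    (local_vertical M B \<pi> c)"
proof
  show "smooth_metric (dom c d) (local_metric M g c)"
    by (rule smooth_metric_subset[OF M.metric_chart[OF g c] dom_open[OF c d]]) (auto simp: dom_iff c)
  show "smooth_metric (chart_img d) (local_metric B h d)" by (rule B.metric_chart[OF h d])
  show "smooth_on (dom c d) (rep c d)" by (rule rep_smooth[OF c d])
  fix y assume y: "y \<in> dom c d"
  have yi: "y \<in> chart_img c" using y by (simp add: dom_iff c)
  have p: "chart_inv c y \<in> topspace (mtop M)" using M.chart_inv_in[OF yi] M.chart_subset[OF c] by blast
  show "rep c d y \<in> chart_img d" by (rule rep_in(1)[OF c d y])
  have "differential B \<pi> (chart_inv c y) ` tangent_space M (chart_inv c y) = tangent_space B (\<pi> (chart_inv c y))"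
    using sub p unfolding riemannian_submersion_def by blast
  then show surj: "surj (dd (rep c d) y)" by (rule rep_surj[OF c d y])
  show V: "local_vertical M B \<pi> c y = {u. dd (rep c d) y u = 0}"
    by (rule local_vertical_eq[OF c d y])
  have "\<pi> (chart_inv c y) \<in> topspace (mtop B)"
    using y B.chart_subset[OF d] by (auto simp: dom_iff c)
  then obtain \<sigma> where \<sigma>: "smooth_embedding circle M \<sigma>"
    "\<sigma> ` sphere 0 1 = {p \<in> topspace (mtop M). \<pi> p = \<pi> (chart_inv c y)}"
    using fib unfolding circle_fibers_def by (auto simp: mtop_circle)
  show "\<exists>k. k \<noteq> 0 \<and> local_vertical M B \<pi> c y = range (\<lambda>c. c *\<^sub>R k)"
    unfolding V by (rule kernel_line[OF c d y \<sigma> surj])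
  show "local_metric B h d (rep c d y) (dd (rep c d) y u) (dd (rep c d) y v) = local_metric M g c y u v"
    if "u \<in> orth_compl (local_metric M g c) (local_vertical M B \<pi> c) y"
      "v \<in> orth_compl (local_metric M g c) (local_vertical M B \<pi> c) y" for u v
    using sub p horizontal_coord[OF c yi that(1)] horizontal_coord[OF c yi that(2)]
    unfolding riemannian_submersion_def local_metric_def rep_in(2)[OF c d y]
      differential_coord[OF c d y, symmetric] by blast
  show "second_ff (local_metric M g c) (local_vertical M B \<pi> c) (\<lambda>_. u) (\<lambda>_. v) y = 0" for u v
    using tg c yi unfolding totally_geodesic_fibers_def by blast
qed

end

theorem lemma3p4:
  fixes M :: "('a, 'v::findim_inner) mfd" and g :: "'a metric_tensor"
    and B :: "('b, 'w::findim_inner) mfd" and h :: "'b metric_tensor"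
    and \<pi> :: "'a \<Rightarrow> 'b" and X :: "'a \<Rightarrow> 'a tvec"
  assumes "smooth_manifold M" and "riemannian_metric M g" and "compact_space (mtop M)"
    and "constant_scalar_curvature M g"
    and "smooth_manifold B" and "riemannian_metric B h"
    and "riemannian_submersion M g B h \<pi>"
    and "circle_fibers M B \<pi>" and "totally_geodesic_fibers M g B \<pi>"
    and "smooth_vector_field M X"
    and "\<forall>p\<in>topspace (mtop M). X p \<in> vertical_space M B \<pi> p"
    and "quasi_einstein M g X"
  shows "constant_oneill_norm M g B \<pi> \<and> constant_scalar_curvature B h"
proof -
  interpret smooth_mfd_map M B \<pi>
    using assms(1,5,7) by unfold_locales (auto simp: riemannian_submersion_def)
  obtain S where S: "\<And>c x. c \<in> charts M \<Longrightarrow> x \<in> chart_img c \<Longrightarrow> scal (local_metric M g c) x = S"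
    using assms(4) unfolding constant_scalar_curvature_def by blast
  obtain m \<Lambda> :: real where qe: "\<And>c x u v. c \<in> charts M \<Longrightarrow> x \<in> chart_img c \<Longrightarrow>
      ricci (local_metric M g c) x u v
        + 1 / 2 * lie_derivative_metric (local_metric M g c) (local_field M X c) x u v
        - 1 / m * (local_metric M g c x (local_field M X c x) u * local_metric M g c x (local_field M X c x) v)
      = \<Lambda> * local_metric M g c x u v"
    using assms(12) unfolding quasi_einstein_def Let_def by blast
  \<comment> \<open>The rank of the horizontal distribution, one less than the dimension of
    M.\<close>
  define n where "n = real (dim (UNIV :: 'v set)) - 1"
  \<comment> \<open>The right-hand sides mention neither charts nor points, so constancy follows
    from the pointwise formulas once every point is covered by some pair of charts.\<close>
  have main: "oneill_A_norm (local_metric M g c) (local_vertical M B \<pi> c) x = sqrt (S - n * \<Lambda>)"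
    "scal (local_metric B h d) (rep c d x) = 2 * S - n * \<Lambda>"
    if c: "c \<in> charts M" and d: "d \<in> charts B" and x: "x \<in> dom c d" for c d x
  proof -
    interpret L: submersion "dom c d" "local_metric M g c" "chart_img d" "local_metric B h d"
      "rep c d" "local_vertical M B \<pi> c"
      by (rule chart_submersion[OF assms(2,6,7,8,9) c d])
    have dom: "dom c d \<subseteq> chart_img c" by (auto simp: dom_iff c)
    have Y: "smooth_on (dom c d) (local_field M X c)"
      by (rule smooth_on_subset[OF _ dom]) (use assms(10) c in \<open>simp add: smooth_vector_field_def\<close>)
    have V: "local_field M X c y \<in> local_vertical M B \<pi> c y" if "y \<in> dom c d" for y
    proof -
      have y: "y \<in> chart_img c" using dom that by blast
      have "X (chart_inv c y) \<in> vertical_space M B \<pi> (chart_inv c y)"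
        using assms(11) M.chart_inv_in[OF y] M.chart_subset[OF c] by blast
      then show ?thesis
        using M.local_field_eq[OF c y] by (simp add: local_vertical_def vertical_space_def)
    qed
    have xi: "x \<in> chart_img c" using dom x by blast
    note R = L.quasi_einstein_conclusion[OF x Y V qe[OF c xi]]
    show "oneill_A_norm (local_metric M g c) (local_vertical M B \<pi> c) x = sqrt (S - n * \<Lambda>)"
      "scal (local_metric B h d) (rep c d x) = 2 * S - n * \<Lambda>"
      using R by (simp_all add: S[OF c xi] n_def)
  qed
  have "constant_oneill_norm M g B \<pi>"
    unfolding constant_oneill_norm_def
  proof (intro exI ballI)
    fix c x assume c: "c \<in> charts M" and x: "x \<in> chart_img c"
    have "\<pi> (chart_inv c x) \<in> topspace (mtop B)"
      using assms(7) M.chart_inv_in[OF x] M.chart_subset[OF c] unfolding riemannian_submersion_def by blast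
    then obtain d where d: "d \<in> charts B" "\<pi> (chart_inv c x) \<in> fst d" using B.charts_cover by blast
    then show "oneill_A_norm (local_metric M g c) (local_vertical M B \<pi> c) x = sqrt (S - n * \<Lambda>)"
      using main(1)[OF c d(1)] x by (simp add: dom_iff c)
  qed
  moreover have "constant_scalar_curvature B h"
    unfolding constant_scalar_curvature_def
  proof (intro exI ballI)
    fix d z assume d: "d \<in> charts B" and z: "z \<in> chart_img d"
    \<comment> \<open>Curvature of B is known only at points of the form \<open>rep c d x\<close>.
      Surjectivity of \<pi> shows that every \<open>z\<close> is of this form.\<close>
    have "chart_inv d z \<in> topspace (mtop B)" using B.chart_inv_in[OF z] B.chart_subset[OF d] by blast
    then obtain p where p: "p \<in> topspace (mtop M)" "\<pi> p = chart_inv d z"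
      using assms(7) unfolding riemannian_submersion_def by (metis imageE)
    then obtain c where c: "c \<in> charts M" "p \<in> fst c" using M.charts_cover by blast
    have "rep c d (snd c p) = z"
      using p(2) M.chart_inv_left[OF c] B.chart_inv_right[OF z] by (simp add: rep_def)
    moreover have "snd c p \<in> dom c d"
      using p(2) B.chart_inv_in[OF z] c(2) by (auto simp: dom_def)
    ultimately show "scal (local_metric B h d) z = 2 * S - n * \<Lambda>"
      using main(2)[OF c(1) d] by metis
  qed
  ultimately show ?thesis ..
qed

end
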